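(* Let $d\ge 2$, $1\le k<d$, and let $E\subset[0,1]^d$ be the fractal percolation set with integer parameter $M\ge 2$ and retention probabilities $\{p_{\mathbf A}\}_{\mathbf A\in\mathcal A_1}$, $0<p_{\mathbf A}<1$. Suppose that Condition $A(\alpha)$ holds for every orthonormal $k$-tuple $\alpha$ in $\mathbb R^d$ such that $S_\alpha$ is not a coordinate plane. Suppose in addition that for all distinct $j_1,\dots,j_k\in[d]$ and all $i^{(j_1)},\dots,i^{(j_k)}\in\{0,\dots,M-1\}$ $$\sum_{\substack{\mathbf A\in\mathcal A_1:\\ A_{j_\ell,1}=i^{(j_\ell)}\ \forall \ell\in[k]}} p_{\mathbf A}>1 .$$ Then, almost surely conditioned on $E\neq\emptyset$, for all orthonormal $k$-tuples $\alpha$ simultaneously, the orthogonal projection $\mathrm{proj}_\alpha(E)$ of $E$ to $S_\alpha$ has nonempty interior (relative to $S_\alpha$).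
   Context: **Notation.** $[d]=\{1,\dots,d\}$, $K=[0,1]^d$, $\mathcal A_n=\{0,\dots,M-1\}^{d\times n}$ (so elements of $\mathcal A_1$ are column vectors of length $d$). For $\mathbf A\in\mathcal A_n$ let $\varphi_{\mathbf A}(\mathbf x)=M^{-n}\mathbf x+\mathbf A\,(M^{-1},\dots,M^{-n})^T$ and $K_{\mathbf A}=\varphi_{\mathbf A}(K)$, a level-$n$ cube of side $M^{-n}$. **Fractal percolation.** $K$ itself is retained at level $0$. If $K_{\mathbf A}$, $\mathbf A\in\mathcal A_n$, is not retained then no $K_{(\mathbf A|\mathbf C)}$, $\mathbf C\in\mathcal A_1$, is retained; if $K_{\mathbf A}$ is retained then each $K_{(\mathbf A|\mathbf C)}$ is retained with probability $p_{\mathbf C}$, all choices being independent. Here $(\mathbf A|\mathbf C)\in\mathcal A_{n+1}$ is $\mathbf A$ with the column $\mathbf C$ appended. Let $\mathcal E_n\subseteq\mathcal A_n$ be the random set of indices of retained level-$n$ cubes, $E_n=\bigcup_{\mathbf A\in\mathcal E_n}K_{\mathbf A}$, and $E=\bigcap_{n\ge1}E_n$. **Directions and projections.** $\alpha=\{\mathbf a^{(1)},\dots,\mathbf a^{(k)}\}$ denotes an orthonormal set of vectors in $\mathbb R^d$ and $S_\alpha=\mathrm{span}(\alpha)$; $\mathrm{proj}_\alpha$ is the orthogonal projection of $\mathbb R^d$ onto $S_\alpha$. Let $\mathbf e^{(i)}$ be the $i$-th standard unit vector. $S_\alpha$ is a coordinate plane if $S_\alpha=\mathrm{span}\{\mathbf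 e^{(j_1)},\dots,\mathbf e^{(j_k)}\}$ for some distinct $j_1,\dots,j_k\in[d]$. Let $\mathbf c^{(1)},\dots,\mathbf c^{(d-k)}$ be an orthonormal basis of $S_\alpha^\perp$ and let $C$ be the $d\times(d-k)$ matrix with these columns. Choose a $k$-element set $\mathcal I\subset[d]$ such that the $(d-k)\times(d-k)$ submatrix of $C$ formed by the rows with indices in $[d]\setminus\mathcal I$ has determinant of absolute value greater than $\frac{1}{2\sqrt{\binom dk}}$ (such $\mathcal I$ exists). Let $\Pi_\alpha$ be the linear projection of $\mathbb R^d$ onto $S_{\mathcal I}=\mathrm{span}\{\mathbf e^{(i)}:i\in\mathcal I\}$ along $S_\alpha^\perp$, i.e. $\Pi_\alpha(\mathbf x)$ is the unique point of $(\mathbf x+S_\alpha^\perp)\cap S_{\mathcal I}$. **Condition $A(\alpha)$.** Let $\Delta_\alpha=\Pi_\alpha(K)\subset S_{\mathcal I}$. For $\mathbf A\in\mathcal A_n$ let $\psi_{\alpha,\mathbf A}:\Pi_\alpha(K_{\mathbf A})\to\Delta_\alpha$ be the inverse of the homothety $\Delta_\alpha\to\Pi_\alpha(K_{\mathbf A})$, $\Pi_\alpha(\mathbf x)\mapsto\Pi_\alpha(\varphi_{\mathbf A}(\mathbf x))$ $(\mathbf x\in K)$. For functions $f:\Delta_\alpha\to[0,\infty)$ vanishing on the boundary of $\Delta_\alpha$ put $$F_\alpha f(x)=\sum_{\mathbf A\in\mathcal A_1:\ x\in\Pi_\alpha(K_{\mathbf A})}p_{\mathbf A}\, f(\psi_{\alpha,\mathbf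 A}(x)),\qquad x\in\Delta_\alpha,$$ and let $F_\alpha^r$ be its $r$-th iterate. Interiors of subsets of $\Delta_\alpha$ are taken in $S_{\mathcal I}$. Condition $A(\alpha)$ holds if there exist $I_1^\alpha,I_2^\alpha\subset\Delta_\alpha$, homothetic copies of $\Delta_\alpha$ under homotheties centred at the centre of $\Delta_\alpha$, and a positive integer $r=r_\alpha$ such that (i) $I_1^\alpha\subset\mathrm{int}\,I_2^\alpha$ and $I_2^\alpha\subset\mathrm{int}\,\Delta_\alpha$; (ii) $F_\alpha^r\mathbf 1_{I_1^\alpha}\ge 2\cdot\mathbf 1_{I_2^\alpha}$ pointwise on $\Delta_\alpha$. *)

theory Defs
  imports "HOL-Probability.Probability"
begin

section \<open>Cubes and fractal percolation\<close>

text \<open>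
  The index type \<open>'d\<close> plays the role of \<open>[d]\<close>, so \<open>d = CARD('d)\<close>. A matrix in
  \<open>{0,\<dots>,M-1}\<^bsup>d\<times>n\<^esup>\<close> is represented by the list of its \<open>n\<close> columns; appending the
  column \<open>C\<close> to \<open>A\<close> is \<open>A @ [C]\<close>.
\<close>

definition digits :: "nat \<Rightarrow> (nat ^ 'd) set" where
  "digits M = {C. \<forall>i. C $ i < M}"

definition words :: "nat \<Rightarrow> nat \<Rightarrow> (nat ^ 'd) list set" where
  "words M n = {A. length A = n \<and> set A \<subseteq> digits M}"

definition unit_cube :: "(real ^ 'd) set" where
  "unit_cube = {x. \<forall>i. 0 \<le> x $ i \<and> x $ i \<le> 1}"

definition cube_map :: "nat \<Rightarrow> (nat ^ 'd) list \<Rightarrow> real ^ 'd \<Rightarrow> real ^ 'd" where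
  "cube_map M A x =
     (\<chi> i. x $ i / real M ^ length A + (\<Sum>l<length A. real (A ! l $ i) / real M ^ Suc l))"

definition cube :: "nat \<Rightarrow> (nat ^ 'd) list \<Rightarrow> (real ^ 'd) set" where
  "cube M A = cube_map M A ` unit_cube"

text \<open>
  \<open>X (A @ [C]) \<omega>\<close> is the choice whether the cube with index \<open>A @ [C]\<close> is kept given that its
  parent is kept. The choices below discarded cubes exist as well, but have no influence on
  \<open>retained\<close>.
\<close>

locale fractal_percolation = prob_space P
  for P :: "'w measure" +
  fixes M :: nat
    and p :: "nat ^ 'd \<Rightarrow> real"
    and X :: "(nat ^ 'd) list \<Rightarrow> 'w \<Rightarrow> bool"
  assumes indep_choices:
      "indep_vars (\<lambda>_. count_space UNIV) X (\<Union>n. words M (Suc n))"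
    and prob_choice:
      "\<And>n A C. A \<in> words M n \<Longrightarrow> C \<in> digits M \<Longrightarrow>
         prob {\<omega> \<in> space P. X (A @ [C]) \<omega>} = p C"

primrec retained ::
  "nat \<Rightarrow> ((nat ^ 'd) list \<Rightarrow> 'w \<Rightarrow> bool) \<Rightarrow> nat \<Rightarrow> 'w \<Rightarrow> (nat ^ 'd) list set" where
  "retained M X 0 \<omega> = {[]}"
| "retained M X (Suc n) \<omega> =
     {A @ [C] | A C. A \<in> retained M X n \<omega> \<and> C \<in> digits M \<and> X (A @ [C]) \<omega>}"

definition level_set ::
  "nat \<Rightarrow> ((nat ^ 'd) list \<Rightarrow> 'w \<Rightarrow> bool) \<Rightarrow> nat \<Rightarrow> 'w \<Rightarrow> (real ^ 'd) set" where
  "level_set M X n \<omega> = (\<Union>A \<in> retained M X n \<omega>. cube M A)"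

definition percolation_set ::
  "nat \<Rightarrow> ((nat ^ 'd) list \<Rightarrow> 'w \<Rightarrow> bool) \<Rightarrow> 'w \<Rightarrow> (real ^ 'd) set" where
  "percolation_set M X \<omega> = (\<Inter>n\<in>{1..}. level_set M X n \<omega>)"


section \<open>Directions and projections\<close>

definition orthonormal :: "(real ^ 'd) set \<Rightarrow> bool" where
  "orthonormal \<alpha> \<longleftrightarrow> pairwise orthogonal \<alpha> \<and> (\<forall>a\<in>\<alpha>. norm a = 1)"

definition coord_plane :: "'d set \<Rightarrow> (real ^ 'd) set" where
  "coord_plane J = span ((\<lambda>j. axis j 1) ` J)"

text \<open>
  The linear projection onto \<open>U\<close> along \<open>W\<close>, for complementary subspaces \<open>U\<close> and \<open>W\<close>:
  the unique point of \<open>(x + W) \<inter> U\<close>.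
\<close>

definition proj_along :: "(real ^ 'd) set \<Rightarrow> (real ^ 'd) set \<Rightarrow> real ^ 'd \<Rightarrow> real ^ 'd" where
  "proj_along U W x = (THE y. y \<in> (+) x ` W \<inter> U)"

definition orth_proj :: "(real ^ 'd) set \<Rightarrow> real ^ 'd \<Rightarrow> real ^ 'd" where
  "orth_proj \<alpha> = proj_along (span \<alpha>) (orthogonal_comp (span \<alpha>))"

text \<open>
  The Leibniz formula of \<^const>\<open>det\<close>, for a matrix whose rows and columns are indexed by a
  finite set \<open>J\<close> instead of a type.
\<close>

definition det_on :: "'d set \<Rightarrow> ('d \<Rightarrow> 'd \<Rightarrow> real) \<Rightarrow> real" where
  "det_on J B = (\<Sum>\<sigma> | \<sigma> permutes J. of_int (sign \<sigma>) * (\<Prod>i\<in>J. B i (\<sigma> i)))"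

text \<open>
  Here the orthonormal basis \<open>c\<close> of the orthogonal complement of the span of \<open>\<alpha>\<close> is
  labelled by \<open>- I\<close>, a set of \<open>d - k\<close> elements, rather than by \<open>{1,\<dots>,d-k}\<close>. Relabelling the
  basis vectors only changes the sign of the determinant. Likewise, passing to another
  orthonormal basis does not change its absolute value.
\<close>

definition admissible :: "(real ^ 'd) set \<Rightarrow> 'd set \<Rightarrow> bool" where
  "admissible \<alpha> I \<longleftrightarrow>
     card I = card \<alpha> \<and>
     (\<exists>c :: 'd \<Rightarrow> real ^ 'd.
        (\<forall>i\<in>- I. \<forall>j\<in>- I. c i \<bullet> c j = (if i = j then 1 else 0)) \<and>
        span (c ` (- I)) = orthogonal_comp (span \<alpha>) \<and>
        \<bar>det_on (- I) (\<lambda>i j. c j $ i)\<bar> > 1 / (2 * sqrt (real (CARD('d) choose card \<alpha>))))"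

definition oblique_proj :: "(real ^ 'd) set \<Rightarrow> 'd set \<Rightarrow> real ^ 'd \<Rightarrow> real ^ 'd" where
  "oblique_proj \<alpha> I = proj_along (coord_plane I) (orthogonal_comp (span \<alpha>))"


section \<open>Condition A\<close>

definition shadow :: "(real ^ 'd) set \<Rightarrow> 'd set \<Rightarrow> (real ^ 'd) set" where
  "shadow \<alpha> I = oblique_proj \<alpha> I ` unit_cube"

text \<open>The inverse of \<open>oblique_proj \<alpha> I x \<mapsto> oblique_proj \<alpha> I (cube_map M A x)\<close>.\<close>

definition zoom ::
  "nat \<Rightarrow> (real ^ 'd) set \<Rightarrow> 'd set \<Rightarrow> (nat ^ 'd) list \<Rightarrow> real ^ 'd \<Rightarrow> real ^ 'd" where
  "zoom M \<alpha> I A y =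
     (THE z. \<exists>x\<in>unit_cube. z = oblique_proj \<alpha> I x \<and> y = oblique_proj \<alpha> I (cube_map M A x))"

text \<open>
  Functions on \<open>shadow \<alpha> I\<close> are represented by functions on the whole space. For points of
  \<open>shadow \<alpha> I\<close>, only the values of \<open>f\<close> on \<open>shadow \<alpha> I\<close> enter.
\<close>

definition F_op ::
  "nat \<Rightarrow> (nat ^ 'd \<Rightarrow> real) \<Rightarrow> (real ^ 'd) set \<Rightarrow> 'd set \<Rightarrow>
     (real ^ 'd \<Rightarrow> real) \<Rightarrow> real ^ 'd \<Rightarrow> real" where
  "F_op M p \<alpha> I f x =
     (\<Sum>C | C \<in> digits M \<and> x \<in> oblique_proj \<alpha> I ` cube M [C]. p C * f (zoom M \<alpha> I [C] x))"

text \<open>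
  The shadow is symmetric about the image of the centre of the unit cube, which is therefore
  its centre.
\<close>

definition shadow_centre :: "(real ^ 'd) set \<Rightarrow> 'd set \<Rightarrow> real ^ 'd" where
  "shadow_centre \<alpha> I = oblique_proj \<alpha> I (\<chi> i. 1 / 2)"

definition centred_copy :: "(real ^ 'd) set \<Rightarrow> 'd set \<Rightarrow> (real ^ 'd) set \<Rightarrow> bool" where
  "centred_copy \<alpha> I S \<longleftrightarrow>
     (\<exists>t::real. t \<noteq> 0 \<and>
        S = (\<lambda>z. shadow_centre \<alpha> I + t *\<^sub>R (z - shadow_centre \<alpha> I)) ` shadow \<alpha> I)"

definition condition_A ::
  "nat \<Rightarrow> (nat ^ 'd \<Rightarrow> real) \<Rightarrow> (real ^ 'd) set \<Rightarrow> 'd set \<Rightarrow> bool" where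
  "condition_A M p \<alpha> I \<longleftrightarrow>
     (\<exists>I1 I2 r.
        I1 \<subseteq> shadow \<alpha> I \<and> I2 \<subseteq> shadow \<alpha> I \<and>
        centred_copy \<alpha> I I1 \<and> centred_copy \<alpha> I I2 \<and> r \<ge> 1 \<and>
        I1 \<subseteq> top_of_set (coord_plane I) interior_of I2 \<and>
        I2 \<subseteq> top_of_set (coord_plane I) interior_of (shadow \<alpha> I) \<and>
        (\<forall>x\<in>shadow \<alpha> I. (F_op M p \<alpha> I ^^ r) (indicat_real I1) x \<ge> 2 * indicat_real I2 x))"

end

theory Submission
  imports Defs
begin

text \<open>
  Write \<open>W\<close> for the orthogonal complement of the span of \<open>\<alpha>\<close>. The projection of \<open>E\<close> has interior as soon as
  all fibres \<open>y + W\<close> with \<open>y\<close> in some ball meet \<open>E\<close>, and by compactness it suffices that they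
  meet retained cubes at arbitrarily high levels. Condition A says that a fibre passing near the
  centre of a cube passes on average near the centres of at least two of its retained
  descendants \<open>r\<close> levels below. This remains true for directions close to the given one. By
  Hoeffding's inequality, a fibre meeting at least \<open>(3/2)\<^sup>n\<close> retained cubes of level \<open>n r\<close> fails to
  meet \<open>(3/2)\<^bsup>n+1\<^esup>\<close> cubes \<open>r\<close> levels below with a probability that is doubly exponentially small in
  \<open>n\<close>, whereas only exponentially many pairs of a direction and a base point have to be considered
  at that scale. So with positive probability all these fibres meet \<open>E\<close>. A branching argument turns
  positive probability into almost sure occurrence in some subtree, given survival, and
  Lindelof's theorem reduces the non-coordinate directions to countably many neighbourhoods.
  For a coordinate plane the fibres are unions of columns of cubes, and the column sums of \<open>p\<close> play
  the role of Condition A.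
\<close>

subsection \<open>Cubes and retained words\<close>

text \<open>The uncountable family of fibres is controlled by a single event defined by countably
  many conditions, \<open>thriving\<close>: at every stage and for every fibre of a finite net, many
  cubes met widely are followed by many cubes met narrowly. What is deduced from this event is
  deterministic. Replacing a fibre by its neighbour in the net and returning costs a fixed relative
  enlargement of the target cubes, and this is paid for by the strict nesting of the two copies in
  Condition A. The union bound over the nets says nothing at low levels, where the failure bounds
  need not be small. There all cubes are forced to be retained, an event of positive probability on
  which growth is automatic, and the later failures are estimated on that event only. The resulting
  lower bound depends on the parameters and the nets, not on the percolation, hence it is the same
  for all subtrees. The branching argument needs exactly this uniformity. Only events read off from
  the tree of choices are measured; the statement about all projections at once follows pointwise on
  such events.\<close>

lemma finite_digits: "finite (digits M :: (nat ^ 'd) set)"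
proof -
  have "(digits M :: (nat ^ 'd) set) \<subseteq> vec_lambda ` (UNIV \<rightarrow>\<^sub>E {..<M})"
  proof
    fix C :: "nat ^ 'd" assume "C \<in> digits M"
    then have "C = vec_lambda (($) C)" "($) C \<in> UNIV \<rightarrow>\<^sub>E {..<M}"
      by (auto simp: digits_def)
    then show "C \<in> vec_lambda ` (UNIV \<rightarrow>\<^sub>E {..<M})" by blast
  qed
  then show ?thesis by (rule finite_subset) (intro finite_imageI finite_PiE; simp)
qed

lemma finite_words: "finite (words M n :: (nat ^ 'd) list set)"
  unfolding words_def using finite_lists_length_eq[OF finite_digits[of M], of n]
  by (simp add: conj_commute)

lemma words_0 [simp]: "words M 0 = {[]}"
  by (auto simp: words_def)

lemma words_append: "A @ B \<in> words M (m + n)" if "A \<in> words M m" "B \<in> words M n"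
  using that by (auto simp: words_def)

lemma words_split:
  assumes "B \<in> words M (m + n)"
  obtains A D where "B = A @ D" "A \<in> words M m" "D \<in> words M n"
proof
  show "B = take m B @ drop m B" by simp
  show "take m B \<in> words M m" "drop m B \<in> words M n"
    using assms set_take_subset[of m B] set_drop_subset[of m B] by (auto simp: words_def)
qed

lemma take_in_words: "take m A \<in> words M m" if "A \<in> words M n" "m \<le> n"
  using that set_take_subset[of m A] by (auto simp: words_def)

text \<open>The empty word is left out because the root is retained without a choice. These words
  index the random choices.\<close>

definition all_words :: "nat \<Rightarrow> (nat ^ 'd) list set" where
  "all_words M = (\<Union>n. words M (Suc n))"

lemma in_all_words: "A \<in> all_words M \<longleftrightarrow> A \<noteq> [] \<and> set A \<subseteq> digits M"
  by (cases A) (auto simp: all_words_def words_def)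

lemma append_in_all_words:
  "set A \<subseteq> digits M \<Longrightarrow> B \<in> all_words M \<Longrightarrow> A @ B \<in> all_words M"
  by (auto simp: in_all_words)

section \<open>Cube maps as homotheties with nested images\<close>

lemma cube_map_component:
  "cube_map M A x $ i = x $ i / real M ^ length A + (\<Sum>l<length A. real (A ! l $ i) / real M ^ Suc l)"
  by (simp add: cube_map_def)

lemma cube_map_Nil [simp]: "cube_map M [] x = x"
  by (simp add: cube_map_def)

lemma cube_map_Cons: "cube_map M (C # A) x = cube_map M [C] (cube_map M A x)"
  unfolding vec_eq_iff
  by (auto simp: cube_map_component sum.lessThan_Suc_shift add_divide_distrib sum_divide_distrib
      mult_ac simp del: sum.lessThan_Suc)

lemma cube_map_append: "cube_map M (A @ B) x = cube_map M A (cube_map M B x)"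
proof (induction A)
  case (Cons C A)
  then show ?case by (metis append_Cons cube_map_Cons)
qed simp

lemma cube_map_affine:
  "cube_map M A x = (1 / real M ^ length A) *\<^sub>R x + cube_map M A 0"
  by (simp add: vec_eq_iff cube_map_component)

lemma cube_map_diff:
  "cube_map M A x - cube_map M A y = (1 / real M ^ length A) *\<^sub>R (x - y)"
  by (simp add: vec_eq_iff cube_map_component diff_divide_distrib)

lemma cube_subset_unit_cube:
  assumes "M \<ge> 1" "set A \<subseteq> digits M"
  shows "cube M A \<subseteq> unit_cube"
  using assms(2)
proof (induction A)
  case Nil
  show ?case by (auto simp: cube_def)
next
  case (Cons C A)
  have "cube_map M (C # A) x \<in> unit_cube" if "x \<in> unit_cube" for x
  proof -
    have y: "cube_map M A x \<in> unit_cube" using Cons that by (auto simp: cube_def)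
    have "0 \<le> cube_map M (C # A) x $ i \<and> cube_map M (C # A) x $ i \<le> 1" for i
    proof -
      have "cube_map M A x $ i + real (C $ i) \<le> real M"
      proof -
        have "C $ i + 1 \<le> M" using Cons.prems by (auto simp: digits_def Suc_le_eq)
        then have "real (C $ i) + 1 \<le> real M" by linarith
        then show ?thesis using y by (auto simp: unit_cube_def intro: order_trans add_mono)
          (smt (verit))
      qed
      moreover have "0 \<le> cube_map M A x $ i" using y by (auto simp: unit_cube_def)
      ultimately show ?thesis using \<open>M \<ge> 1\<close>
        by (subst (1 2) cube_map_Cons)
           (simp add: cube_map_component[of _ "[C]"] add_divide_distrib[symmetric])
    qed
    then show ?thesis by (auto simp: unit_cube_def)
  qed
  then show ?case by (auto simp: cube_def)
qed

lemma unit_cube_covered: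
  assumes "M \<ge> 1" "x \<in> unit_cube"
  shows "\<exists>A\<in>words M n. x \<in> cube M A"
  using assms(2)
proof (induction n arbitrary: x)
  case 0
  then show ?case by (auto simp: cube_def)
next
  case (Suc n)
  \<comment> \<open>The cap at \<open>M - 1\<close> takes effect only for \<open>x $ i = 1\<close>,
    where the floor equals \<open>M\<close> and is not a digit.\<close>
  define C :: "nat ^ 'a" where "C = (\<chi> i. min (nat \<lfloor>real M * x $ i\<rfloor>) (M - 1))"
  define y where "y = (\<chi> i. real M * x $ i - real (C $ i))"
  have xi: "0 \<le> x $ i" "x $ i \<le> 1" for i using Suc.prems by (auto simp: unit_cube_def)
  have y01: "0 \<le> y $ i \<and> y $ i \<le> 1" for i
  proof -
    have "real (C $ i) \<le> real M * x $ i"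
      using xi[of i] by (simp add: C_def min_le_iff_disj of_nat_floor) (smt (verit) floor_correct mult_nonneg_nonneg of_nat_0_le_iff of_nat_mono min.cobounded1 of_nat_floor)
    moreover have "real M * x $ i \<le> real (C $ i) + 1"
    proof (cases "nat \<lfloor>real M * x $ i\<rfloor> \<le> M - 1")
      case True
      then have "C $ i = nat \<lfloor>real M * x $ i\<rfloor>" by (simp add: C_def)
      then show ?thesis using xi[of i] by (simp; linarith)
    next
      case False
      then have "real (C $ i) + 1 = real M" using \<open>M \<ge> 1\<close> by (simp add: C_def of_nat_diff)
      then show ?thesis using xi[of i] by (simp add: mult_left_le)
    qed
    ultimately show ?thesis by (simp add: y_def)
  qed
  then obtain A where A: "A \<in> words M n" "y \<in> cube M A"
    using Suc.IH[of y] by (auto simp: unit_cube_def)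
  have "cube_map M [C] y = x"
    using \<open>M \<ge> 1\<close> by (auto simp: vec_eq_iff cube_map_component y_def diff_divide_distrib)
  then have "x \<in> cube M (C # A)"
    using A(2) by (auto simp: cube_def image_iff) (metis cube_map_Cons)
  moreover have "C # A \<in> words M (Suc n)"
    using A(1) \<open>M \<ge> 1\<close> by (auto simp: words_def digits_def C_def min_less_iff_disj)
  ultimately show ?case by blast
qed

lemma compact_unit_cube: "compact (unit_cube :: (real ^ 'd) set)"
proof -
  have "unit_cube = cbox (0 :: real ^ 'd) 1"
    by (auto simp: unit_cube_def mem_box_cart)
  then show ?thesis by (metis compact_cbox)
qed

lemma compact_cube: "compact (cube M A)"
  unfolding cube_def
  by (rule compact_continuous_image[OF _ compact_unit_cube])
     (subst cube_map_affine[abs_def], intro continuous_intros)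

text \<open>Retention is read off from a fixed labelling \<open>T\<close> of the words, so that
  randomness enters only through \<open>T\<close>, and the subtree below \<open>A\<close> is simply
  the shifted labelling \<open>\<lambda>D. T (A @ D)\<close>.\<close>

definition surviving :: "nat \<Rightarrow> ((nat ^ 'd) list \<Rightarrow> bool) \<Rightarrow> nat \<Rightarrow> (nat ^ 'd) list set" where
  "surviving M T n = {A \<in> words M n. \<forall>m\<in>{1..n}. T (take m A)}"

lemma retained_eq_surviving: "retained M X n \<omega> = surviving M (\<lambda>A. X A \<omega>) n"
proof (induction n)
  case 0
  then show ?case by (auto simp: surviving_def)
next
  case (Suc n)
  show ?case
  proof (intro set_eqI iffI)
    fix B assume "B \<in> retained M X (Suc n) \<omega>"
    then obtain A C where B: "B = A @ [C]" "A \<in> surviving M (\<lambda>A. X A \<omega>) n" "C \<in> digits M" "X B \<omega>"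
      using Suc by auto
    have "X (take m B) \<omega>" if "m \<in> {1..Suc n}" for m
      using B that by (cases "m = Suc n") (auto simp: surviving_def words_def)
    then show "B \<in> surviving M (\<lambda>A. X A \<omega>) (Suc n)"
      using B by (auto simp: surviving_def words_def)
  next
    fix B assume B: "B \<in> surviving M (\<lambda>A. X A \<omega>) (Suc n)"
    then have "B \<in> words M (n + 1)" by (simp add: surviving_def)
    then obtain A D where D: "B = A @ D" "A \<in> words M n" "D \<in> words M 1" by (rule words_split)
    then obtain C where C: "D = [C]" "C \<in> digits M"
      by (auto simp: words_def length_Suc_conv)
    have "X (take m A) \<omega>" if "m \<in> {1..n}" for m
    proof -
      have "take m B = take m A" using that D by (auto simp: words_def)
      then show ?thesis using B that by (auto simp: surviving_def dest!: bspec[of _ _ m])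
    qed
    moreover have "X B \<omega>"
      using B D C by (auto simp: surviving_def words_def dest!: bspec[of _ _ "Suc n"])
    ultimately show "B \<in> retained M X (Suc n) \<omega>"
      using Suc D C by (auto simp: surviving_def)
  qed
qed

lemma finite_surviving: "finite (surviving M T n)"
  unfolding surviving_def by (simp add: finite_words)

lemma surviving_subset: "surviving M T n \<subseteq> words M n"
  by (auto simp: surviving_def)

text \<open>The branching property: a nonempty prefix of \<open>A @ B\<close> is either a prefix of
  \<open>A\<close> or \<open>A\<close> followed by a nonempty prefix of \<open>B\<close>.\<close>

lemma surviving_append_iff:
  assumes A: "A \<in> words M m" and B: "B \<in> words M n"
  shows "A @ B \<in> surviving M T (m + n) \<longleftrightarrow>
    A \<in> surviving M T m \<and> B \<in> surviving M (\<lambda>D. T (A @ D)) n"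
proof -
  have len: "length A = m" "length B = n" using A B by (auto simp: words_def)
  have "(\<forall>l\<in>{1..m+n}. T (take l (A @ B))) \<longleftrightarrow>
    (\<forall>l\<in>{1..m}. T (take l A)) \<and> (\<forall>l\<in>{1..n}. T (A @ take l B))" (is "?L \<longleftrightarrow> ?R")
  proof
    assume L: ?L
    have "T (take l A)" if "l \<in> {1..m}" for l
      using L[THEN bspec, of l] that len by auto
    moreover have "T (A @ take l B)" if "l \<in> {1..n}" for l
      using L[THEN bspec, of "m + l"] that len by auto
    ultimately show ?R by blast
  next
    assume R: ?R
    show ?L
    proof
      fix l assume l: "l \<in> {1..m+n}"
      show "T (take l (A @ B))"
      proof (cases "l \<le> m")
        case True then show ?thesis using R l len by auto
      next
        case False
        then have "l - m \<in> {1..n}" using l by auto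
        then show ?thesis using R False len by auto
      qed
    qed
  qed
  then show ?thesis using words_append[OF A B] A B by (auto simp: surviving_def)
qed

lemma surviving_nonempty_mono:
  assumes "surviving M T n \<noteq> {}" "m \<le> n"
  shows "surviving M T m \<noteq> {}"
proof -
  obtain A where A: "A \<in> surviving M T n" using assms by auto
  then have "A \<in> words M (m + (n - m))" using assms by (auto simp: surviving_def)
  then obtain B D where "A = B @ D" "B \<in> words M m" "D \<in> words M (n - m)" by (rule words_split)
  then show ?thesis using A assms surviving_append_iff[of B M m D "n - m" T] by auto
qed

subsection \<open>Independence of subtrees\<close>

text \<open>The product space contains only functions that are extensional on \<open>K\<close>. The
  second conjunct extends the control to arbitrary labellings: \<open>f\<close> depends on the
  labels in \<open>K\<close> alone. Disjoint sets \<open>K\<close> thus yield independent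
  quantities.\<close>

definition tree_measurable :: "'a set \<Rightarrow> 'b measure \<Rightarrow> (('a \<Rightarrow> bool) \<Rightarrow> 'b) \<Rightarrow> bool" where
  "tree_measurable K N f \<longleftrightarrow>
     f \<in> measurable (PiM K (\<lambda>_. count_space UNIV)) N \<and> (\<forall>T. f (restrict T K) = f T)"

abbreviation tree_event :: "'a set \<Rightarrow> (('a \<Rightarrow> bool) \<Rightarrow> bool) \<Rightarrow> bool" where
  "tree_event K \<equiv> tree_measurable K (count_space UNIV)"

lemma tree_event_atom: "A \<in> K \<Longrightarrow> tree_event K (\<lambda>T. T A)"
  by (auto simp: tree_measurable_def intro: measurable_component_singleton)

lemma tree_measurable_const: "c \<in> space N \<Longrightarrow> tree_measurable K N (\<lambda>T. c)"
  by (simp add: tree_measurable_def)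

lemma tree_measurable_compose:
  "tree_measurable K N f \<Longrightarrow> g \<in> measurable N N' \<Longrightarrow> tree_measurable K N' (\<lambda>T. g (f T))"
  by (auto simp: tree_measurable_def)

lemma tree_event_not: "tree_event K \<phi> \<Longrightarrow> tree_event K (\<lambda>T. \<not> \<phi> T)"
  by (auto simp: tree_measurable_def)

lemma tree_event_conj:
  "tree_event K \<phi> \<Longrightarrow> tree_event K \<psi> \<Longrightarrow> tree_event K (\<lambda>T. \<phi> T \<and> \<psi> T)"
  by (auto simp: tree_measurable_def intro: pred_intros_logic)

lemma tree_event_imp:
  "tree_event K \<phi> \<Longrightarrow> tree_event K \<psi> \<Longrightarrow> tree_event K (\<lambda>T. \<phi> T \<longrightarrow> \<psi> T)"
  by (auto simp: tree_measurable_def intro: pred_intros_logic)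

lemma tree_event_Ball:
  assumes "countable I" "\<And>i. i \<in> I \<Longrightarrow> tree_event K (\<phi> i)"
  shows "tree_event K (\<lambda>T. \<forall>i\<in>I. \<phi> i T)"
proof (cases "I = {}")
  case True
  then show ?thesis by (simp add: tree_measurable_const)
next
  case False
  have eq: "(\<forall>i\<in>I. \<phi> i T) \<longleftrightarrow> (\<forall>n. \<phi> (from_nat_into I n) T)" for T
    using from_nat_into[OF False] from_nat_into_surj[OF \<open>countable I\<close>] by metis
  have "\<And>n. tree_event K (\<phi> (from_nat_into I n))"
    using assms(2) from_nat_into[OF False] by blast
  then show ?thesis
    by (auto simp: tree_measurable_def eq intro: pred_intros_countable)
qed

lemma tree_event_Bex:
  assumes "countable I" "\<And>i. i \<in> I \<Longrightarrow> tree_event K (\<phi> i)"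
  shows "tree_event K (\<lambda>T. \<exists>i\<in>I. \<phi> i T)"
  using tree_event_not[OF tree_event_Ball[OF \<open>countable I\<close> tree_event_not[OF assms(2)]]] by simp

lemma tree_event_All:
  fixes \<phi> :: "'i :: countable \<Rightarrow> _"
  assumes "\<And>i. tree_event K (\<phi> i)"
  shows "tree_event K (\<lambda>T. \<forall>i. \<phi> i T)"
  using tree_event_Ball[of UNIV K \<phi>] assms by simp

lemma tree_event_Ex:
  fixes \<phi> :: "'i :: countable \<Rightarrow> _"
  assumes "\<And>i. tree_event K (\<phi> i)"
  shows "tree_event K (\<lambda>T. \<exists>i. \<phi> i T)"
  using tree_event_Bex[of UNIV K \<phi>] assms by simp

lemma tree_measurable_sum_of_bool:
  assumes "\<And>i. i \<in> I \<Longrightarrow> tree_event K (\<phi> i)"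
  shows "tree_measurable K borel (\<lambda>T. \<Sum>i\<in>I. of_bool (\<phi> i T) :: real)"
  unfolding tree_measurable_def
proof
  show "(\<lambda>T. \<Sum>i\<in>I. of_bool (\<phi> i T) :: real) \<in> borel_measurable (PiM K (\<lambda>_. count_space UNIV))"
  proof (intro borel_measurable_sum)
    fix i assume "i \<in> I"
    then have "\<phi> i \<in> measurable (PiM K (\<lambda>_. count_space UNIV)) (count_space UNIV)"
      using assms by (simp add: tree_measurable_def)
    then show "(\<lambda>T. of_bool (\<phi> i T) :: real) \<in> borel_measurable (PiM K (\<lambda>_. count_space UNIV))"
      by (rule measurable_compose) simp
  qed
  show "\<forall>T. (\<Sum>i\<in>I. of_bool (\<phi> i (restrict T K)) :: real) = (\<Sum>i\<in>I. of_bool (\<phi> i T))"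
    using assms by (auto simp: tree_measurable_def intro!: sum.cong)
qed

lemma tree_event_le:
  "tree_measurable K borel f \<Longrightarrow> tree_event K (\<lambda>T. c \<le> (f T :: real))"
  by (rule tree_measurable_compose[where g = "\<lambda>x. c \<le> x"]) measurable

lemma tree_event_less:
  "tree_measurable K borel f \<Longrightarrow> tree_event K (\<lambda>T. (f T :: real) < c)"
  by (rule tree_measurable_compose[where g = "\<lambda>x. x < c"]) measurable

text \<open>Applied with \<open>h\<close> prepending a fixed word, this confines a property of a
  subtree to the labels strictly below its root.\<close>

lemma tree_measurable_reindex:
  assumes f: "tree_measurable K N f" and h: "h ` K \<subseteq> K'"
  shows "tree_measurable K' N (\<lambda>T. f (\<lambda>B. T (h B)))"
proof -
  have *: "f (\<lambda>B. T (h B)) = f (restrict (\<lambda>B. T (h B)) K)" for T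
    using f by (simp add: tree_measurable_def)
  have "(\<lambda>T. restrict (\<lambda>B. T (h B)) K) \<in>
      measurable (PiM K' (\<lambda>_. count_space UNIV)) (PiM K (\<lambda>_. count_space UNIV))"
    using h by (intro measurable_restrict measurable_component_singleton) auto
  then have "(\<lambda>T. f (restrict (\<lambda>B. T (h B)) K)) \<in> measurable (PiM K' (\<lambda>_. count_space UNIV)) N"
    by (rule measurable_compose) (use f in \<open>simp add: tree_measurable_def\<close>)
  moreover have "restrict (\<lambda>B. restrict T K' (h B)) K = restrict (\<lambda>B. T (h B)) K" for T
    using h by (auto simp: fun_eq_iff)
  moreover have "(\<lambda>T. f (\<lambda>B. T (h B))) = (\<lambda>T. f (restrict (\<lambda>B. T (h B)) K))"
    by (rule ext) (rule *)
  ultimately show ?thesis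
    unfolding tree_measurable_def by (metis *)
qed

lemma tree_measurable_mono:
  "tree_measurable K N f \<Longrightarrow> K \<subseteq> K' \<Longrightarrow> tree_measurable K' N f"
  using tree_measurable_reindex[of K N f "\<lambda>x. x" K'] by simp

lemma tree_event_surviving:
  assumes "\<And>m. m \<in> {1..n} \<Longrightarrow> take m A \<in> K"
  shows "tree_event K (\<lambda>T. A \<in> surviving M T n)"
  unfolding surviving_def mem_Collect_eq
  by (intro tree_event_conj tree_event_Ball tree_event_atom tree_measurable_const)
     (use assms in auto)

text \<open>The labels that determine the retained cubes up to level \<open>n\<close>: the past of
  the process at time \<open>n\<close>.\<close>

definition upto_words :: "nat \<Rightarrow> nat \<Rightarrow> (nat ^ 'd) list set" where
  "upto_words M n = {A \<in> all_words M. length A \<le> n}"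

lemma finite_upto_words: "finite (upto_words M n :: (nat ^ 'd) list set)"
proof -
  have "upto_words M n \<subseteq> (\<Union>m\<le>n. words M m)"
    by (auto simp: upto_words_def in_all_words words_def)
  then show ?thesis by (rule finite_subset) (auto simp: finite_words)
qed

lemma take_in_upto_words:
  "A \<in> words M n \<Longrightarrow> m \<in> {1..n} \<Longrightarrow> take m A \<in> upto_words M n"
  using set_take_subset[of m A] by (auto simp: words_def upto_words_def in_all_words)

lemma tree_event_surviving_eq:
  fixes K :: "(nat ^ 'd) list set"
  assumes "upto_words M n \<subseteq> K"
  shows "tree_event K (\<lambda>T. surviving M T n = R)"
proof -
  have "(surviving M T n = R) \<longleftrightarrow> R \<subseteq> words M n \<and> (\<forall>A\<in>words M n. A \<in> surviving M T n \<longleftrightarrow> A \<in> R)" for T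
    using surviving_subset[of M T n] by blast
  moreover have "tree_event K (\<lambda>T. A \<in> surviving M T n \<longleftrightarrow> A \<in> R)" if "A \<in> words M n" for A
  proof -
    have "tree_event K (\<lambda>T. A \<in> surviving M T n)"
      using take_in_upto_words[OF that] assms by (intro tree_event_surviving) auto
    then show ?thesis
      by (cases "A \<in> R") (auto dest: tree_event_not)
  qed
  ultimately show ?thesis
    by (simp only:) (intro tree_event_conj tree_event_Ball tree_measurable_const;
        auto intro: countable_finite finite_words)
qed

section \<open>Independence of events living on disjoint sets of words\<close>

context fractal_percolation
begin

lemma indep_all_words: "indep_vars (\<lambda>_. count_space UNIV) X (all_words M)"
  using indep_choices by (simp add: all_words_def)

lemma random_tree_measurable:
  assumes "tree_measurable K N f" "K \<subseteq> all_words M"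
  shows "(\<lambda>\<omega>. f (\<lambda>A. X A \<omega>)) \<in> measurable P N"
proof -
  have "(\<lambda>\<omega>. restrict (\<lambda>A. X A \<omega>) K) \<in> measurable P (PiM K (\<lambda>_. count_space UNIV))"
    using indep_all_words assms(2) by (intro measurable_restrict) (auto simp: indep_vars_def)
  then have "(\<lambda>\<omega>. f (restrict (\<lambda>A. X A \<omega>) K)) \<in> measurable P N"
    by (rule measurable_compose) (use assms(1) in \<open>simp add: tree_measurable_def\<close>)
  then show ?thesis using assms(1) by (simp add: tree_measurable_def)
qed

lemma random_tree_event:
  assumes "tree_event (all_words M) \<phi>"
  shows "{\<omega> \<in> space P. \<phi> (\<lambda>A. X A \<omega>)} \<in> events"
  using random_tree_measurable[OF assms] by (simp add: pred_def)

lemma indep_vars_blocks: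
  assumes "\<And>j. j \<in> L \<Longrightarrow> tree_measurable (K j) (N j) (f j)"
    and "\<And>j. j \<in> L \<Longrightarrow> K j \<subseteq> all_words M" and "disjoint_family_on K L"
  shows "indep_vars N (\<lambda>j \<omega>. f j (\<lambda>A. X A \<omega>)) L"
proof -
  have "indep_vars (\<lambda>j. PiM (K j) (\<lambda>_. count_space UNIV)) (\<lambda>j \<omega>. restrict (\<lambda>A. X A \<omega>) (K j)) L"
    by (rule indep_vars_restrict[OF indep_all_words assms(2,3)])
  then have "indep_vars N (\<lambda>j \<omega>. f j (restrict (\<lambda>A. X A \<omega>) (K j))) L"
    by (rule indep_vars_compose2) (use assms(1) in \<open>auto simp: tree_measurable_def\<close>)
  then show ?thesis
    by (rule indep_vars_cong[THEN iffD1, rotated -1])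
       (use assms(1) in \<open>auto simp: tree_measurable_def fun_eq_iff\<close>)
qed

lemma prob_Ball_blocks:
  assumes "finite L" and "\<And>j. j \<in> L \<Longrightarrow> tree_event (K j) (\<phi> j)"
    and "\<And>j. j \<in> L \<Longrightarrow> K j \<subseteq> all_words M" and "disjoint_family_on K L"
  shows "prob {\<omega> \<in> space P. \<forall>j\<in>L. \<phi> j (\<lambda>A. X A \<omega>)} =
    (\<Prod>j\<in>L. prob {\<omega> \<in> space P. \<phi> j (\<lambda>A. X A \<omega>)})"
proof (cases "L = {}")
  case True
  then show ?thesis by (simp add: prob_space)
next
  case False
  have "indep_vars (\<lambda>_. count_space UNIV) (\<lambda>j \<omega>. \<phi> j (\<lambda>A. X A \<omega>)) L"
    by (rule indep_vars_blocks[OF assms(2-)])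
  from indep_varsD_finite[OF this False \<open>finite L\<close>, of "\<lambda>_. {True}"]
  have "prob (\<Inter>j\<in>L. (\<lambda>\<omega>. \<phi> j (\<lambda>A. X A \<omega>)) -` {True} \<inter> space P) =
     (\<Prod>j\<in>L. prob ((\<lambda>\<omega>. \<phi> j (\<lambda>A. X A \<omega>)) -` {True} \<inter> space P))" by simp
  moreover have "(\<Inter>j\<in>L. (\<lambda>\<omega>. \<phi> j (\<lambda>A. X A \<omega>)) -` {True} \<inter> space P) =
      {\<omega> \<in> space P. \<forall>j\<in>L. \<phi> j (\<lambda>A. X A \<omega>)}" using False by auto
  moreover have "(\<lambda>\<omega>. \<phi> j (\<lambda>A. X A \<omega>)) -` {True} \<inter> space P = {\<omega> \<in> space P. \<phi> j (\<lambda>A. X A \<omega>)}" for j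
    by auto
  ultimately show ?thesis by simp
qed

lemma prob_conj_blocks:
  assumes "tree_event K \<phi>" "tree_event K' \<psi>" "K \<subseteq> all_words M" "K' \<subseteq> all_words M" "K \<inter> K' = {}"
  shows "prob {\<omega> \<in> space P. \<phi> (\<lambda>A. X A \<omega>) \<and> \<psi> (\<lambda>A. X A \<omega>)} =
    prob {\<omega> \<in> space P. \<phi> (\<lambda>A. X A \<omega>)} * prob {\<omega> \<in> space P. \<psi> (\<lambda>A. X A \<omega>)}"
proof -
  have "prob {\<omega> \<in> space P. \<forall>j\<in>UNIV. (if j then \<phi> else \<psi>) (\<lambda>A. X A \<omega>)} =
    (\<Prod>j\<in>UNIV. prob {\<omega> \<in> space P. (if j then \<phi> else \<psi>) (\<lambda>A. X A \<omega>)})"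
    by (rule prob_Ball_blocks[where K = "\<lambda>j. if j then K else K'"])
       (use assms in \<open>auto simp: disjoint_family_on_def\<close>)
  moreover have "(\<forall>j\<in>UNIV. (if j then \<phi> else \<psi>) T) \<longleftrightarrow> \<phi> T \<and> \<psi> T" for T
    by (auto split: if_splits)
  ultimately show ?thesis by (simp only:) (simp add: UNIV_bool mult.commute)
qed

lemma prob_X:
  assumes "A \<in> all_words M"
  shows "prob {\<omega> \<in> space P. X A \<omega>} = p (last A)"
proof -
  have "A = butlast A @ [last A]" "last A \<in> digits M" "set (butlast A) \<subseteq> digits M"
    using assms by (auto simp: in_all_words dest: in_set_butlastD)
  then show ?thesis using prob_choice[of "butlast A" "length (butlast A)" "last A"]
    by (auto simp: words_def)
qed

lemma prob_Ball_X:
  assumes "finite F" "F \<subseteq> all_words M"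
  shows "prob {\<omega> \<in> space P. \<forall>A\<in>F. X A \<omega>} = (\<Prod>A\<in>F. p (last A))"
proof -
  have "prob {\<omega> \<in> space P. \<forall>A\<in>F. X A \<omega>} = (\<Prod>A\<in>F. prob {\<omega> \<in> space P. X A \<omega>})"
    by (rule prob_Ball_blocks[where \<phi> = "\<lambda>A T. T A" and K = "\<lambda>A. {A}"])
       (use assms in \<open>auto simp: disjoint_family_on_def intro: tree_event_atom\<close>)
  then show ?thesis using assms by (auto simp: prob_X intro!: prod.cong)
qed

text \<open>Survival of \<open>A\<close> is the conjunction of the choices at its nonempty prefixes.
  These are distinct by length, hence independent, and the prefix of length \<open>m\<close> ends in
  the column \<open>A ! (m - 1)\<close>.\<close>

lemma prob_surviving:
  assumes "A \<in> words M n"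
  shows "prob {\<omega> \<in> space P. A \<in> surviving M (\<lambda>B. X B \<omega>) n} = prod_list (map p A)"
proof -
  have len: "length A = n" using assms by (simp add: words_def)
  have inj: "inj_on (\<lambda>m. take m A) {1..n}"
    by (rule inj_onI) (use len in \<open>auto dest: arg_cong[of _ _ length]\<close>)
  have "{\<omega> \<in> space P. A \<in> surviving M (\<lambda>B. X B \<omega>) n} =
      {\<omega> \<in> space P. \<forall>B\<in>(\<lambda>m. take m A) ` {1..n}. X B \<omega>}"
    using assms by (auto simp: surviving_def)
  also have "prob \<dots> = (\<Prod>B\<in>(\<lambda>m. take m A) ` {1..n}. p (last B))"
    using take_in_upto_words[OF assms] by (intro prob_Ball_X) (auto simp: upto_words_def)
  also have "\<dots> = (\<Prod>m\<in>{1..n}. p (last (take m A)))"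
    by (subst prod.reindex[OF inj]) simp
  also have "\<dots> = (\<Prod>m<n. p (A ! m))"
  proof (rule prod.reindex_bij_witness[of _ Suc "\<lambda>m. m - 1"])
    fix m assume m: "m \<in> {1..n}"
    then have "take m A \<noteq> []" using len by auto
    then have "last (take m A) = A ! (m - 1)" using m len by (simp add: last_conv_nth)
    then show "p (A ! (m - 1)) = p (last (take m A))" by simp
  qed auto
  also have "\<dots> = prod_list (map p A)"
    using len by (simp add: prod.list_conv_set_nth atLeast0LessThan)
  finally show ?thesis .
qed

text \<open>Statistical self-similarity. Since the shifted choices again form a percolation with the
  same \<open>M\<close> and \<open>p\<close>, bounds valid for all such percolations pass to
  subtrees.\<close>

lemma fractal_percolation_subtree:
  assumes "set A \<subseteq> digits M"
  shows "fractal_percolation P M p (\<lambda>B. X (A @ B))"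
proof -
  have "indep_vars (\<lambda>_. count_space UNIV) (\<lambda>B \<omega>. X (A @ B) \<omega>) (all_words M)"
    by (rule indep_vars_blocks[where f = "\<lambda>B T. T (A @ B)" and K = "\<lambda>B. {A @ B}"])
       (use append_in_all_words[OF assms] in \<open>auto simp: disjoint_family_on_def intro: tree_event_atom\<close>)
  moreover have "prob {\<omega> \<in> space P. X (A @ (B @ [C])) \<omega>} = p C"
    if "B \<in> words M n" "C \<in> digits M" for B C n
    using prob_choice[of "A @ B" "length A + n" C] words_append[of A M "length A" B n] that assms
    by (auto simp: words_def)
  ultimately show ?thesis
    by unfold_locales (auto simp: all_words_def)
qed

end

subsection \<open>A zero-one law\<close>

lemma surviving_Cons_iff:
  assumes "C \<in> digits M" "B \<in> words M n"
  shows "C # B \<in> surviving M T (Suc n) \<longleftrightarrow> T [C] \<and> B \<in> surviving M (\<lambda>D. T (C # D)) n"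
  using surviving_append_iff[of "[C]" M 1 B n T] assms by (auto simp: words_def surviving_def)

text \<open>Koenig's argument: there are finitely many first columns, so if the subtree below each
  retained child died out, the whole tree would die at a common finite level.\<close>

lemma survival_step:
  fixes T :: "(nat ^ 'd) list \<Rightarrow> bool"
  assumes "\<forall>n. surviving M T n \<noteq> {}"
  shows "\<exists>C\<in>digits M. T [C] \<and> (\<forall>n. surviving M (\<lambda>B. T (C # B)) n \<noteq> {})"
proof (rule ccontr)
  assume "\<not> ?thesis"
  then have "\<forall>C\<in>digits M. \<exists>n. T [C] \<longrightarrow> surviving M (\<lambda>B. T (C # B)) n = {}" by blast
  then obtain N where N: "\<And>C. C \<in> digits M \<Longrightarrow> T [C] \<Longrightarrow> surviving M (\<lambda>B. T (C # B)) (N C) = {}"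
    by metis
  \<comment> \<open>The sum serves as a common upper bound of all extinction times
    \<open>N C\<close>.\<close>
  define n where "n = (\<Sum>C\<in>(digits M :: (nat ^ 'd) set). N C)"
  obtain A where A: "A \<in> surviving M T (Suc n)" using assms by auto
  then have "A \<in> words M (Suc n)" by (simp add: surviving_def)
  then obtain C B where CB: "A = C # B" "C \<in> digits M" "B \<in> words M n"
    by (cases A) (auto simp: words_def)
  then have *: "T [C]" "B \<in> surviving M (\<lambda>D. T (C # D)) n"
    using A surviving_Cons_iff[of C M B n T] by auto
  moreover have "N C \<le> n" unfolding n_def by (rule member_le_sum) (auto simp: CB finite_digits)
  ultimately have "surviving M (\<lambda>D. T (C # D)) (N C) \<noteq> {}"
    using surviving_nonempty_mono[of M "\<lambda>D. T (C # D)" n "N C"] by blast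
  then show False using N CB *(1) by blast
qed

lemma tree_event_survival:
  "tree_event (all_words M) (\<lambda>T. \<forall>n. surviving M T n \<noteq> {})"
proof -
  have "upto_words M n \<subseteq> all_words M" for n by (auto simp: upto_words_def)
  then show ?thesis by (intro tree_event_All tree_event_not tree_event_surviving_eq)
qed

text \<open>Strict concavity of \<open>t \<mapsto> 1 - \<Prod>(1 - p\<^sub>C t)\<close>, which vanishes at \<open>t = 0\<close>.\<close>

lemma one_minus_prod_concave:
  fixes p :: "'a \<Rightarrow> real"
  assumes "finite S" "\<And>C. C \<in> S \<Longrightarrow> 0 < p C \<and> p C < 1" "0 < a" "a < b" "b \<le> 1" "2 \<le> card S"
  shows "a * (1 - (\<Prod>C\<in>S. 1 - p C * b)) < b * (1 - (\<Prod>C\<in>S. 1 - p C * a))"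
proof -
  have factor: "0 < 1 - p C * b" "1 - p C * b < 1 - p C * a" if "C \<in> S" for C
  proof -
    have "p C * b \<le> p C * 1" using assms(2)[OF that] assms(5) by (intro mult_left_mono) auto
    then show "0 < 1 - p C * b" using assms(2)[OF that] by linarith
    show "1 - p C * b < 1 - p C * a" using assms(2)[OF that] assms(4) by simp
  qed
  have key: "R \<subseteq> S \<Longrightarrow> a * (1 - (\<Prod>C\<in>R. 1 - p C * b)) \<le> b * (1 - (\<Prod>C\<in>R. 1 - p C * a)) \<and>
      (2 \<le> card R \<longrightarrow> a * (1 - (\<Prod>C\<in>R. 1 - p C * b)) < b * (1 - (\<Prod>C\<in>R. 1 - p C * a)))"
    if "finite R" for R
    using that
  proof (induction R rule: finite_induct)
    case empty
    then show ?case by simp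
  next
    case (insert D R)
    let ?A = "\<Prod>C\<in>R. 1 - p C * a" and ?B = "\<Prod>C\<in>R. 1 - p C * b"
    have IH: "a * (1 - ?B) \<le> b * (1 - ?A)" using insert by auto
    have BA: "?B \<le> ?A" using factor insert.prems by (intro prod_mono) (auto simp: less_imp_le)
    have BA': "?B < ?A" if "R \<noteq> {}"
    proof -
      obtain D' where "D' \<in> R" using \<open>R \<noteq> {}\<close> by blast
      have "0 < 1 - p C * b" "1 - p C * b < 1 - p C * a" if "C \<in> R" for C
        using factor[of C] that insert.prems by auto
      then show ?thesis using \<open>D' \<in> R\<close> insert.hyps
        by (intro prod_mono_strict[of D']) (auto intro: less_imp_le less_trans)
    qed
    have pD: "0 < p D * a * b" using assms insert.prems by auto
    \<comment> \<open>Strictness comes from the cross term \<open>p D * a * b * (?A - ?B)\<close>,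
      which is positive as soon as \<open>R\<close> is nonempty; this is why two elements are
      required.\<close>
    have eq: "b * (1 - (1 - p D * a) * ?A) - a * (1 - (1 - p D * b) * ?B)
        = (b * (1 - ?A) - a * (1 - ?B)) + p D * a * b * (?A - ?B)"
      by (simp add: algebra_simps)
    have "0 \<le> p D * a * b * (?A - ?B)" using pD BA by simp
    moreover have "0 < p D * a * b * (?A - ?B)" if "2 \<le> card (insert D R)"
    proof -
      have "R \<noteq> {}" using that by auto
      then show ?thesis using pD BA' by simp
    qed
    ultimately show ?case using eq IH insert.hyps by auto
  qed
  show ?thesis using key[OF assms(1)] assms(6) by simp
qed

lemma card_digits_ge_2: "M \<ge> 2 \<Longrightarrow> 2 \<le> card (digits M :: (nat ^ 'd) set)"
proof -
  assume "M \<ge> 2"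
  then have "{(\<chi> i. 0), (\<chi> i. 1)} \<subseteq> (digits M :: (nat ^ 'd) set)" by (auto simp: digits_def)
  from card_mono[OF finite_digits this] show ?thesis by (simp add: vec_eq_iff)
qed

text \<open>For each \<open>C\<close> the label \<open>[C]\<close> and the labels strictly below it
  form a block. Blocks of different \<open>C\<close> are disjoint, and inside a block the choice at
  the root is separate from the subtree that \<open>H\<close> inspects.\<close>

lemma (in fractal_percolation) prob_no_child:
  assumes H: "tree_event (all_words M) H"
  shows "prob {\<omega> \<in> space P. \<forall>C\<in>digits M. \<not> (X [C] \<omega> \<and> H (\<lambda>B. X (C # B) \<omega>))} =
    (\<Prod>C\<in>digits M. 1 - p C * prob {\<omega> \<in> space P. H (\<lambda>B. X (C # B) \<omega>)})"
proof -
  let ?K = "\<lambda>C. insert [C] ((#) C ` all_words M)"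
  have sub: "?K C \<subseteq> all_words M" if "C \<in> digits M" for C
    using that by (auto simp: in_all_words)
  have H': "tree_event ((#) C ` all_words M) (\<lambda>T. H (\<lambda>B. T (C # B)))" for C
    by (rule tree_measurable_reindex[OF H]) simp
  have ev: "tree_event (?K C) (\<lambda>T. T [C] \<and> H (\<lambda>B. T (C # B)))" for C
    by (intro tree_event_conj tree_event_atom tree_measurable_mono[OF H']) auto
  have "prob {\<omega> \<in> space P. \<forall>C\<in>digits M. \<not> (X [C] \<omega> \<and> H (\<lambda>B. X (C # B) \<omega>))} =
    (\<Prod>C\<in>digits M. prob {\<omega> \<in> space P. \<not> (X [C] \<omega> \<and> H (\<lambda>B. X (C # B) \<omega>))})"
    using prob_Ball_blocks[of "digits M" ?K "\<lambda>C T. \<not> (T [C] \<and> H (\<lambda>B. T (C # B)))"]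
      sub tree_event_not[OF ev] by (auto simp: disjoint_family_on_def finite_digits)
  also have "\<dots> = (\<Prod>C\<in>digits M. 1 - p C * prob {\<omega> \<in> space P. H (\<lambda>B. X (C # B) \<omega>)})"
  proof (rule prod.cong[OF refl])
    fix C :: "nat ^ 'd" assume C: "C \<in> digits M"
    have no_singleton: "[C] \<notin> (#) C ` all_words M" by (auto simp: in_all_words)
    have "prob {\<omega> \<in> space P. X [C] \<omega> \<and> H (\<lambda>B. X (C # B) \<omega>)} =
        prob {\<omega> \<in> space P. X [C] \<omega>} * prob {\<omega> \<in> space P. H (\<lambda>B. X (C # B) \<omega>)}"
      using prob_conj_blocks[of "{[C]}" "\<lambda>T. T [C]" "(#) C ` all_words M"
          "\<lambda>T. H (\<lambda>B. T (C # B))"] H'[of C] sub[OF C] tree_event_atom[of "[C]"]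
        no_singleton by auto
    moreover have "prob {\<omega> \<in> space P. X [C] \<omega>} = p C"
      using prob_X[of "[C]"] C by (simp add: in_all_words)
    moreover have "{\<omega> \<in> space P. X [C] \<omega> \<and> H (\<lambda>B. X (C # B) \<omega>)} \<in> events"
      using random_tree_event[OF tree_measurable_mono[OF ev sub[OF C]]] .
    ultimately show "prob {\<omega> \<in> space P. \<not> (X [C] \<omega> \<and> H (\<lambda>B. X (C # B) \<omega>))} =
        1 - p C * prob {\<omega> \<in> space P. H (\<lambda>B. X (C # B) \<omega>)}"
      by (subst prob_neg) simp_all
  qed
  finally show ?thesis .
qed

text \<open>
  Compare the infimum \<open>g\<close> of the probability of \<open>G\<close> and the supremum \<open>s\<close> of the survival
  probability over all percolations with parameters \<open>M\<close> and \<open>p\<close>. With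
  \<open>h t = 1 - \<Prod>(1 - p\<^sub>C t)\<close>, one generation of branching gives \<open>h g \<le> g\<close> and \<open>s \<le> h s\<close>, and
  strict concavity of \<open>h\<close> excludes \<open>0 < g < s\<close>.
\<close>

lemma hereditary_event_on_survival:
  fixes X :: "(nat ^ 'd) list \<Rightarrow> 'w \<Rightarrow> bool" and G :: "((nat ^ 'd) list \<Rightarrow> bool) \<Rightarrow> bool"
  assumes X: "fractal_percolation P M p X"
    and M: "M \<ge> 2"
    and p: "\<And>C. C \<in> digits M \<Longrightarrow> 0 < p C \<and> p C < 1"
    and G: "tree_event (all_words M) G"
    and hereditary: "\<And>T C. C \<in> digits M \<Longrightarrow> T [C] \<Longrightarrow> G (\<lambda>B. T (C # B)) \<Longrightarrow> G T"
    and survives: "\<And>T n. G T \<Longrightarrow> surviving M T n \<noteq> {}"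
    and q: "q > 0" "\<And>Y. fractal_percolation P M p Y \<Longrightarrow>
      measure P {\<omega> \<in> space P. G (\<lambda>A. Y A \<omega>)} \<ge> q"
  shows "AE \<omega> in P. (\<forall>n. surviving M (\<lambda>A. X A \<omega>) n \<noteq> {}) \<longrightarrow> G (\<lambda>A. X A \<omega>)"
proof -
  define S where "S = (\<lambda>T :: (nat ^ 'd) list \<Rightarrow> bool. \<forall>n. surviving M T n \<noteq> {})"
  have S: "tree_event (all_words M) S" unfolding S_def by (rule tree_event_survival)
  define pr where "pr H Y = measure P {\<omega> \<in> space P. H (\<lambda>A. Y A \<omega>)}"
    for H :: "((nat ^ 'd) list \<Rightarrow> bool) \<Rightarrow> bool" and Y :: "(nat ^ 'd) list \<Rightarrow> 'w \<Rightarrow> bool"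
  \<comment> \<open>This family is closed under passing to first-generation subtrees. Infimum and
    supremum over it take the place of fixed-point equations for the probabilities.\<close>
  define perc where "perc = {Y. fractal_percolation P M p Y}"
  interpret prob_space P using X by (simp add: fractal_percolation_def)
  have pr01: "0 \<le> pr H Y" "pr H Y \<le> 1" for H Y by (auto simp: pr_def)
  have bdd: "bdd_below (pr H ` perc)" "bdd_above (pr H ` perc)" for H
    using pr01 by (auto intro!: bdd_belowI bdd_aboveI)
  have perc: "X \<in> perc" using X by (simp add: perc_def)
  have child: "(\<lambda>B. Y (C # B)) \<in> perc" if "Y \<in> perc" "C \<in> digits M" for Y C
    using fractal_percolation.fractal_percolation_subtree[of P M p Y "[C]"] that
    by (simp add: perc_def)
  define g where "g = (INF Y\<in>perc. pr G Y)"
  define s where "s = (SUP Y\<in>perc. pr S Y)"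
  have g_le: "g \<le> pr G Y" if "Y \<in> perc" for Y
    unfolding g_def using bdd that by (intro cINF_lower)
  have le_s: "pr S Y \<le> s" if "Y \<in> perc" for Y
    unfolding s_def using bdd that by (intro cSUP_upper)
  have "g \<ge> q" unfolding g_def using perc q by (intro cINF_greatest) (auto simp: perc_def pr_def)
  have "s \<le> 1" unfolding s_def using perc pr01 by (intro cSUP_least) auto
  define h where "h t = 1 - (\<Prod>C\<in>digits M. 1 - p C * t)" for t
  have no_child: "prob {\<omega> \<in> space P. \<forall>C\<in>digits M. \<not> (Y [C] \<omega> \<and> H (\<lambda>B. Y (C # B) \<omega>))} =
     (\<Prod>C\<in>digits M. 1 - p C * pr H (\<lambda>B. Y (C # B)))"
    if "Y \<in> perc" "tree_event (all_words M) H" for Y H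
    using fractal_percolation.prob_no_child[of P M p Y H] that by (simp add: perc_def pr_def)
  have not: "prob {\<omega> \<in> space P. \<not> H (\<lambda>A. Y A \<omega>)} = 1 - pr H Y"
    if "Y \<in> perc" "tree_event (all_words M) H" for Y H
    unfolding pr_def using fractal_percolation.random_tree_event[of P M p Y H] that
    by (intro prob_neg) (simp add: perc_def)
  have meas: "{\<omega> \<in> space P. \<forall>C\<in>digits M. \<not> (Y [C] \<omega> \<and> H (\<lambda>B. Y (C # B) \<omega>))} \<in> events"
    if "Y \<in> perc" "tree_event (all_words M) H" for Y H
  proof -
    have "tree_event (all_words M) (\<lambda>T. \<forall>C\<in>digits M. \<not> (T [C] \<and> H (\<lambda>B. T (C # B))))"
      by (intro tree_event_Ball tree_event_not tree_event_conj tree_event_atom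
          tree_measurable_reindex[OF that(2)] countable_finite finite_digits)
         (auto simp: in_all_words)
    from fractal_percolation.random_tree_event[OF _ this, of P p Y] show ?thesis
      using that by (simp add: perc_def)
  qed
  have "h g \<le> pr G Y" if Y: "Y \<in> perc" for Y
  proof -
    have "1 - pr G Y \<le> (\<Prod>C\<in>digits M. 1 - p C * pr G (\<lambda>B. Y (C # B)))"
      unfolding not[OF Y G, symmetric] no_child[OF Y G, symmetric]
      using hereditary by (intro finite_measure_mono meas Y G) auto
    also have "\<dots> \<le> (\<Prod>C\<in>digits M. 1 - p C * g)"
    proof (intro prod_mono conjI)
      fix C :: "nat ^ 'd" assume C: "C \<in> digits M"
      have "p C * pr G (\<lambda>B. Y (C # B)) \<le> 1 * 1"
        using p[OF C] pr01 by (intro mult_mono) auto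
      then show "0 \<le> 1 - p C * pr G (\<lambda>B. Y (C # B))" by simp
      show "1 - p C * pr G (\<lambda>B. Y (C # B)) \<le> 1 - p C * g"
        using p[OF C] g_le[OF child[OF Y C]] by simp
    qed
    finally show ?thesis by (simp add: h_def)
  qed
  then have hg: "h g \<le> g" unfolding g_def using perc by (intro cINF_greatest) auto
  have "pr S Y \<le> h s" if Y: "Y \<in> perc" for Y
  proof -
    have "(\<Prod>C\<in>digits M. 1 - p C * s) \<le> (\<Prod>C\<in>digits M. 1 - p C * pr S (\<lambda>B. Y (C # B)))"
    proof (intro prod_mono conjI)
      fix C :: "nat ^ 'd" assume C: "C \<in> digits M"
      have "p C * s \<le> 1 * 1"
        using p[OF C] \<open>s \<le> 1\<close> le_s[OF perc] pr01(1)[of S X] by (intro mult_mono) auto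
      then show "0 \<le> 1 - p C * s" by simp
      show "1 - p C * s \<le> 1 - p C * pr S (\<lambda>B. Y (C # B))"
        using p[OF C] le_s[OF child[OF Y C]] by simp
    qed
    also have "\<dots> \<le> 1 - pr S Y"
      unfolding not[OF Y S, symmetric] no_child[OF Y S, symmetric]
    proof (intro finite_measure_mono)
      show "{\<omega> \<in> space P. \<not> S (\<lambda>A. Y A \<omega>)} \<in> events"
        using fractal_percolation.random_tree_event[of P M p Y] tree_event_not[OF S] Y
        by (simp add: perc_def)
      show "{\<omega> \<in> space P. \<forall>C\<in>digits M. \<not> (Y [C] \<omega> \<and> S (\<lambda>B. Y (C # B) \<omega>))}
          \<subseteq> {\<omega> \<in> space P. \<not> S (\<lambda>A. Y A \<omega>)}"
        using survival_step[of M "\<lambda>A. Y A _"] unfolding S_def by blast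
    qed
    finally show ?thesis by (simp add: h_def)
  qed
  then have hs: "s \<le> h s" unfolding s_def using perc by (intro cSUP_least) auto
  have "s \<le> g"
  proof (rule ccontr)
    assume "\<not> s \<le> g"
    then have "g < s" by simp
    moreover have "0 < g" using \<open>g \<ge> q\<close> q by simp
    ultimately have "g * h s < s * h g"
      unfolding h_def
      by (intro one_minus_prod_concave finite_digits p \<open>s \<le> 1\<close> card_digits_ge_2 M)
    moreover have "s * h g \<le> s * g" using hg \<open>g < s\<close> \<open>0 < g\<close> by (intro mult_left_mono) auto
    moreover have "g * s \<le> g * h s" using hs \<open>0 < g\<close> by (intro mult_left_mono) auto
    ultimately show False by (simp add: mult.commute)
  qed
  then have "pr S X \<le> pr G X" using le_s[OF perc] g_le[OF perc] by linarith
  have ev: "{\<omega> \<in> space P. S (\<lambda>A. X A \<omega>)} \<in> events" "{\<omega> \<in> space P. G (\<lambda>A. X A \<omega>)} \<in> events"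
    using fractal_percolation.random_tree_event[OF X] S G by auto
  \<comment> \<open>Since \<open>G\<close> forces survival, the comparison of the two probabilities
    makes the difference of the events a null set.\<close>
  have "prob ({\<omega> \<in> space P. S (\<lambda>A. X A \<omega>)} - {\<omega> \<in> space P. G (\<lambda>A. X A \<omega>)}) = pr S X - pr G X"
    unfolding pr_def by (rule finite_measure_Diff[OF ev]) (use survives in \<open>auto simp: S_def\<close>)
  then have "prob ({\<omega> \<in> space P. S (\<lambda>A. X A \<omega>)} - {\<omega> \<in> space P. G (\<lambda>A. X A \<omega>)}) = 0"
    using \<open>pr S X \<le> pr G X\<close> measure_nonneg[of P] by (smt (verit))
  then have "AE \<omega> in P. \<omega> \<notin> {\<omega> \<in> space P. S (\<lambda>A. X A \<omega>)} - {\<omega> \<in> space P. G (\<lambda>A. X A \<omega>)}"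
    using ev by (subst (asm) prob_eq_0) auto
  then show ?thesis by (rule AE_mp) (auto simp: S_def)
qed

text \<open>The existence of a surviving word whose subtree satisfies \<open>N\<close> is
  hereditary, by prepending a column to that word. The empty word shows that it is at least as
  likely as \<open>N\<close> itself.\<close>

lemma subtree_event_on_survival:
  fixes X :: "(nat ^ 'd) list \<Rightarrow> 'w \<Rightarrow> bool" and N :: "((nat ^ 'd) list \<Rightarrow> bool) \<Rightarrow> bool"
  assumes X: "fractal_percolation P M p X"
    and M: "M \<ge> 2"
    and p: "\<And>C. C \<in> digits M \<Longrightarrow> 0 < p C \<and> p C < 1"
    and N: "tree_event (all_words M) N"
    and survives: "\<And>T n. N T \<Longrightarrow> surviving M T n \<noteq> {}"
    and q: "q > 0" "\<And>Y. fractal_percolation P M p Y \<Longrightarrow>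
      measure P {\<omega> \<in> space P. N (\<lambda>A. Y A \<omega>)} \<ge> q"
  shows "AE \<omega> in P. (\<forall>n. surviving M (\<lambda>A. X A \<omega>) n \<noteq> {}) \<longrightarrow>
    (\<exists>m. \<exists>A\<in>surviving M (\<lambda>A. X A \<omega>) m. N (\<lambda>B. X (A @ B) \<omega>))"
proof (rule hereditary_event_on_survival[OF X M p, where
      G = "\<lambda>T. \<exists>m. \<exists>A\<in>surviving M T m. N (\<lambda>B. T (A @ B))" and q = q])
  let ?G = "\<lambda>T. \<exists>m. \<exists>A\<in>surviving M T m. N (\<lambda>B. T (A @ B))"
  have eq: "?G T \<longleftrightarrow> (\<exists>m. \<exists>A\<in>words M m. A \<in> surviving M T m \<and> N (\<lambda>B. T (A @ B)))" for T
    using surviving_subset by blast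
  show G: "tree_event (all_words M) ?G"
    unfolding eq
  proof (intro tree_event_Ex tree_event_Bex tree_event_conj)
    fix m and A :: "(nat ^ 'd) list" assume A: "A \<in> words M m"
    show "tree_event (all_words M) (\<lambda>T. A \<in> surviving M T m)"
      using take_in_upto_words[OF A] by (intro tree_event_surviving) (auto simp: upto_words_def)
    show "tree_event (all_words M) (\<lambda>T. N (\<lambda>B. T (A @ B)))"
      by (rule tree_measurable_reindex[OF N])
         (use append_in_all_words[of A M] A in \<open>auto simp: words_def\<close>)
  qed (simp add: countable_finite finite_words)
  show "?G T" if C: "C \<in> digits M" "T [C]" "?G (\<lambda>B. T (C # B))" for T C
  proof -
    obtain m A where A: "A \<in> surviving M (\<lambda>B. T (C # B)) m" "N (\<lambda>B. T (C # A @ B))" using C(3) by auto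
    then have "C # A \<in> surviving M T (Suc m)"
      using C surviving_subset[of M "\<lambda>B. T (C # B)" m] by (subst surviving_Cons_iff) auto
    then show ?thesis using A(2) by (intro exI[of _ "Suc m"] bexI[of _ "C # A"]) auto
  qed
  show "surviving M T n \<noteq> {}" if "?G T" for T n
  proof -
    obtain m A where A: "A \<in> surviving M T m" "N (\<lambda>B. T (A @ B))" using \<open>?G T\<close> by auto
    then obtain B where B: "B \<in> surviving M (\<lambda>B. T (A @ B)) n" using survives by blast
    then have "A @ B \<in> surviving M T (m + n)"
      using A surviving_subset by (subst surviving_append_iff) blast+
    then show ?thesis using surviving_nonempty_mono[of M T "m + n" n] by auto
  qed
  show "q > 0" by fact
  fix Y :: "(nat ^ 'd) list \<Rightarrow> 'w \<Rightarrow> bool" assume Y: "fractal_percolation P M p Y"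
  interpret Y: fractal_percolation P M p Y by fact
  have "[] \<in> surviving M T 0" for T :: "(nat ^ 'd) list \<Rightarrow> bool" by (simp add: surviving_def)
  then have "measure P {\<omega> \<in> space P. N (\<lambda>A. Y A \<omega>)} \<le> measure P {\<omega> \<in> space P. ?G (\<lambda>A. Y A \<omega>)}"
    by (intro Y.finite_measure_mono Y.random_tree_event[OF G]) (auto intro!: exI[of _ 0] bexI[of _ "[]"])
  then show "q \<le> measure P {\<omega> \<in> space P. ?G (\<lambda>A. Y A \<omega>)}" using q(2)[OF Y] by linarith
qed

subsection \<open>Growth along fibres\<close>

lemma real_card_surviving:
  "real (card {A \<in> surviving M T n. h A}) = (\<Sum>A\<in>{A \<in> words M n. h A}. of_bool (A \<in> surviving M T n))"
proof -
  have "{A \<in> surviving M T n. h A} = {A \<in> words M n. h A} \<inter> {A. A \<in> surviving M T n}"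
    using surviving_subset by blast
  then show ?thesis by (simp add: finite_words)
qed

lemma tree_event_card_surviving_ge:
  fixes K :: "(nat ^ 'd) list set"
  assumes "upto_words M n \<subseteq> K"
  shows "tree_event K (\<lambda>T. c \<le> real (card {A \<in> surviving M T n. h A}))"
  unfolding real_card_surviving
  by (intro tree_event_le tree_measurable_sum_of_bool tree_event_surviving)
     (use take_in_upto_words assms in blast)

text \<open>Eventually \<open>\<kappa> * \<rho> ^ n\<close> exceeds \<open>n * (ln b + 1)\<close>,
  which leaves terms below \<open>exp (-1) ^ n\<close>. Here \<open>b ^ n\<close> stands for the
  size of a net and the exponential for the failure probability of one fibre.\<close>

lemma summable_power_exp_power:
  fixes b \<kappa> \<rho> :: real
  assumes "b \<ge> 1" "\<kappa> > 0" "\<rho> > 1"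
  shows "summable (\<lambda>n. b ^ n * exp (- \<kappa> * \<rho> ^ n))"
proof -
  have "(\<lambda>n. real n * (1 / \<rho>) ^ n) \<longlonglongrightarrow> 0"
    using assms by (intro powser_times_n_limit_0) auto
  moreover have "0 < \<kappa> / (ln b + 1)" using assms by (simp add: add_nonneg_pos)
  ultimately have "\<forall>\<^sub>F n in sequentially. real n * (1 / \<rho>) ^ n < \<kappa> / (ln b + 1)"
    by (rule order_tendstoD)
  then have "\<forall>\<^sub>F n in sequentially. norm (b ^ n * exp (- \<kappa> * \<rho> ^ n)) \<le> exp (-1) ^ n"
  proof eventually_elim
    case (elim n)
    have "ln b + 1 > 0" using assms by (simp add: add_nonneg_pos)
    then have "real n * (ln b + 1) \<le> \<kappa> * \<rho> ^ n"
      using elim assms by (simp add: field_simps power_divide)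
    then have "exp (real n * ln b + - \<kappa> * \<rho> ^ n) \<le> exp (real n * (-1))"
      by (simp add: algebra_simps)
    moreover have bn: "b ^ n = exp (real n * ln b)" using assms by (simp add: exp_of_nat_mult)
    have "b ^ n * exp (- \<kappa> * \<rho> ^ n) = exp (real n * ln b + - \<kappa> * \<rho> ^ n)"
      unfolding bn exp_add ..
    moreover have "exp (real n * (-1)) = exp (-1 :: real) ^ n" by (rule exp_of_nat_mult)
    moreover have "norm (b ^ n * exp (- \<kappa> * \<rho> ^ n)) = b ^ n * exp (- \<kappa> * \<rho> ^ n)" using assms by simp
    ultimately show ?case by linarith
  qed
  then show ?thesis by (rule summable_comparison_test_ev) (simp add: summable_geometric)
qed

text \<open>
  A parameter \<open>\<theta>\<close> stands for a fibre of a projection, and \<open>wide \<theta> A\<close>, \<open>narrow \<theta> A\<close> say that the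
  fibre meets a large or a small neighbourhood of the centre of the cube \<open>A\<close>. Only the finitely
  many fibres of the net \<open>\<Theta> n\<close> are examined at stage \<open>n\<close>.
\<close>

locale growth_scheme =
  fixes M r :: nat and p :: "nat ^ 'd \<Rightarrow> real"
    and \<rho> \<mu> c b :: real
    and \<Theta> :: "nat \<Rightarrow> 't set"
    and wide narrow :: "'t \<Rightarrow> (nat ^ 'd) list \<Rightarrow> bool"
  assumes M: "M \<ge> 2"
    and p: "\<And>C. C \<in> digits M \<Longrightarrow> 0 < p C \<and> p C < 1"
    and rates: "1 < \<rho>" "\<rho> < \<mu>"
    and b: "1 \<le> b"
    and net: "\<And>n. finite (\<Theta> n)" "\<And>n. real (card (\<Theta> n)) \<le> c * b ^ n"
    and mean_growth: "\<And>n \<theta> A. \<theta> \<in> \<Theta> n \<Longrightarrow> A \<in> words M (n * r) \<Longrightarrow> wide \<theta> A \<Longrightarrow>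
      \<mu> \<le> (\<Sum>D\<in>{D \<in> words M r. narrow \<theta> (A @ D)}. prod_list (map p D))"
begin

text \<open>An implication instead of a bare lower bound: its failure is a one-step deviation given
  the past, so that the estimates at different stages do not accumulate. The passage from narrow
  back to wide is left to the geometry.\<close>

definition thrives_at :: "nat \<Rightarrow> 't \<Rightarrow> ((nat ^ 'd) list \<Rightarrow> bool) \<Rightarrow> bool" where
  "thrives_at n \<theta> T \<longleftrightarrow>
     (\<rho> ^ n \<le> real (card {A \<in> surviving M T (n * r). wide \<theta> A}) \<longrightarrow>
      \<rho> ^ Suc n \<le> real (card {B \<in> surviving M T (Suc n * r). narrow \<theta> B}))"

definition thriving :: "((nat ^ 'd) list \<Rightarrow> bool) \<Rightarrow> bool" where
  "thriving T \<longleftrightarrow> (\<forall>n. \<forall>\<theta>\<in>\<Theta> n. thrives_at n \<theta> T)"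

lemma tree_event_thrives_at: "tree_event (all_words M) (thrives_at n \<theta>)"
  unfolding thrives_at_def
  by (intro tree_event_imp tree_event_card_surviving_ge) (auto simp: upto_words_def)

lemma tree_event_thriving: "tree_event (all_words M) thriving"
  unfolding thriving_def
  by (intro tree_event_All tree_event_Ball countable_finite net tree_event_thrives_at)

definition offspring :: "'t \<Rightarrow> (nat ^ 'd) list \<Rightarrow> ((nat ^ 'd) list \<Rightarrow> bool) \<Rightarrow> real" where
  "offspring \<theta> A T =
     (\<Sum>D\<in>{D \<in> words M r. narrow \<theta> (A @ D)}. of_bool (D \<in> surviving M (\<lambda>B. T (A @ B)) r))"

lemma offspring_eq_card:
  "offspring \<theta> A T = real (card {D \<in> surviving M (\<lambda>B. T (A @ B)) r. narrow \<theta> (A @ D)})"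
  by (simp add: offspring_def real_card_surviving)

text \<open>Concatenation is injective because the parents have equal length. Only an inequality
  holds in general, as a narrowly met descendant may stem from a parent that is not met
  widely.\<close>

lemma sum_offspring_le:
  "(\<Sum>A\<in>{A \<in> surviving M T (n * r). wide \<theta> A}. offspring \<theta> A T)
     \<le> real (card {B \<in> surviving M T (Suc n * r). narrow \<theta> B})"
proof -
  let ?V = "{A \<in> surviving M T (n * r). wide \<theta> A}"
  let ?D = "\<lambda>A. {D \<in> surviving M (\<lambda>B. T (A @ B)) r. narrow \<theta> (A @ D)}"
  have fin: "finite ?V" "finite (?D A)" for A by (simp_all add: finite_surviving)
  have "(\<Sum>A\<in>?V. offspring \<theta> A T) = real (card (SIGMA A : ?V. ?D A))"
    using fin by (simp add: offspring_eq_card)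
  also have "card (SIGMA A : ?V. ?D A) \<le> card {B \<in> surviving M T (Suc n * r). narrow \<theta> B}"
  proof (rule card_inj_on_le[where f = "\<lambda>(A, D). A @ D"])
    show "inj_on (\<lambda>(A, D). A @ D) (SIGMA A : ?V. ?D A)"
      by (auto simp: inj_on_def surviving_def words_def)
    have "A @ D \<in> surviving M T (r + n * r)"
      if "A \<in> surviving M T (n * r)" "D \<in> surviving M (\<lambda>B. T (A @ B)) r" for A D
      unfolding add.commute[of r] using that surviving_subset
      by (subst surviving_append_iff) blast+
    then show "(\<lambda>(A, D). A @ D) ` (SIGMA A : ?V. ?D A) \<subseteq> {B \<in> surviving M T (Suc n * r). narrow \<theta> B}"
      by auto
  qed (simp add: finite_surviving)
  finally show ?thesis by simp
qed

text \<open>When everything is retained, the number of offspring dominates its mean, since each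
  summand \<open>prod_list (map p D)\<close> is at most 1. Hence growth by the factor
  \<open>\<mu>\<close> is certain.\<close>

lemma thrives_at_if_full:
  assumes full: "\<forall>A\<in>upto_words M (N * r). T A" and n: "n < N" and \<theta>: "\<theta> \<in> \<Theta> n"
  shows "thrives_at n \<theta> T"
  unfolding thrives_at_def
proof
  let ?V = "{A \<in> surviving M T (n * r). wide \<theta> A}"
  assume V: "\<rho> ^ n \<le> real (card ?V)"
  have level: "Suc n * r \<le> N * r" using n by (intro mult_right_mono) auto
  have "\<mu> \<le> offspring \<theta> A T" if A: "A \<in> ?V" for A
  proof -
    have Aw: "A \<in> words M (n * r)" using A surviving_subset by blast
    have surv: "D \<in> surviving M (\<lambda>B. T (A @ B)) r" if D: "D \<in> words M r" for D
    proof -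
      have "T (A @ take m D)" if "m \<in> {1..r}" for m
        using full[THEN bspec, of "take (n * r + m) (A @ D)"]
          take_in_upto_words[OF words_append[OF Aw D], of "n * r + m"] that level Aw
        by (auto simp: words_def upto_words_def)
      then show ?thesis using D by (simp add: surviving_def)
    qed
    have "\<mu> \<le> (\<Sum>D\<in>{D \<in> words M r. narrow \<theta> (A @ D)}. prod_list (map p D))"
      using A by (intro mean_growth[OF \<theta> Aw]) auto
    also have "\<dots> \<le> offspring \<theta> A T"
      unfolding offspring_def
    proof (rule sum_mono)
      fix D assume D: "D \<in> {D \<in> words M r. narrow \<theta> (A @ D)}"
      have "set D \<subseteq> digits M \<Longrightarrow> 0 \<le> prod_list (map p D) \<and> prod_list (map p D) \<le> 1" for D
        by (induction D) (use p in \<open>force intro: mult_le_one less_imp_le\<close>)+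
      then show "prod_list (map p D) \<le> of_bool (D \<in> surviving M (\<lambda>B. T (A @ B)) r)"
        using surv D by (auto simp: words_def)
    qed
    finally show ?thesis .
  qed
  then have "real (card ?V) * \<mu> \<le> (\<Sum>A\<in>?V. offspring \<theta> A T)" by (rule sum_bounded_below)
  also note sum_offspring_le
  finally have "real (card ?V) * \<mu> \<le> real (card {B \<in> surviving M T (Suc n * r). narrow \<theta> B})" .
  moreover have "\<rho> ^ n * \<rho> \<le> real (card ?V) * \<mu>"
    using V rates by (intro mult_mono) auto
  ultimately show "\<rho> ^ Suc n \<le> real (card {B \<in> surviving M T (Suc n * r). narrow \<theta> B})"
    by (simp add: mult.commute)
qed

text \<open>Hoeffding's exponent per parent. The offspring counts lie between 0 and the number of
  words of length \<open>r\<close>, and for \<open>v\<close> parents a deviation by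
  \<open>v * (\<mu> - \<rho>)\<close> has probability at most
  \<open>exp (- \<kappa> * v)\<close>.\<close>

definition \<kappa> :: real where
  "\<kappa> = 2 * (\<mu> - \<rho>)\<^sup>2 / (real (card (words M r :: (nat ^ 'd) list set)))\<^sup>2"

lemma card_words_pos: "0 < card (words M r :: (nat ^ 'd) list set)"
proof -
  have "replicate r (\<chi> i. 0) \<in> (words M r :: (nat ^ 'd) list set)"
    using M by (auto simp: words_def digits_def)
  then show ?thesis using finite_words card_gt_0_iff by blast
qed

lemma \<kappa>_pos: "\<kappa> > 0"
  using rates card_words_pos by (auto simp: \<kappa>_def)

end

section \<open>Probability that growth fails\<close>

locale percolation_growth = growth_scheme M r p \<rho> \<mu> c b \<Theta> wide narrow + fractal_percolation P M p X
  for M r :: nat and p :: "nat ^ 'd \<Rightarrow> real" and \<rho> \<mu> c b :: real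
    and \<Theta> :: "nat \<Rightarrow> 't set" and wide narrow :: "'t \<Rightarrow> (nat ^ 'd) list \<Rightarrow> bool"
    and P :: "'w measure" and X :: "(nat ^ 'd) list \<Rightarrow> 'w \<Rightarrow> bool"
begin

lemma tree_measurable_offspring:
  assumes "K = (@) A ` all_words M"
  shows "tree_measurable K borel (offspring \<theta> A)"
  unfolding offspring_def
proof (intro tree_measurable_sum_of_bool tree_event_surviving)
  fix D assume D: "D \<in> {D \<in> words M r. narrow \<theta> (A @ D)}"
  have "tree_event (all_words M) (\<lambda>T. D \<in> surviving M T r)"
    using D take_in_upto_words[of D M r] by (intro tree_event_surviving) (auto simp: upto_words_def)
  then show "tree_event K (\<lambda>T. D \<in> surviving M (\<lambda>B. T (A @ B)) r)"
    by (rule tree_measurable_reindex) (simp add: assms)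
qed

lemma expectation_offspring:
  assumes A: "A \<in> words M (n * r)" "\<theta> \<in> \<Theta> n" "wide \<theta> A"
  shows "\<mu> \<le> expectation (\<lambda>\<omega>. offspring \<theta> A (\<lambda>B. X B \<omega>))"
proof -
  interpret sub: fractal_percolation P M p "\<lambda>B. X (A @ B)"
    by (rule fractal_percolation_subtree) (use A in \<open>auto simp: words_def\<close>)
  have ev: "{\<omega> \<in> space P. D \<in> surviving M (\<lambda>B. X (A @ B) \<omega>) r} \<in> events" if "D \<in> words M r" for D
    using take_in_upto_words[OF that]
    by (intro sub.random_tree_event tree_event_surviving) (auto simp: upto_words_def)
  have int: "has_bochner_integral P (\<lambda>\<omega>. of_bool (D \<in> surviving M (\<lambda>B. X (A @ B) \<omega>) r) :: real)
      (prod_list (map p D))" if "D \<in> words M r" for D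
  proof -
    have "has_bochner_integral P
        (indicat_real {\<omega> \<in> space P. D \<in> surviving M (\<lambda>B. X (A @ B) \<omega>) r})
        (prob {\<omega> \<in> space P. D \<in> surviving M (\<lambda>B. X (A @ B) \<omega>) r})"
      by (intro has_bochner_integral_real_indicator ev that) (simp add: emeasure_eq_measure)
    then show ?thesis unfolding sub.prob_surviving[OF that]
      by (rule has_bochner_integral_cong[THEN iffD1, rotated -1]) (auto simp: indicator_def)
  qed
  have "has_bochner_integral P (\<lambda>\<omega>. offspring \<theta> A (\<lambda>B. X B \<omega>))
     (\<Sum>D\<in>{D \<in> words M r. narrow \<theta> (A @ D)}. prod_list (map p D))"
    unfolding offspring_def by (intro has_bochner_integral_sum int) auto
  then show ?thesis using mean_growth[OF A(2,1,3)] by (simp add: has_bochner_integral_integral_eq)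
qed

lemma disjoint_subtrees:
  assumes "V \<subseteq> words M n"
  shows "disjoint_family_on (\<lambda>A. (@) A ` all_words M) V"
  unfolding disjoint_family_on_def
proof (intro ballI impI)
  fix A B assume AB: "A \<in> V" "B \<in> V" "A \<noteq> B"
  then have "length A = length B" using assms by (auto simp: words_def)
  then show "(@) A ` all_words M \<inter> (@) B ` all_words M = {}" using AB by auto
qed

text \<open>For a fixed set of parents the counts are independent, as they live on disjoint
  subtrees. Because of \<open>\<rho> ^ n \<le> card V\<close> the threshold lies at least
  \<open>card V * (\<mu> - \<rho>)\<close> below the mean, so Hoeffding's inequality gives a bound
  exponential in \<open>card V\<close>.\<close>

lemma prob_few_offspring:
  assumes V: "V \<subseteq> words M (n * r)" "\<And>A. A \<in> V \<Longrightarrow> wide \<theta> A" "\<rho> ^ n \<le> real (card V)" and \<theta>: "\<theta> \<in> \<Theta> n"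
  shows "prob {\<omega> \<in> space P. (\<Sum>A\<in>V. offspring \<theta> A (\<lambda>B. X B \<omega>)) < \<rho> ^ Suc n} \<le> exp (- \<kappa> * \<rho> ^ n)"
proof -
  define w where "w = real (card (words M r :: (nat ^ 'd) list set))"
  have w: "w > 0" using card_words_pos by (simp add: w_def)
  have Vpos: "0 < real (card V)" using V(3) rates by (smt (verit) zero_less_power)
  have finV: "finite V" using V(1) finite_words finite_subset by blast
  have sub: "(@) A ` all_words M \<subseteq> all_words M" if "A \<in> V" for A
    using append_in_all_words[of A M] that V(1) by (auto simp: words_def)
  have range: "offspring \<theta> A T \<in> {0..w}" for A T
  proof -
    have "offspring \<theta> A T \<le> (\<Sum>D\<in>{D \<in> words M r. narrow \<theta> (A @ D)}. 1)"
      unfolding offspring_def by (intro sum_mono) auto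
    also have "\<dots> \<le> w" unfolding w_def by (simp add: card_mono finite_words)
    finally show ?thesis by (simp add: offspring_eq_card)
  qed
  have indep: "indep_vars (\<lambda>_. borel) (\<lambda>A \<omega>. offspring \<theta> A (\<lambda>B. X B \<omega>)) V"
    by (rule indep_vars_blocks[OF tree_measurable_offspring[OF refl] sub disjoint_subtrees[OF V(1)]])
  define m where "m = (\<Sum>A\<in>V. expectation (\<lambda>\<omega>. offspring \<theta> A (\<lambda>B. X B \<omega>)))"
  interpret Hoeffding_ineq P V "\<lambda>A \<omega>. offspring \<theta> A (\<lambda>B. X B \<omega>)" "\<lambda>_. 0" "\<lambda>_. w" m
    by unfold_locales (use finV indep range in \<open>auto simp: m_def\<close>)
  have m: "real (card V) * \<mu> \<le> m" unfolding m_def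
    by (rule sum_bounded_below) (use expectation_offspring V(1,2) \<theta> in auto)
  have ge: "\<rho> ^ Suc n \<le> m - real (card V) * (\<mu> - \<rho>)"
  proof -
    have "\<rho> ^ n * \<rho> \<le> real (card V) * \<rho>" using V(3) rates by (intro mult_right_mono) auto
    then show ?thesis using m by (simp add: algebra_simps)
  qed
  let ?S = "\<lambda>\<omega>. \<Sum>A\<in>V. offspring \<theta> A (\<lambda>B. X B \<omega>)"
  have "prob {\<omega> \<in> space P. ?S \<omega> < \<rho> ^ Suc n} \<le>
      prob {\<omega> \<in> space P. ?S \<omega> \<le> m - real (card V) * (\<mu> - \<rho>)}"
    using ge by (intro finite_measure_mono) (auto intro!: borel_measurable_sum random_variable)
  also have "\<dots> \<le> exp (-2 * (real (card V) * (\<mu> - \<rho>))\<^sup>2 / (\<Sum>A\<in>V. (w - 0)\<^sup>2))"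
    by (rule Hoeffding_ineq_le) (use rates w Vpos in auto)
  also have "-2 * (real (card V) * (\<mu> - \<rho>))\<^sup>2 / (\<Sum>A\<in>V. (w - 0)\<^sup>2) = - \<kappa> * real (card V)"
    using w Vpos by (simp add: \<kappa>_def w_def[symmetric] power2_eq_square field_simps)
  also have "exp (- \<kappa> * real (card V)) \<le> exp (- \<kappa> * \<rho> ^ n)"
    using V(3) \<kappa>_pos by simp
  finally show ?thesis .
qed

text \<open>Conditioning on the past is done by splitting over the finitely many values
  \<open>R\<close> of the retained set at level \<open>n * r\<close>. For fixed \<open>R\<close>,
  the shortage of offspring involves only deeper labels and is independent of the past, including
  \<open>H\<close>. The factor \<open>prob H\<close> is kept so that the bound remains useful when
  \<open>H\<close> is rare.\<close>

lemma prob_not_thrives_at: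
  assumes H: "tree_event (upto_words M (n * r)) H" and \<theta>: "\<theta> \<in> \<Theta> n"
  shows "prob {\<omega> \<in> space P. H (\<lambda>B. X B \<omega>) \<and> \<not> thrives_at n \<theta> (\<lambda>B. X B \<omega>)} \<le>
    prob {\<omega> \<in> space P. H (\<lambda>B. X B \<omega>)} * exp (- \<kappa> * \<rho> ^ n)"
proof -
  let ?K = "upto_words M (n * r) :: (nat ^ 'd) list set"
  let ?K' = "{A \<in> all_words M. n * r < length A} :: (nat ^ 'd) list set"
  let ?V = "\<lambda>R. {A \<in> R. wide \<theta> A}"
  define past where "past = (\<lambda>R T. H T \<and> surviving M T (n * r) = R)"
  define future where "future = (\<lambda>R T. \<rho> ^ n \<le> real (card (?V R)) \<and>
     (\<Sum>A\<in>?V R. offspring \<theta> A T) < \<rho> ^ Suc n)"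
  define Rs where "Rs = Pow (words M (n * r) :: (nat ^ 'd) list set)"
  have "finite Rs" by (simp add: Rs_def finite_words)
  have K: "?K \<subseteq> all_words M" "?K' \<subseteq> all_words M" "?K \<inter> ?K' = {}" by (auto simp: upto_words_def)
  have past: "tree_event ?K (past R)" for R
    unfolding past_def by (intro tree_event_conj H tree_event_surviving_eq order.refl)
  have future: "tree_event ?K' (future R)" if "R \<in> Rs" for R
  proof -
    have "tree_measurable ?K' borel (\<lambda>T. \<Sum>A\<in>?V R. offspring \<theta> A T)"
      unfolding offspring_def
      apply (subst sum.Sigma)
      subgoal using that by (auto simp: Rs_def intro: finite_subset finite_words)
      subgoal by (simp add: finite_words)
    proof (subst case_prod_unfold, intro tree_measurable_sum_of_bool)
      fix i assume i: "i \<in> (SIGMA A:?V R. {D \<in> words M r. narrow \<theta> (A @ D)})"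
      then have A: "fst i \<in> words M (n * r)" and D: "snd i \<in> words M r"
        using that by (auto simp: Rs_def)
      have "tree_event (all_words M) (\<lambda>T. snd i \<in> surviving M T r)"
        using take_in_upto_words[OF D] by (intro tree_event_surviving) (auto simp: upto_words_def)
      then show "tree_event ?K' (\<lambda>T. snd i \<in> surviving M (\<lambda>B. T (fst i @ B)) r)"
        by (rule tree_measurable_reindex)
           (use A append_in_all_words[of "fst i" M] in \<open>auto simp: words_def in_all_words\<close>)
    qed
    then show ?thesis unfolding future_def
      by (intro tree_event_conj tree_event_less tree_measurable_const) auto
  qed
  have ev: "{\<omega> \<in> space P. past R (\<lambda>B. X B \<omega>)} \<in> events" for R
    by (rule random_tree_event[OF tree_measurable_mono[OF past K(1)]])
  have ev': "{\<omega> \<in> space P. past R (\<lambda>B. X B \<omega>) \<and> future R (\<lambda>B. X B \<omega>)} \<in> events" if "R \<in> Rs" for R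
    by (rule random_tree_event[OF tree_event_conj[OF tree_measurable_mono[OF past K(1)]
            tree_measurable_mono[OF future[OF that] K(2)]]])
  have prob_future: "prob {\<omega> \<in> space P. future R (\<lambda>B. X B \<omega>)} \<le> exp (- \<kappa> * \<rho> ^ n)" if "R \<in> Rs" for R
  proof (cases "\<rho> ^ n \<le> real (card (?V R))")
    case True
    show ?thesis unfolding future_def using True
      by simp (rule prob_few_offspring[simplified], use that True \<theta> in \<open>auto simp: Rs_def\<close>)
  next
    case False
    then show ?thesis by (simp add: future_def)
  qed
  have "prob {\<omega> \<in> space P. H (\<lambda>B. X B \<omega>) \<and> \<not> thrives_at n \<theta> (\<lambda>B. X B \<omega>)} \<le>
     prob (\<Union>R\<in>Rs. {\<omega> \<in> space P. past R (\<lambda>B. X B \<omega>) \<and> future R (\<lambda>B. X B \<omega>)})"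
  proof (rule finite_measure_mono)
    \<comment> \<open>The retained set itself serves as \<open>R\<close>: by
      \<open>sum_offspring_le\<close>, too few narrow cubes at the next stage force a small sum of
      offspring.\<close>
    have "\<exists>R\<in>Rs. past R T \<and> future R T" if "H T" "\<not> thrives_at n \<theta> T" for T
      using that sum_offspring_le[of \<theta> T n] surviving_subset[of M T "n * r"]
      by (intro bexI[of _ "surviving M T (n * r)"])
         (auto simp: past_def future_def thrives_at_def Rs_def)
    then show "{\<omega> \<in> space P. H (\<lambda>B. X B \<omega>) \<and> \<not> thrives_at n \<theta> (\<lambda>B. X B \<omega>)} \<subseteq>
      (\<Union>R\<in>Rs. {\<omega> \<in> space P. past R (\<lambda>B. X B \<omega>) \<and> future R (\<lambda>B. X B \<omega>)})" by blast
  qed (use ev' \<open>finite Rs\<close> in auto)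
  also have "\<dots> \<le> (\<Sum>R\<in>Rs. prob {\<omega> \<in> space P. past R (\<lambda>B. X B \<omega>) \<and> future R (\<lambda>B. X B \<omega>)})"
    by (rule finite_measure_subadditive_finite) (use ev' \<open>finite Rs\<close> in auto)
  also have "\<dots> = (\<Sum>R\<in>Rs. prob {\<omega> \<in> space P. past R (\<lambda>B. X B \<omega>)} *
      prob {\<omega> \<in> space P. future R (\<lambda>B. X B \<omega>)})"
    by (intro sum.cong[OF refl] prob_conj_blocks[OF past future K])
  also have "\<dots> \<le> (\<Sum>R\<in>Rs. prob {\<omega> \<in> space P. past R (\<lambda>B. X B \<omega>)} * exp (- \<kappa> * \<rho> ^ n))"
    by (intro sum_mono mult_left_mono prob_future) auto
  also have "\<dots> = (\<Sum>R\<in>Rs. prob {\<omega> \<in> space P. past R (\<lambda>B. X B \<omega>)}) * exp (- \<kappa> * \<rho> ^ n)"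
    by (simp add: sum_distrib_right)
  also have "(\<Sum>R\<in>Rs. prob {\<omega> \<in> space P. past R (\<lambda>B. X B \<omega>)}) =
      prob (\<Union>R\<in>Rs. {\<omega> \<in> space P. past R (\<lambda>B. X B \<omega>)})"
    by (rule finite_measure_finite_Union[symmetric])
       (use ev \<open>finite Rs\<close> in \<open>auto simp: disjoint_family_on_def past_def\<close>)
  also have "(\<Union>R\<in>Rs. {\<omega> \<in> space P. past R (\<lambda>B. X B \<omega>)}) = {\<omega> \<in> space P. H (\<lambda>B. X B \<omega>)}"
  proof -
    have "surviving M T (n * r) \<in> Rs" for T using surviving_subset by (simp add: Rs_def)
    then show ?thesis unfolding past_def by blast
  qed
  finally show ?thesis .
qed

text \<open>On the event \<open>H\<close> that all cubes up to level \<open>N * r\<close> are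
  retained, the stages below \<open>N\<close> thrive by fullness. Every later failure is intersected
  with \<open>H\<close>, so the union bound carries the factor \<open>h\<close> and at least
  \<open>h / 2\<close> survives, however small \<open>h\<close> is.\<close>

lemma prob_thriving_and_full:
  assumes small: "(\<Sum>n. c * (b ^ (n + N) * exp (- \<kappa> * \<rho> ^ (n + N)))) \<le> 1 / 2"
  shows "(\<Prod>A\<in>upto_words M (N * r). p (last A)) / 2 \<le> prob {\<omega> \<in> space P. thriving (\<lambda>A. X A \<omega>)}"
proof -
  define H where "H = (\<lambda>T :: (nat ^ 'd) list \<Rightarrow> bool. \<forall>A\<in>upto_words M (N * r). T A)"
  have H: "tree_event (upto_words M m) H" if "N * r \<le> m" for m
    unfolding H_def
    by (intro tree_event_Ball tree_event_atom countable_finite finite_upto_words)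
       (use that in \<open>auto simp: upto_words_def\<close>)
  have Hall: "tree_event (all_words M) H"
    by (rule tree_measurable_mono[OF H[OF order.refl]]) (auto simp: upto_words_def)
  define h where "h = prob {\<omega> \<in> space P. H (\<lambda>A. X A \<omega>)}"
  have h: "h = (\<Prod>A\<in>upto_words M (N * r). p (last A))"
    unfolding h_def H_def
    by (rule prob_Ball_X[OF finite_upto_words]) (auto simp: upto_words_def)
  define bad where "bad = (\<lambda>n. {\<omega> \<in> space P. H (\<lambda>A. X A \<omega>) \<and> \<not> (\<forall>\<theta>\<in>\<Theta> n. thrives_at n \<theta> (\<lambda>A. X A \<omega>))})"
  have bad_event: "bad n \<in> events" for n
    unfolding bad_def
    by (rule random_tree_event[where \<phi> = "\<lambda>T. H T \<and> \<not> (\<forall>\<theta>\<in>\<Theta> n. thrives_at n \<theta> T)"])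
       (intro tree_event_conj[OF Hall] tree_event_not tree_event_Ball tree_event_thrives_at
        countable_finite net)
  \<comment> \<open>For \<open>N \<le> n\<close> fullness belongs to the past of stage
    \<open>n\<close>, which is what \<open>prob_not_thrives_at\<close> asks of
    \<open>H\<close>.\<close>
  have prob_bad: "prob (bad n) \<le> h * (c * (b ^ n * exp (- \<kappa> * \<rho> ^ n)))" if "N \<le> n" for n
  proof -
    let ?B = "\<lambda>\<theta>. {\<omega> \<in> space P. H (\<lambda>A. X A \<omega>) \<and> \<not> thrives_at n \<theta> (\<lambda>A. X A \<omega>)}"
    have ev: "?B \<theta> \<in> events" for \<theta>
      by (rule random_tree_event[where \<phi> = "\<lambda>T. H T \<and> \<not> thrives_at n \<theta> T"])
         (intro tree_event_conj[OF Hall] tree_event_not tree_event_thrives_at)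
    have "prob (bad n) \<le> prob (\<Union>\<theta>\<in>\<Theta> n. ?B \<theta>)"
      by (rule finite_measure_mono) (use ev net in \<open>auto simp: bad_def\<close>)
    also have "\<dots> \<le> (\<Sum>\<theta>\<in>\<Theta> n. prob (?B \<theta>))"
      by (rule finite_measure_subadditive_finite) (use ev net in auto)
    also have "\<dots> \<le> real (card (\<Theta> n)) * (h * exp (- \<kappa> * \<rho> ^ n))"
      unfolding h_def
      by (intro sum_bounded_above prob_not_thrives_at H mult_right_mono that) auto
    also have "\<dots> \<le> (c * b ^ n) * (h * exp (- \<kappa> * \<rho> ^ n))"
      by (intro mult_right_mono net) (auto simp: h_def)
    finally show ?thesis by (simp add: mult_ac)
  qed
  have summ: "summable (\<lambda>n. c * (b ^ (n + N) * exp (- \<kappa> * \<rho> ^ (n + N))))"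
    using summable_power_exp_power[OF b \<kappa>_pos rates(1)]
    by (intro summable_mult) (subst summable_iff_shift)
  have summ_bad: "summable (\<lambda>n. prob (bad (n + N)))"
    by (rule summable_comparison_test'[OF summable_mult[OF summ, of h], of 0])
       (use prob_bad[of "_ + N"] in simp)
  have "prob (\<Union>n. bad (n + N)) \<le> (\<Sum>n. prob (bad (n + N)))"
    by (rule finite_measure_subadditive_countably) (use bad_event summ_bad in auto)
  also have "\<dots> \<le> (\<Sum>n. h * (c * (b ^ (n + N) * exp (- \<kappa> * \<rho> ^ (n + N)))))"
    by (rule suminf_le[OF prob_bad summ_bad summable_mult[OF summ]]) simp
  also have "\<dots> = h * (\<Sum>n. c * (b ^ (n + N) * exp (- \<kappa> * \<rho> ^ (n + N))))"
    by (rule suminf_mult[OF summ])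
  also have "\<dots> \<le> h * (1 / 2)" using small by (intro mult_left_mono) (auto simp: h_def)
  finally have union: "prob (\<Union>n. bad (n + N)) \<le> h / 2" by simp
  have "{\<omega> \<in> space P. H (\<lambda>A. X A \<omega>)} - (\<Union>n. bad (n + N)) \<subseteq> {\<omega> \<in> space P. thriving (\<lambda>A. X A \<omega>)}"
  proof
    fix \<omega> assume \<omega>: "\<omega> \<in> {\<omega> \<in> space P. H (\<lambda>A. X A \<omega>)} - (\<Union>n. bad (n + N))"
    have "thrives_at n \<theta> (\<lambda>A. X A \<omega>)" if "\<theta> \<in> \<Theta> n" for n \<theta>
    proof (cases "n < N")
      case True
      then show ?thesis using thrives_at_if_full[of N "\<lambda>A. X A \<omega>"] \<omega> that by (auto simp: H_def)
    next
      case False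
      then have "\<omega> \<notin> bad (n - N + N)" using \<omega> by blast
      then show ?thesis using False \<omega> that by (auto simp: bad_def)
    qed
    then show "\<omega> \<in> {\<omega> \<in> space P. thriving (\<lambda>A. X A \<omega>)}" using \<omega> by (auto simp: thriving_def)
  qed
  then have "prob ({\<omega> \<in> space P. H (\<lambda>A. X A \<omega>)} - (\<Union>n. bad (n + N))) \<le>
      prob {\<omega> \<in> space P. thriving (\<lambda>A. X A \<omega>)}"
    by (rule finite_measure_mono) (rule random_tree_event[OF tree_event_thriving])
  moreover have "h - prob (\<Union>n. bad (n + N)) \<le> prob ({\<omega> \<in> space P. H (\<lambda>A. X A \<omega>)} - (\<Union>n. bad (n + N)))"
    unfolding h_def using random_tree_event[OF Hall] bad_event
    by (subst finite_measure_Diff') (auto intro!: finite_measure_mono)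
  ultimately show ?thesis using union unfolding h by linarith
qed

end

text \<open>The index \<open>N\<close> comes from the tail of a convergent series determined by the
  parameters. Hence \<open>q\<close> can be chosen before \<open>X\<close>, as the zero-one law
  requires.\<close>

lemma (in growth_scheme) thriving_has_positive_prob:
  "\<exists>q>0. \<forall>X. fractal_percolation P M p X \<longrightarrow>
     q \<le> measure P {\<omega> \<in> space P. thriving (\<lambda>A. X A \<omega>)}"
proof -
  have "summable (\<lambda>n. c * (b ^ n * exp (- \<kappa> * \<rho> ^ n)))"
    by (intro summable_mult summable_power_exp_power b \<kappa>_pos rates)
  from suminf_exist_split[OF _ this, of "1 / 2"]
  obtain N where N: "norm (\<Sum>n. c * (b ^ (n + N) * exp (- \<kappa> * \<rho> ^ (n + N)))) < 1 / 2" by auto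
  let ?q = "(\<Prod>A\<in>upto_words M (N * r). p (last A)) / 2"
  have "?q > 0"
  proof -
    have "0 < p (last A)" if "A \<in> upto_words M (N * r)" for A
      using that p[of "last A"] last_in_set[of A] by (auto simp: upto_words_def in_all_words subset_iff)
    then show ?thesis by (simp add: prod_pos)
  qed
  moreover have "?q \<le> measure P {\<omega> \<in> space P. thriving (\<lambda>A. X A \<omega>)}"
    if "fractal_percolation P M p X" for X
  proof -
    interpret fractal_percolation P M p X by fact
    interpret percolation_growth M r p \<rho> \<mu> c b \<Theta> wide narrow P X ..
    show ?thesis by (rule prob_thriving_and_full) (use N in auto)
  qed
  ultimately show ?thesis by blast
qed

lemma (in growth_scheme) thriving_subtree_on_survival:
  assumes X: "fractal_percolation P M p X"
    and survives: "\<And>T n. thriving T \<Longrightarrow> surviving M T n \<noteq> {}"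
  shows "AE \<omega> in P. (\<forall>n. surviving M (\<lambda>A. X A \<omega>) n \<noteq> {}) \<longrightarrow>
    (\<exists>m. \<exists>A\<in>surviving M (\<lambda>A. X A \<omega>) m. thriving (\<lambda>B. X (A @ B) \<omega>))"
proof -
  obtain q where "q > 0" "\<And>Y. fractal_percolation P M p Y \<Longrightarrow>
     q \<le> measure P {\<omega> \<in> space P. thriving (\<lambda>A. Y A \<omega>)}"
    using thriving_has_positive_prob by blast
  then show ?thesis
    by (intro subtree_event_on_survival[OF X M p tree_event_thriving survives]) auto
qed

subsection \<open>Condition A in terms of fibres\<close>

text \<open>A direct sum decomposition, the situation in which the definite description in
  \<open>proj_along\<close> denotes a point.\<close>

definition complementary :: "'a::real_vector set \<Rightarrow> 'a set \<Rightarrow> bool" where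
  "complementary U W \<longleftrightarrow> subspace U \<and> subspace W \<and> U \<inter> W = {0} \<and> (\<forall>x. \<exists>u\<in>U. x - u \<in> W)"

lemma proj_along_eqI:
  assumes "complementary U W" "u \<in> U" "x - u \<in> W"
  shows "proj_along U W x = u"
  unfolding proj_along_def
proof (rule the_equality)
  have sub: "subspace U" "subspace W" and int: "U \<inter> W = {0}" using assms(1) by (auto simp: complementary_def)
  have "u - x \<in> W" using subspace_neg[OF sub(2) assms(3)] by simp
  then show "u \<in> (+) x ` W \<inter> U" using assms(2) by (auto intro!: image_eqI[of _ _ "u - x"])
  fix y assume y: "y \<in> (+) x ` W \<inter> U"
  then obtain w where w: "w \<in> W" "y = x + w" by auto
  have "y - u \<in> U" using y assms(2) subspace_diff[OF sub(1)] by blast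
  moreover have "y - u = w + (x - u)" using w by simp
  then have "y - u \<in> W" using w(1) assms(3) subspace_add[OF sub(2)] by metis
  ultimately have "y - u \<in> {0}" using int by blast
  then show "y = u" by simp
qed

lemma proj_along_props:
  assumes "complementary U W"
  shows "proj_along U W x \<in> U" and "x - proj_along U W x \<in> W"
proof -
  obtain u where "u \<in> U" "x - u \<in> W" using assms by (auto simp: complementary_def)
  then show "proj_along U W x \<in> U" "x - proj_along U W x \<in> W"
    using proj_along_eqI[OF assms] by auto
qed

lemma linear_proj_along:
  assumes "complementary U W"
  shows "linear (proj_along U W)"
proof (rule linearI)
  have sub: "subspace U" "subspace W" using assms by (auto simp: complementary_def)
  fix x y :: "real ^ 'a" and c :: real
  show "proj_along U W (x + y) = proj_along U W x + proj_along U W y"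
    using subspace_add[OF sub(1)] subspace_add[OF sub(2) proj_along_props(2)[OF assms, of x] proj_along_props(2)[OF assms, of y]]
    by (intro proj_along_eqI[OF assms]) (auto simp: proj_along_props[OF assms] algebra_simps)
  show "proj_along U W (c *\<^sub>R x) = c *\<^sub>R proj_along U W x"
    using subspace_scale[OF sub(1)] subspace_scale[OF sub(2) proj_along_props(2)[OF assms, of x], of c]
    by (intro proj_along_eqI[OF assms]) (auto simp: proj_along_props[OF assms] algebra_simps)
qed

text \<open>This replaces projections by fibres. The oblique and the orthogonal projection have the
  same kernel \<open>W\<close>, so a statement on fibres passes from Condition A to the orthogonal
  projection.\<close>

lemma proj_along_eq_iff:
  assumes "complementary U W"
  shows "proj_along U W x = proj_along U W y \<longleftrightarrow> x - y \<in> W"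
proof
  have sub: "subspace W" using assms by (auto simp: complementary_def)
  assume "proj_along U W x = proj_along U W y"
  then show "x - y \<in> W"
    using subspace_diff[OF sub proj_along_props(2)[OF assms, of x] proj_along_props(2)[OF assms, of y]]
    by simp
next
  have sub: "subspace W" using assms by (auto simp: complementary_def)
  assume "x - y \<in> W"
  then show "proj_along U W x = proj_along U W y"
    using subspace_add[OF sub _ proj_along_props(2)[OF assms, of y], of "x - y"]
    by (intro proj_along_eqI[OF assms]) (auto simp: proj_along_props[OF assms] algebra_simps)
qed

lemma proj_along_fixed: "complementary U W \<Longrightarrow> u \<in> U \<Longrightarrow> proj_along U W u = u"
  by (rule proj_along_eqI) (auto simp: complementary_def subspace_0)

section \<open>Orthogonal complements, coordinate planes and the minor condition\<close>

lemma complementary_span_orthogonal_comp: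
  "complementary (span \<alpha>) (orthogonal_comp (span (\<alpha> :: (real ^ 'd) set)))"
  unfolding complementary_def
proof (intro conjI allI)
  show "span \<alpha> \<inter> (span \<alpha>)\<^sup>\<bottom> = {0}" by (simp add: orthogonal_Int_0)
  fix x :: "real ^ 'd"
  have "x \<in> span \<alpha> + (span \<alpha>)\<^sup>\<bottom>" using subspace_sum_orthogonal_comp[of "span \<alpha>"] by simp
  then obtain u w where "x = u + w" "u \<in> span \<alpha>" "w \<in> (span \<alpha>)\<^sup>\<bottom>" by (rule set_plus_elim)
  then show "\<exists>u\<in>span \<alpha>. x - u \<in> (span \<alpha>)\<^sup>\<bottom>" by (intro bexI[of _ u]) auto
qed (simp_all add: subspace_orthogonal_comp)

lemma dim_orthonormal_span:
  fixes \<alpha> :: "(real ^ 'd) set"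
  assumes "orthonormal \<alpha>"
  shows "dim (span \<alpha>) = card \<alpha>" and "dim (orthogonal_comp (span \<alpha>)) = CARD('d) - card \<alpha>"
proof -
  have "independent \<alpha>"
    using assms by (intro pairwise_orthogonal_independent) (auto simp: orthonormal_def)
  then show 1: "dim (span \<alpha>) = card \<alpha>" using indep_card_eq_dim_span by metis
  have "dim {y \<in> UNIV. \<forall>x \<in> span \<alpha>. orthogonal x y} + dim (span \<alpha>) = dim (UNIV :: (real ^ 'd) set)"
    by (rule dim_subspace_orthogonal_to_vectors) auto
  then show "dim (orthogonal_comp (span \<alpha>)) = CARD('d) - card \<alpha>"
    unfolding 1 by (simp add: orthogonal_comp_def)
qed

lemma coord_plane_eq: "coord_plane J = {x :: real ^ 'd. \<forall>i. i \<notin> J \<longrightarrow> x $ i = 0}"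
proof
  have "subspace {x :: real ^ 'd. \<forall>i. i \<notin> J \<longrightarrow> x $ i = 0}" by (auto simp: subspace_def)
  then show "coord_plane J \<subseteq> {x :: real ^ 'd. \<forall>i. i \<notin> J \<longrightarrow> x $ i = 0}"
    unfolding coord_plane_def by (rule span_minimal[rotated]) (auto simp: axis_def)
  show "{x :: real ^ 'd. \<forall>i. i \<notin> J \<longrightarrow> x $ i = 0} \<subseteq> coord_plane J"
  proof
    fix x :: "real ^ 'd" assume x: "x \<in> {x. \<forall>i. i \<notin> J \<longrightarrow> x $ i = 0}"
    then have "x = (\<Sum>i\<in>J. x $ i *\<^sub>R axis i 1)"
      by (auto simp: vec_eq_iff axis_def if_distrib cong: if_cong)
    then show "x \<in> coord_plane J"
      unfolding coord_plane_def by (metis (no_types, lifting) imageI span_base span_scale span_sum)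
  qed
qed

lemma dim_coord_plane: "dim (coord_plane J :: (real ^ 'd) set) = card J"
proof -
  have "inj_on (\<lambda>j. axis j 1 :: real ^ 'd) J" by (auto simp: inj_on_def axis_eq_axis)
  moreover have "independent ((\<lambda>j. axis j 1 :: real ^ 'd) ` J)"
    by (rule independent_mono[OF independent_Basis]) (auto simp: Basis_vec_def)
  ultimately show ?thesis
    unfolding coord_plane_def using indep_card_eq_dim_span[of "(\<lambda>j. axis j 1 :: real ^ 'd) ` J"]
    by (simp add: card_image)
qed

text \<open>The matrix is padded by an identity block to apply the theory of \<^const>\<open>det\<close>.\<close>

lemma det_on_nonzero_kernel:
  fixes B :: "'d::finite \<Rightarrow> 'd \<Rightarrow> real"
  assumes "det_on J B \<noteq> 0" and "\<And>i. i \<in> J \<Longrightarrow> (\<Sum>j\<in>J. B i j * v j) = 0" and "j \<in> J"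
  shows "v j = 0"
proof -
  define A :: "real ^ 'd ^ 'd" where
    "A = (\<chi> i j. if i \<in> J \<and> j \<in> J then B i j else if i = j then 1 else 0)"
  have "det A = (\<Sum>\<sigma> | \<sigma> permutes J. of_int (sign \<sigma>) * (\<Prod>i\<in>UNIV. A $ i $ \<sigma> i))"
    unfolding det_def
  proof (rule sum.mono_neutral_right)
    show "{\<sigma>. \<sigma> permutes J} \<subseteq> {\<sigma>. \<sigma> permutes UNIV}" by (auto intro: permutes_subset)
    show "\<forall>\<sigma>\<in>{\<sigma>. \<sigma> permutes UNIV} - {\<sigma>. \<sigma> permutes J}.
        of_int (sign \<sigma>) * (\<Prod>i\<in>UNIV. A $ i $ \<sigma> i) = 0"
    proof
      \<comment> \<open>A permutation moving a point outside \<open>J\<close> meets an off-diagonal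
        zero of the identity block, so its Leibniz term vanishes.\<close>
      fix \<sigma> assume \<sigma>: "\<sigma> \<in> {\<sigma>. \<sigma> permutes (UNIV :: 'd set)} - {\<sigma>. \<sigma> permutes J}"
      then obtain i where "i \<notin> J" "\<sigma> i \<noteq> i"
        using permutes_superset[of \<sigma> UNIV J] by auto
      then have "A $ i $ \<sigma> i = 0" by (simp add: A_def)
      then have "(\<Prod>i\<in>UNIV. A $ i $ \<sigma> i) = 0" by (auto intro!: prod_zero)
      then show "of_int (sign \<sigma>) * (\<Prod>i\<in>UNIV. A $ i $ \<sigma> i) = 0" by simp
    qed
  qed (simp add: finite_permutations)
  also have "\<dots> = det_on J B"
    unfolding det_on_def
  proof (rule sum.cong[OF refl])
    fix \<sigma> assume "\<sigma> \<in> {\<sigma>. \<sigma> permutes J}"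
    then have \<sigma>: "\<sigma> permutes J" by simp
    have "(\<Prod>i\<in>UNIV. A $ i $ \<sigma> i) = (\<Prod>i\<in>J. A $ i $ \<sigma> i)"
      by (rule prod.mono_neutral_right) (auto simp: A_def permutes_not_in[OF \<sigma>])
    also have "\<dots> = (\<Prod>i\<in>J. B i (\<sigma> i))"
      by (rule prod.cong) (auto simp: A_def permutes_in_image[OF \<sigma>])
    finally show "of_int (sign \<sigma>) * (\<Prod>i\<in>UNIV. A $ i $ \<sigma> i) = of_int (sign \<sigma>) * (\<Prod>i\<in>J. B i (\<sigma> i))"
      by simp
  qed
  finally have inv: "invertible A" using assms(1) by (simp add: invertible_det_nz)
  define w :: "real ^ 'd" where "w = (\<chi> j. if j \<in> J then v j else 0)"
  have "(A *v w) $ i = 0" for i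
  proof -
    have "(A *v w) $ i = (\<Sum>j\<in>J. A $ i $ j * v j)"
      unfolding matrix_vector_mult_def w_def
      by (simp add: if_distrib sum.If_cases cong: if_cong)
    also have "\<dots> = 0"
    proof (cases "i \<in> J")
      case True
      then show ?thesis using assms(2)[OF True] by (simp add: A_def)
    next
      case False
      then show ?thesis by (intro sum.neutral) (auto simp: A_def)
    qed
    finally show ?thesis .
  qed
  then have "A *v w = A *v 0" by (simp add: vec_eq_iff)
  then have "w = 0" using inj_matrix_vector_mult[OF inv] by (rule injD[rotated])
  then have "w $ j = 0" by simp
  then show ?thesis using \<open>j \<in> J\<close> by (simp add: w_def)
qed

text \<open>The determinant bound makes the minor nonzero. A common vector of both subspaces
  vanishes in the coordinates outside \<open>I\<close>, so its coefficients with respect to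
  \<open>c\<close> lie in the kernel of the minor. The dimensions add up to that of the whole
  space.\<close>

lemma complementary_admissible:
  fixes \<alpha> :: "(real ^ 'd) set"
  assumes adm: "admissible \<alpha> I" and \<alpha>: "orthonormal \<alpha>"
  shows "complementary (coord_plane I) (orthogonal_comp (span \<alpha>))"
proof -
  let ?W = "orthogonal_comp (span \<alpha>)"
  obtain c :: "'d \<Rightarrow> real ^ 'd" where c: "span (c ` (- I)) = ?W"
    and orth: "\<forall>i\<in>- I. \<forall>j\<in>- I. c i \<bullet> c j = (if i = j then 1 else 0)"
    and det: "\<bar>det_on (- I) (\<lambda>i j. c j $ i)\<bar> > 1 / (2 * sqrt (real (CARD('d) choose card \<alpha>)))"
    using adm unfolding admissible_def by auto
  have "0 \<le> 1 / (2 * sqrt (real (CARD('d) choose card \<alpha>)))" by simp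
  then have nz: "det_on (- I) (\<lambda>i j. c j $ i) \<noteq> 0" using det by linarith
  have sub: "subspace (coord_plane I :: (real ^ 'd) set)" "subspace ?W"
    by (auto simp: coord_plane_def subspace_orthogonal_comp)
  have int: "coord_plane I \<inter> ?W = {0}"
  proof -
    have "x = 0" if x: "x \<in> coord_plane I" "x \<in> ?W" for x
    proof -
      have "x \<in> span (c ` (- I))" using x(2) c by simp
      then obtain u where "x = (\<Sum>y\<in>c ` (- I). u y *\<^sub>R y)" by (auto simp: span_finite)
      moreover have "inj_on c (- I)" using orth by (metis inj_onI zero_neq_one)
      ultimately obtain v where v: "x = (\<Sum>j\<in>- I. v j *\<^sub>R c j)"
        by (auto simp: sum.reindex)
      have "(\<Sum>j\<in>- I. c j $ i * v j) = 0" if "i \<in> - I" for i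
      proof -
        have "x $ i = 0" using that x(1) by (auto simp: coord_plane_eq)
        then show ?thesis unfolding v by (simp add: mult.commute)
      qed
      then have "v j = 0" if "j \<in> - I" for j
        using det_on_nonzero_kernel[OF nz _ that] by blast
      then show "x = 0" unfolding v by (simp)
    qed
    then show ?thesis using subspace_0[OF sub(1)] subspace_0[OF sub(2)] by blast
  qed
  have cards: "card I = card \<alpha>" "card \<alpha> \<le> CARD('d)"
    using adm card_mono[of UNIV I] by (auto simp: admissible_def)
  have "dim {x + y |x y. x \<in> coord_plane I \<and> y \<in> ?W} + dim (coord_plane I \<inter> ?W) =
      dim (coord_plane I :: (real ^ 'd) set) + dim ?W"
    by (rule dim_sums_Int[OF sub])
  then have "dim {x + y |x y. x \<in> coord_plane I \<and> y \<in> ?W} = DIM(real ^ 'd)"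
    using cards by (simp add: int dim_coord_plane dim_orthonormal_span[OF \<alpha>])
  then have "span {x + y |x y. x \<in> coord_plane I \<and> y \<in> ?W} = UNIV"
    using dim_eq_full by blast
  moreover have "span {x + y |x y. x \<in> coord_plane I \<and> y \<in> ?W} = {x + y |x y. x \<in> coord_plane I \<and> y \<in> ?W}"
    using subspace_sums[OF sub] by (simp add: span_eq_iff)
  ultimately have "\<exists>u w. x = u + w \<and> u \<in> coord_plane I \<and> w \<in> ?W" for x by blast
  then have "\<exists>u\<in>coord_plane I. x - u \<in> ?W" for x
    by (metis add_diff_cancel_left')
  then show ?thesis using sub int by (auto simp: complementary_def)
qed

definition core_cube :: "real \<Rightarrow> (real ^ 'd) set" where
  "core_cube t = {x. \<forall>i. \<bar>x $ i - 1 / 2\<bar> \<le> t / 2}"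

lemma core_cube_1: "core_cube 1 = unit_cube"
  by (auto simp: core_cube_def unit_cube_def abs_le_iff) (smt (verit) field_sum_of_halves)+

lemma core_cube_mono: "s \<le> t \<Longrightarrow> core_cube s \<subseteq> core_cube t"
  unfolding core_cube_def by (fastforce intro: order_trans)

lemma core_cube_subset_unit_cube: "t \<le> 1 \<Longrightarrow> core_cube t \<subseteq> unit_cube"
  using core_cube_mono core_cube_1 by blast

lemma core_cube_dilate:
  fixes x :: "real ^ 'd"
  assumes "x \<in> core_cube s"
  shows "(\<chi> i. 1 / 2) + t *\<^sub>R (x - (\<chi> i. 1 / 2)) \<in> core_cube (\<bar>t\<bar> * s)"
proof -
  have "\<bar>t\<bar> * \<bar>x $ i - 1 / 2\<bar> \<le> \<bar>t\<bar> * (s / 2)" for i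
    using assms by (intro mult_left_mono) (auto simp: core_cube_def)
  then show ?thesis by (auto simp: core_cube_def abs_mult)
qed

lemma compact_core_cube: "compact (core_cube t :: (real ^ 'd) set)"
proof -
  have "core_cube t = cbox (\<chi> i. 1 / 2 - t / 2) ((\<chi> i. 1 / 2 + t / 2) :: real ^ 'd)"
  proof (intro set_eqI iffI)
    fix x :: "real ^ 'd" assume "x \<in> core_cube t"
    then have "\<bar>x $ i - 1 / 2\<bar> \<le> t / 2" for i by (simp add: core_cube_def)
    then have "1 / 2 - t / 2 \<le> x $ i \<and> x $ i \<le> 1 / 2 + t / 2" for i
      unfolding abs_le_iff by (metis add.commute diff_le_eq le_diff_eq minus_diff_eq)
    then show "x \<in> cbox (\<chi> i. 1 / 2 - t / 2) (\<chi> i. 1 / 2 + t / 2)" by (simp add: mem_box_cart)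
  next
    fix x :: "real ^ 'd" assume "x \<in> cbox (\<chi> i. 1 / 2 - t / 2) (\<chi> i. 1 / 2 + t / 2)"
    then have "1 / 2 - t / 2 \<le> x $ i \<and> x $ i \<le> 1 / 2 + t / 2" for i by (simp add: mem_box_cart)
    then have "\<bar>x $ i - 1 / 2\<bar> \<le> t / 2" for i
      unfolding abs_le_iff by (metis add.commute diff_le_eq le_diff_eq minus_diff_eq)
    then show "x \<in> core_cube t" by (simp add: core_cube_def)
  qed
  then show ?thesis by (metis compact_cbox)
qed

text \<open>By linearity the homothety can be carried out in the cube before projecting. The cube is
  symmetric about its centre, so a negative ratio has the same effect as its absolute value.\<close>

lemma centred_copy_eq:
  fixes \<alpha> :: "(real ^ 'd) set"
  assumes comp: "complementary (coord_plane I) (orthogonal_comp (span \<alpha>))" and "centred_copy \<alpha> I S"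
  shows "\<exists>t>0. S = oblique_proj \<alpha> I ` core_cube t"
proof -
  let ?c = "(\<chi> i. 1 / 2) :: real ^ 'd"
  obtain t where t: "t \<noteq> 0"
    and S: "S = (\<lambda>z. shadow_centre \<alpha> I + t *\<^sub>R (z - shadow_centre \<alpha> I)) ` shadow \<alpha> I"
    using assms(2) by (auto simp: centred_copy_def)
  interpret linear "oblique_proj \<alpha> I" unfolding oblique_proj_def by (rule linear_proj_along[OF comp])
  have "S = oblique_proj \<alpha> I ` (\<lambda>x. ?c + t *\<^sub>R (x - ?c)) ` unit_cube"
    unfolding S shadow_def shadow_centre_def by (simp add: image_image add diff scale)
  also have "(\<lambda>x. ?c + t *\<^sub>R (x - ?c)) ` unit_cube = core_cube \<bar>t\<bar>"
  proof
    show "(\<lambda>x. ?c + t *\<^sub>R (x - ?c)) ` unit_cube \<subseteq> core_cube \<bar>t\<bar>"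
      using core_cube_dilate[of _ 1 t] by (auto simp: core_cube_1)
    show "core_cube \<bar>t\<bar> \<subseteq> (\<lambda>x. ?c + t *\<^sub>R (x - ?c)) ` unit_cube"
    proof
      fix x :: "real ^ 'd" assume "x \<in> core_cube \<bar>t\<bar>"
      then have "?c + (1 / t) *\<^sub>R (x - ?c) \<in> unit_cube"
        using core_cube_dilate[of x "\<bar>t\<bar>" "1 / t"] t by (simp add: core_cube_1)
      then show "x \<in> (\<lambda>x. ?c + t *\<^sub>R (x - ?c)) ` unit_cube"
        using t by (intro image_eqI[of _ _ "?c + (1 / t) *\<^sub>R (x - ?c)"]) (auto simp: algebra_simps)
    qed
  qed
  finally show ?thesis using t by (intro exI[of _ "\<bar>t\<bar>"]) auto
qed

text \<open>A point of the smaller set at maximal distance from the centre can be pushed outwards.\<close>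

lemma projected_core_subset_interior:
  fixes U W :: "(real ^ 'd) set"
  assumes comp: "complementary U W" and U: "U \<noteq> {0}" and st: "s > 0" "t > 0"
    and sub: "proj_along U W ` core_cube t \<subseteq> top_of_set U interior_of (proj_along U W ` core_cube s)"
  shows "t < s"
proof -
  let ?c = "(\<chi> i. 1 / 2) :: real ^ 'd"
  let ?pr = "proj_along U W"
  interpret linear ?pr by (rule linear_proj_along[OF comp])
  have subU: "subspace U" using comp by (simp add: complementary_def)
  let ?N = "\<lambda>x. norm (?pr (x - ?c))"
  have "?c \<in> core_cube t" using st by (simp add: core_cube_def)
  then have "core_cube t \<noteq> ({} :: (real ^ 'd) set)" by blast
  moreover have "continuous_on (core_cube t) ?N"
    by (intro continuous_intros linear_continuous_on_compose[OF _ linear_axioms])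
  ultimately obtain x where x: "x \<in> core_cube t" "\<And>y. y \<in> core_cube t \<Longrightarrow> ?N y \<le> ?N x"
    using continuous_attains_sup[OF compact_core_cube] by blast
  \<comment> \<open>A nonzero vector of \<open>U\<close> is fixed by the projection, and a short
    multiple of it stays in the core cube, so the maximal distance is positive.\<close>
  have "?N x > 0"
  proof -
    obtain u where u: "u \<in> U" "u \<noteq> 0" using U subspace_0[OF subU] by blast
    define e where "e = t / (2 * norm u)"
    have "e > 0" using u st by (simp add: e_def)
    have "?c + e *\<^sub>R u \<in> core_cube t"
    proof -
      have "\<bar>e * u $ i\<bar> \<le> t / 2" for i
      proof -
        have "\<bar>e * u $ i\<bar> \<le> e * norm u"
          using \<open>e > 0\<close> component_le_norm_cart[of u i] by (simp add: abs_mult)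
        then show ?thesis using u by (simp add: e_def)
      qed
      then show ?thesis by (simp add: core_cube_def)
    qed
    moreover have "?N (?c + e *\<^sub>R u) > 0"
      using \<open>e > 0\<close> u by (simp add: scale proj_along_fixed[OF comp])
    ultimately show ?thesis using x(2) by fastforce
  qed
  have "?pr x \<in> top_of_set U interior_of (?pr ` core_cube s)" using sub x(1) by blast
  then obtain T where T: "open T" "?pr x \<in> T" "T \<inter> U \<subseteq> ?pr ` core_cube s"
    by (auto simp: interior_of_def openin_open)
  obtain \<delta> where \<delta>: "\<delta> > 0" "ball (?pr x) \<delta> \<subseteq> T" using T open_contains_ball by blast
  define e where "e = \<delta> / (2 * ?N x)"
  have "e > 0" using \<delta> \<open>?N x > 0\<close> by (simp add: e_def)
  define z where "z = ?pr x + e *\<^sub>R ?pr (x - ?c)"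
  have "dist (?pr x) z < \<delta>" using \<open>e > 0\<close> \<delta> \<open>?N x > 0\<close> by (simp add: z_def dist_norm e_def)
  then have "z \<in> T" using \<delta>(2) by (auto simp: subset_iff)
  moreover have "z \<in> U" unfolding z_def
    by (intro subspace_add subU subspace_scale proj_along_props[OF comp])
  ultimately obtain y where y: "y \<in> core_cube s" "z = ?pr y" using T(3) by blast
  have "?pr (y - ?c) = z - ?pr ?c" using y(2) by (simp add: diff)
  also have "\<dots> = (1 + e) *\<^sub>R ?pr (x - ?c)" by (simp add: z_def diff algebra_simps)
  finally have Ny: "?N y = (1 + e) * ?N x" using \<open>e > 0\<close> by simp
  \<comment> \<open>Shrinking \<open>y\<close> back into the smaller core cube and using maximality
    of \<open>x\<close> bounds the push: \<open>(t / s) * (1 + e) \<le> 1\<close>.\<close>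
  have "?c + (t / s) *\<^sub>R (y - ?c) \<in> core_cube t"
    using core_cube_dilate[OF y(1), of "t / s"] st by simp
  then have "?N (?c + (t / s) *\<^sub>R (y - ?c)) \<le> ?N x" by (rule x(2))
  then have "(t / s) * ?N y \<le> ?N x" using st by (simp add: scale)
  then have "(t / s) * (1 + e) \<le> 1" unfolding Ny mult.assoc[symmetric] using \<open>?N x > 0\<close> by (metis mult_le_cancel_right2 not_le)
  then have "t * (1 + e) \<le> s" using st by (simp add: field_simps)
  moreover have "t < t * (1 + e)" using st \<open>e > 0\<close> by simp
  ultimately show ?thesis by linarith
qed

text \<open>Each application of the operator chooses one more column, so the iterate is a sum over
  words of length \<open>r\<close>. A word contributes only if the fibre of \<open>x\<close> meets
  the copy of \<open>S\<close> in its cube. The upper bound is the direction that turns Condition A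
  into a lower bound for a mean count.\<close>

lemma F_op_funpow_le:
  fixes \<alpha> :: "(real ^ 'd) set"
  assumes comp: "complementary (coord_plane I) (orthogonal_comp (span \<alpha>))"
    and M: "M \<ge> 1" and p: "\<And>C. C \<in> digits M \<Longrightarrow> 0 \<le> p C"
  shows "(F_op M p \<alpha> I ^^ r) (indicat_real (oblique_proj \<alpha> I ` S)) x \<le>
    (\<Sum>D\<in>{D \<in> words M r. \<exists>u\<in>S. x = oblique_proj \<alpha> I (cube_map M D u)}. prod_list (map p D))"
proof (induction r arbitrary: x)
  case 0
  have "{D \<in> words M 0. \<exists>u\<in>S. x = oblique_proj \<alpha> I (cube_map M D u)} =
      (if x \<in> oblique_proj \<alpha> I ` S then {[]} else {})" by auto
  then show ?case by (simp add: indicator_def)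
next
  case (Suc r)
  let ?pr = "oblique_proj \<alpha> I"
  let ?f = "(F_op M p \<alpha> I ^^ r) (indicat_real (?pr ` S))"
  let ?Cs = "{C. C \<in> digits M \<and> x \<in> ?pr ` cube M [C]}"
  let ?Ds = "\<lambda>C. {D \<in> words M r. \<exists>u\<in>S. zoom M \<alpha> I [C] x = ?pr (cube_map M D u)}"
  have sub: "subspace (orthogonal_comp (span \<alpha>))" using comp by (simp add: complementary_def)
  \<comment> \<open>Cube maps are homotheties and therefore respect fibres. This makes the value of
    \<open>zoom\<close> independent of the chosen preimage.\<close>
  have eq_iff: "?pr (cube_map M A v) = ?pr (cube_map M A w) \<longleftrightarrow> ?pr v = ?pr w" for A v w
    unfolding oblique_proj_def proj_along_eq_iff[OF comp] cube_map_diff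
    using M subspace_scale[OF sub, of "v - w" "1 / real M ^ length A"]
      subspace_scale[OF sub, of "(1 / real M ^ length A) *\<^sub>R (v - w)" "real M ^ length A"] by auto
  have zoom: "zoom M \<alpha> I [C] x = ?pr v" if "v \<in> unit_cube" "x = ?pr (cube_map M [C] v)" for C v
    unfolding zoom_def using that by (intro the_equality) (auto simp: eq_iff)
  have fin: "finite ?Cs" "finite (?Ds C)" for C by (auto simp: finite_digits finite_words)
  have "(F_op M p \<alpha> I ^^ Suc r) (indicat_real (?pr ` S)) x = (\<Sum>C\<in>?Cs. p C * ?f (zoom M \<alpha> I [C] x))"
    by (simp add: F_op_def)
  also have "\<dots> \<le> (\<Sum>C\<in>?Cs. p C * (\<Sum>D\<in>?Ds C. prod_list (map p D)))"
    using p by (intro sum_mono mult_left_mono Suc) auto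
  also have "\<dots> = (\<Sum>E\<in>(\<lambda>(C, D). C # D) ` (SIGMA C:?Cs. ?Ds C). prod_list (map p E))"
    using fin by (subst sum.reindex) (auto simp: inj_on_def sum.Sigma sum_distrib_left case_prod_unfold)
  also have "\<dots> \<le> (\<Sum>E\<in>{E \<in> words M (Suc r). \<exists>u\<in>S. x = ?pr (cube_map M E u)}. prod_list (map p E))"
  proof (rule sum_mono2)
    show "(\<lambda>(C, D). C # D) ` (SIGMA C:?Cs. ?Ds C) \<subseteq>
        {E \<in> words M (Suc r). \<exists>u\<in>S. x = ?pr (cube_map M E u)}"
    proof clarify
      fix C D u y assume C: "C \<in> digits M" "y \<in> cube M [C]" "x = ?pr y"
        and D: "D \<in> words M r" and u: "u \<in> S" "zoom M \<alpha> I [C] (?pr y) = ?pr (cube_map M D u)"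
      obtain v where v: "v \<in> unit_cube" "y = cube_map M [C] v" using C(2) by (auto simp: cube_def)
      have "?pr v = ?pr (cube_map M D u)" using zoom[OF v(1), of C] C(3) v(2) u(2) by simp
      then have "?pr y = ?pr (cube_map M (C # D) u)"
        unfolding cube_map_Cons[of M C D] v(2) eq_iff .
      then show "C # D \<in> words M (Suc r) \<and> (\<exists>u\<in>S. ?pr y = ?pr (cube_map M (C # D) u))"
        using C(1) D u(1) by (auto simp: words_def)
    qed
    fix E assume "E \<in> {E \<in> words M (Suc r). \<exists>u\<in>S. x = ?pr (cube_map M E u)} -
        (\<lambda>(C, D). C # D) ` (SIGMA C:?Cs. ?Ds C)"
    then have "set E \<subseteq> digits M" by (auto simp: words_def)
    then show "0 \<le> prod_list (map p E)" using p by (induction E) auto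
  qed (simp add: finite_words)
  finally show ?case .
qed

text \<open>The conclusion mentions only translates of \<open>W\<close>: the shadow and the index
  set \<open>I\<close> have disappeared, and what remains can be perturbed together with
  \<open>W\<close>.\<close>

lemma condition_A_core_cubes:
  fixes \<alpha> :: "(real ^ 'd) set"
  defines "W \<equiv> orthogonal_comp (span \<alpha>)"
  assumes A: "condition_A M p \<alpha> I" and comp: "complementary (coord_plane I) W" and I: "I \<noteq> {}"
    and M: "M \<ge> 1" and p: "\<And>C. C \<in> digits M \<Longrightarrow> 0 \<le> p C"
  obtains t\<^sub>1 t\<^sub>2 r where "0 < t\<^sub>1" "t\<^sub>1 < t\<^sub>2" "t\<^sub>2 \<le> 1" "r \<ge> 1"
    "\<And>z. z \<in> core_cube t\<^sub>2 \<Longrightarrow>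
       2 \<le> (\<Sum>D\<in>{D \<in> words M r. \<exists>u\<in>core_cube t\<^sub>1. cube_map M D u - z \<in> W}. prod_list (map p D))"
proof -
  let ?pr = "oblique_proj \<alpha> I"
  have pr: "?pr = proj_along (coord_plane I) W" by (simp add: oblique_proj_def W_def)
  note comp' = comp[unfolded W_def]
  obtain I1 I2 r where sub: "I2 \<subseteq> shadow \<alpha> I" and copies: "centred_copy \<alpha> I I1" "centred_copy \<alpha> I I2"
    and "r \<ge> 1" and int: "I1 \<subseteq> top_of_set (coord_plane I) interior_of I2"
      "I2 \<subseteq> top_of_set (coord_plane I) interior_of (shadow \<alpha> I)"
    and F: "\<And>x. x \<in> shadow \<alpha> I \<Longrightarrow> (F_op M p \<alpha> I ^^ r) (indicat_real I1) x \<ge> 2 * indicat_real I2 x"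
    using A unfolding condition_A_def by blast
  obtain s\<^sub>1 where s1: "s\<^sub>1 > 0" "I1 = ?pr ` core_cube s\<^sub>1" using centred_copy_eq[OF comp' copies(1)] by blast
  obtain s\<^sub>2 where s2: "s\<^sub>2 > 0" "I2 = ?pr ` core_cube s\<^sub>2" using centred_copy_eq[OF comp' copies(2)] by blast
  have nz: "coord_plane I \<noteq> ({0} :: (real ^ 'd) set)"
    using I dim_coord_plane[of I] dim_eq_0[of "coord_plane I :: (real ^ 'd) set"] by auto
  have "s\<^sub>1 < s\<^sub>2"
    using int(1) by (intro projected_core_subset_interior[OF comp nz s2(1) s1(1)]) (simp add: s1 s2 pr)
  have "s\<^sub>2 < 1"
    using int(2) by (intro projected_core_subset_interior[OF comp nz _ s2(1)])
      (simp_all add: s2 pr shadow_def core_cube_1)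
  show ?thesis
  proof (rule that[of s\<^sub>1 s\<^sub>2 r])
    fix z :: "real ^ 'd" assume z: "z \<in> core_cube s\<^sub>2"
    have "?pr z \<in> I2" using z s2 by blast
    then have "2 \<le> (F_op M p \<alpha> I ^^ r) (indicat_real I1) (?pr z)"
      using F[of "?pr z"] sub by auto
    also have "\<dots> \<le> (\<Sum>D\<in>{D \<in> words M r. \<exists>u\<in>core_cube s\<^sub>1. ?pr z = ?pr (cube_map M D u)}. prod_list (map p D))"
      unfolding s1(2) by (rule F_op_funpow_le[OF comp' M p])
    also have "{D \<in> words M r. \<exists>u\<in>core_cube s\<^sub>1. ?pr z = ?pr (cube_map M D u)} =
        {D \<in> words M r. \<exists>u\<in>core_cube s\<^sub>1. cube_map M D u - z \<in> W}"
      unfolding pr eq_commute[of "proj_along _ _ z"] by (simp add: proj_along_eq_iff[OF comp])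
    finally show "2 \<le> (\<Sum>D\<in>{D \<in> words M r. \<exists>u\<in>core_cube s\<^sub>1. cube_map M D u - z \<in> W}. prod_list (map p D))" .
  qed (use \<open>s\<^sub>1 > 0\<close> \<open>s\<^sub>1 < s\<^sub>2\<close> \<open>s\<^sub>2 < 1\<close> \<open>r \<ge> 1\<close> in auto)
qed

subsection \<open>From fibres to projections\<close>

definition limit_set :: "nat \<Rightarrow> ((nat ^ 'd) list \<Rightarrow> bool) \<Rightarrow> (real ^ 'd) set" where
  "limit_set M T = (\<Inter>n\<in>{1..}. \<Union>A\<in>surviving M T n. cube M A)"

lemma percolation_set_eq: "percolation_set M X \<omega> = limit_set M (\<lambda>A. X A \<omega>)"
  by (simp add: percolation_set_def level_set_def limit_set_def retained_eq_surviving)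

lemma cube_append_subset:
  assumes "M \<ge> 1" "set B \<subseteq> digits M"
  shows "cube M (A @ B) \<subseteq> cube M A"
  using cube_subset_unit_cube[OF assms] by (auto simp: cube_def cube_map_append)

lemma surviving_cubes_antimono:
  assumes "M \<ge> 1" "m \<le> n"
  shows "(\<Union>A\<in>surviving M T n. cube M A) \<subseteq> (\<Union>A\<in>surviving M T m. cube M A)"
proof
  fix x assume "x \<in> (\<Union>A\<in>surviving M T n. cube M A)"
  then obtain A where A: "A \<in> surviving M T n" "x \<in> cube M A" by auto
  then have "A \<in> words M (m + (n - m))" using assms(2) by (auto simp: surviving_def)
  then obtain B D where BD: "A = B @ D" "B \<in> words M m" "D \<in> words M (n - m)" by (rule words_split)
  then have "B \<in> surviving M T m" using A(1) assms(2) surviving_append_iff[of B M m D "n - m" T] by auto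
  moreover have "x \<in> cube M B"
    using A(2) BD cube_append_subset[OF assms(1), of D B] by (auto simp: words_def)
  ultimately show "x \<in> (\<Union>A\<in>surviving M T m. cube M A)" by blast
qed

text \<open>Nested nonempty compact sets have a common point. The assumption concerns multiples of
  \<open>r\<close> only; since \<open>n \<le> n * r\<close> and the cubes are nested, all levels are
  covered.\<close>

lemma fibre_meets_limit_set:
  assumes M: "M \<ge> 1" and r: "r \<ge> 1" and W: "subspace W"
    and meets: "\<And>n. \<exists>B\<in>surviving M T (n * r). \<exists>x\<in>cube M B. x - y \<in> W"
  shows "\<exists>e\<in>limit_set M T. e - y \<in> W"
proof -
  define F where "F n = (\<Union>A\<in>surviving M T n. cube M A) \<inter> {x. x - y \<in> W}" for n
  have "closed ((\<lambda>x. x - y) -` W)"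
    by (intro closed_vimage closed_subspace W continuous_intros)
  then have "compact (F n)" for n
    unfolding F_def vimage_def
    by (intro compact_Int_closed compact_UN finite_surviving compact_cube) auto
  moreover have "F n \<noteq> {}" for n
  proof -
    have "n \<le> n * r" using r by simp
    then show ?thesis
      using meets[of n] surviving_cubes_antimono[OF M, of n "n * r" T] unfolding F_def by blast
  qed
  moreover have "F n \<subseteq> F m" if "m \<le> n" for m n
    using surviving_cubes_antimono[OF M that] unfolding F_def by blast
  ultimately have "\<Inter> (range F) \<noteq> {}" by (rule compact_nest)
  then show ?thesis by (auto simp: F_def limit_set_def)
qed

lemma limit_set_subtree:
  assumes M: "M \<ge> 1" and A: "A \<in> surviving M T m" and e: "e \<in> limit_set M (\<lambda>B. T (A @ B))"
  shows "cube_map M A e \<in> limit_set M T"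
proof -
  have "cube_map M A e \<in> (\<Union>A\<in>surviving M T n. cube M A)" if n: "n \<ge> 1" for n
  proof -
    obtain B where B: "B \<in> surviving M (\<lambda>B. T (A @ B)) n" "e \<in> cube M B"
      using e n unfolding limit_set_def by auto
    then have "A @ B \<in> surviving M T (m + n)"
      using A surviving_subset by (subst surviving_append_iff) blast+
    moreover have "cube_map M A e \<in> cube M (A @ B)"
      using B(2) by (auto simp: cube_def cube_map_append)
    ultimately show ?thesis using surviving_cubes_antimono[OF M, of n "m + n" T] by auto
  qed
  then show ?thesis by (auto simp: limit_set_def)
qed

lemma orth_proj_interior_nonempty:
  fixes \<alpha> :: "(real ^ 'd) set"
  assumes e: "\<epsilon> > 0" and cover: "\<And>x. x \<in> ball x\<^sub>0 \<epsilon> \<Longrightarrow> \<exists>e\<in>E. e - x \<in> orthogonal_comp (span \<alpha>)"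
  shows "top_of_set (span \<alpha>) interior_of (orth_proj \<alpha> ` E) \<noteq> {}"
proof -
  note comp = complementary_span_orthogonal_comp[of \<alpha>]
  let ?pr = "orth_proj \<alpha>"
  have pr: "?pr = proj_along (span \<alpha>) (orthogonal_comp (span \<alpha>))" by (simp add: orth_proj_def)
  interpret linear ?pr unfolding pr by (rule linear_proj_along[OF comp])
  have eq_iff: "?pr a = ?pr b \<longleftrightarrow> a - b \<in> orthogonal_comp (span \<alpha>)" for a b
    unfolding pr by (rule proj_along_eq_iff[OF comp])
  have "span \<alpha> \<inter> ball (?pr x\<^sub>0) \<epsilon> \<subseteq> ?pr ` E"
  proof
    fix y assume y: "y \<in> span \<alpha> \<inter> ball (?pr x\<^sub>0) \<epsilon>"
    \<comment> \<open>The translate of \<open>y\<close> by \<open>x\<^sub>0 - ?pr x\<^sub>0\<close>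
      lies on the fibre of \<open>y\<close> and within the ball where fibres are known to meet
      \<open>E\<close>.\<close>
    have "dist x\<^sub>0 (y + (x\<^sub>0 - ?pr x\<^sub>0)) = dist (?pr x\<^sub>0) y" by (simp add: dist_norm algebra_simps)
    then obtain e where "e \<in> E" "e - (y + (x\<^sub>0 - ?pr x\<^sub>0)) \<in> orthogonal_comp (span \<alpha>)"
      using cover[of "y + (x\<^sub>0 - ?pr x\<^sub>0)"] y by auto
    then have "?pr e = ?pr (y + (x\<^sub>0 - ?pr x\<^sub>0))" using eq_iff by blast
    also have "\<dots> = ?pr y + (?pr x\<^sub>0 - ?pr (?pr x\<^sub>0))" by (simp add: add diff)
    also have "\<dots> = y"
      using y proj_along_fixed[OF comp] proj_along_props(1)[OF comp] by (simp add: pr)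
    finally show "y \<in> ?pr ` E" using \<open>e \<in> E\<close> by auto
  qed
  moreover have "openin (top_of_set (span \<alpha>)) (span \<alpha> \<inter> ball (?pr x\<^sub>0) \<epsilon>)" by (rule openin_open_Int) simp
  moreover have "?pr x\<^sub>0 \<in> span \<alpha> \<inter> ball (?pr x\<^sub>0) \<epsilon>"
    using e proj_along_props(1)[OF comp] by (simp add: pr)
  ultimately show ?thesis unfolding interior_of_def by blast
qed

text \<open>The random word \<open>A\<close> is found before a direction is chosen, so one thriving
  subtree serves all of \<W> simultaneously. Its cube map preserves the directions of fibres and
  shrinks the ball of base points to radius \<open>\<epsilon> / real M ^ m\<close>.\<close>

lemma (in growth_scheme) projections_have_interior:
  fixes X :: "(nat ^ 'd) list \<Rightarrow> 'w \<Rightarrow> bool" and y\<^sub>0 :: "real ^ 'd"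
  assumes X: "fractal_percolation P M p X" and r: "r \<ge> 1" and \<epsilon>: "\<epsilon> > 0"
    and nonempty: "\<W> \<noteq> {}" and \<W>: "\<And>W. W \<in> \<W> \<Longrightarrow> subspace W"
    and meets: "\<And>T W y n. thriving T \<Longrightarrow> W \<in> \<W> \<Longrightarrow> y \<in> ball y\<^sub>0 \<epsilon> \<Longrightarrow>
      \<exists>B\<in>surviving M T (n * r). \<exists>x\<in>cube M B. x - y \<in> W"
  shows "AE \<omega> in P. percolation_set M X \<omega> \<noteq> {} \<longrightarrow>
    (\<forall>\<alpha>. orthogonal_comp (span \<alpha>) \<in> \<W> \<longrightarrow>
       top_of_set (span \<alpha>) interior_of (orth_proj \<alpha> ` percolation_set M X \<omega>) \<noteq> {})"
proof -
  have M1: "M \<ge> 1" using M by simp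
  have survives: "surviving M T n \<noteq> {}" if "thriving T" for T n
  proof -
    obtain W where "W \<in> \<W>" using nonempty by blast
    moreover have "y\<^sub>0 \<in> ball y\<^sub>0 \<epsilon>" using \<epsilon> by simp
    ultimately have "surviving M T (n * r) \<noteq> {}" using meets[OF that] by blast
    moreover have "n \<le> n * r" using r by simp
    ultimately show ?thesis by (rule surviving_nonempty_mono)
  qed
  have "AE \<omega> in P. (\<forall>n. surviving M (\<lambda>A. X A \<omega>) n \<noteq> {}) \<longrightarrow>
    (\<exists>m. \<exists>A\<in>surviving M (\<lambda>A. X A \<omega>) m. thriving (\<lambda>B. X (A @ B) \<omega>))"
    by (rule thriving_subtree_on_survival[OF X]) (rule survives)
  then show ?thesis
  proof eventually_elim
    case (elim \<omega>)
    show ?case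
    proof (intro impI allI)
      fix \<alpha> :: "(real ^ 'd) set"
      assume ne: "percolation_set M X \<omega> \<noteq> {}" and \<alpha>: "orthogonal_comp (span \<alpha>) \<in> \<W>"
      let ?T = "\<lambda>A. X A \<omega>" and ?W = "orthogonal_comp (span \<alpha>)"
      have "surviving M ?T n \<noteq> {}" for n
        using ne by (cases n) (auto simp: percolation_set_eq limit_set_def surviving_def[of M _ 0])
      then obtain m A where A: "A \<in> surviving M ?T m" and thr: "thriving (\<lambda>B. ?T (A @ B))"
        using elim by blast
      have len: "length A = m" using A by (simp add: surviving_def words_def)
      have Mm: "real M ^ m > 0" using M by simp
      have "\<exists>e\<in>limit_set M ?T. e - x \<in> ?W"
        if x: "x \<in> ball (cube_map M A y\<^sub>0) (\<epsilon> / real M ^ m)" for x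
      proof -
        define y where "y = y\<^sub>0 + (real M ^ m) *\<^sub>R (x - cube_map M A y\<^sub>0)"
        have xy: "x = cube_map M A y"
        proof -
          have "cube_map M A y - cube_map M A y\<^sub>0 = x - cube_map M A y\<^sub>0"
            unfolding cube_map_diff using M len by (simp add: y_def)
          then show ?thesis by simp
        qed
        have "dist y\<^sub>0 y = real M ^ m * dist (cube_map M A y\<^sub>0) x"
          using Mm by (simp add: y_def dist_norm norm_minus_commute)
        then have "y \<in> ball y\<^sub>0 \<epsilon>" using x Mm by (simp add: field_simps)
        from fibre_meets_limit_set[OF M1 r \<W>[OF \<alpha>] meets[OF thr \<alpha> this]]
        obtain e where e: "e \<in> limit_set M (\<lambda>B. ?T (A @ B))" "e - y \<in> ?W" by blast
        have "cube_map M A e - x \<in> ?W"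
          unfolding xy cube_map_diff by (intro subspace_scale \<W> \<alpha> e)
        then show ?thesis using limit_set_subtree[OF M1 A e(1)] by blast
      qed
      then show "top_of_set (span \<alpha>) interior_of (orth_proj \<alpha> ` percolation_set M X \<omega>) \<noteq> {}"
        unfolding percolation_set_eq
        by (intro orth_proj_interior_nonempty[of "\<epsilon> / real M ^ m" "cube_map M A y\<^sub>0"])
           (use \<epsilon> Mm in auto)
    qed
  qed
qed

lemma ball_centre_subset_core_cube: "ball (\<chi> i. 1 / 2) (t / 2) \<subseteq> core_cube t"
proof
  fix x :: "real ^ 'd" assume "x \<in> ball (\<chi> i. 1 / 2) (t / 2)"
  then have "norm (x - (\<chi> i. 1 / 2)) < t / 2" by (simp add: dist_norm norm_minus_commute)
  then have "\<bar>x $ i - 1 / 2\<bar> \<le> t / 2" for i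
    using component_le_norm_cart[of "x - (\<chi> i. 1 / 2)" i] by simp
  then show "x \<in> core_cube t" by (simp add: core_cube_def)
qed

subsection \<open>Coordinate planes\<close>

text \<open>At level \<open>n\<close> a fibre is described by the first \<open>n\<close>
  base-\<open>M\<close> digits of its coordinates in \<open>J\<close>. These finite descriptions are
  exact, so no fibre has to be perturbed and \<open>agree\<close> plays the part of both
  \<open>wide\<close> and \<open>narrow\<close>.\<close>

lemma coordinate_projection_has_interior:
  fixes X :: "(nat ^ 'd) list \<Rightarrow> 'w \<Rightarrow> bool" and J :: "'d set"
  assumes X: "fractal_percolation P M p X" and M: "M \<ge> 2"
    and p: "\<And>C. C \<in> digits M \<Longrightarrow> 0 < p C \<and> p C < 1"
    and sums: "\<And>i. (\<forall>j\<in>J. i j < M) \<Longrightarrow> (\<Sum>C | C \<in> digits M \<and> (\<forall>j\<in>J. C $ j = i j). p C) > 1"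
  shows "AE \<omega> in P. percolation_set M X \<omega> \<noteq> {} \<longrightarrow>
    (\<forall>\<alpha>. span \<alpha> = coord_plane J \<longrightarrow>
       top_of_set (span \<alpha>) interior_of (orth_proj \<alpha> ` percolation_set M X \<omega>) \<noteq> {})"
proof -
  define column where "column c = (\<Sum>C | C \<in> digits M \<and> (\<forall>j\<in>J. C $ j = c $ j). p C)" for c :: "nat ^ 'd"
  define \<mu> where "\<mu> = Min (column ` digits M)"
  define \<rho> where "\<rho> = (1 + \<mu>) / 2"
  have ne: "digits M \<noteq> ({} :: (nat ^ 'd) set)" using card_digits_ge_2[OF M] by (metis card.empty not_numeral_le_zero)
  have "\<mu> \<in> column ` digits M" unfolding \<mu>_def using ne by (intro Min_in) (auto simp: finite_digits)
  then have "\<mu> > 1" using sums by (auto simp: column_def digits_def)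
  have \<mu>_le: "\<mu> \<le> column c" if "c \<in> digits M" for c
    unfolding \<mu>_def using that by (intro Min_le) (auto simp: finite_digits)
  define agree :: "(nat ^ 'd) list \<Rightarrow> (nat ^ 'd) list \<Rightarrow> bool" where
    "agree = (\<lambda>\<theta> A. \<forall>l<length A. \<forall>j\<in>J. A ! l $ j = \<theta> ! l $ j)"
  let ?b = "real (card (digits M :: (nat ^ 'd) set))"
  \<comment> \<open>The net consists of words of length \<open>n + 1\<close> because stage
    \<open>n\<close> also reads the digit with index \<open>n\<close>.\<close>
  interpret growth_scheme M 1 p \<rho> \<mu> ?b ?b "\<lambda>n. words M (Suc n)" agree agree
  proof
    show "1 < \<rho>" "\<rho> < \<mu>" using \<open>\<mu> > 1\<close> by (auto simp: \<rho>_def)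
    show "1 \<le> ?b" using card_digits_ge_2[OF M, where 'd = 'd] by linarith
    show "finite (words M (Suc n))" for n by (rule finite_words)
    have "card (words M (Suc n) :: (nat ^ 'd) list set) = card (digits M :: (nat ^ 'd) set) ^ Suc n" for n
      using card_lists_length_eq[OF finite_digits[of M], of "Suc n"]
      by (simp add: words_def conj_commute)
    then show "real (card (words M (Suc n) :: (nat ^ 'd) list set)) \<le> ?b * ?b ^ n" for n by simp
    show "\<mu> \<le> (\<Sum>D\<in>{D \<in> words M 1. agree \<theta> (A @ D)}. prod_list (map p D))"
      if \<theta>: "\<theta> \<in> words M (Suc n)" and A: "A \<in> words M (n * 1)" and ag: "agree \<theta> A" for n \<theta> A
    proof -
      have len: "length A = n" using A by (simp add: words_def)
      have "\<theta> ! n \<in> digits M" using \<theta> by (auto simp: words_def)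
      then have "\<mu> \<le> column (\<theta> ! n)" by (rule \<mu>_le)
      also have "\<dots> = (\<Sum>D\<in>(\<lambda>C. [C]) ` {C \<in> digits M. \<forall>j\<in>J. C $ j = \<theta> ! n $ j}. prod_list (map p D))"
        by (subst sum.reindex) (auto simp: column_def inj_on_def)
      also have "(\<lambda>C. [C]) ` {C \<in> digits M. \<forall>j\<in>J. C $ j = \<theta> ! n $ j} = {D \<in> words M 1. agree \<theta> (A @ D)}"
        using ag len by (auto simp: words_def agree_def length_Suc_conv nth_append less_Suc_eq)
      finally show ?thesis .
    qed
  qed (use M p in auto)
  have many: "\<rho> ^ n \<le> real (card {A \<in> surviving M T (n * 1). agree \<theta> A})"
    if "thriving T" "\<theta> \<in> words M n" for T n \<theta>
    using that(2)
  proof (induction n arbitrary: \<theta>)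
    case 0
    have "{A \<in> surviving M T 0. agree \<theta> A} = {[]}" by (auto simp: surviving_def agree_def)
    then show ?case by simp
  next
    case (Suc n)
    have "agree (take n \<theta>) A \<longleftrightarrow> agree \<theta> A" if "A \<in> surviving M T n" for A
      using that by (auto simp: agree_def surviving_def words_def)
    then have "{A \<in> surviving M T (n * 1). agree (take n \<theta>) A} = {A \<in> surviving M T (n * 1). agree \<theta> A}" by auto
    moreover have "take n \<theta> \<in> words M n" using Suc.prems by (rule take_in_words) simp
    ultimately have "\<rho> ^ n \<le> real (card {A \<in> surviving M T (n * 1). agree \<theta> A})"
      using Suc.IH[of "take n \<theta>"] by simp
    then show ?case using \<open>thriving T\<close> Suc.prems unfolding thriving_def thrives_at_def by blast
  qed
  have meets: "\<exists>B\<in>surviving M T (n * 1). \<exists>x\<in>cube M B. x - y \<in> orthogonal_comp (coord_plane J)"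
    if T: "thriving T" and y: "y \<in> unit_cube" for T n y
  proof -
    obtain \<theta> where \<theta>: "\<theta> \<in> words M n" "y \<in> cube M \<theta>"
      using unit_cube_covered[OF _ y, of M n] M by auto
    then obtain v where v: "v \<in> unit_cube" "y = cube_map M \<theta> v" by (auto simp: cube_def)
    have "0 < \<rho> ^ n" using \<open>\<mu> > 1\<close> by (simp add: \<rho>_def)
    then have "0 < real (card {A \<in> surviving M T (n * 1). agree \<theta> A})"
      using many[OF T \<theta>(1)] by linarith
    then obtain B where B: "B \<in> surviving M T (n * 1)" "agree \<theta> B"
      by (metis (no_types, lifting) card.empty empty_Collect_eq of_nat_0 less_irrefl)
    have "length B = length \<theta>" using B(1) \<theta>(1) by (simp add: surviving_def words_def)
    \<comment> \<open>Taking the same relative position \<open>v\<close> in the cube of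
      \<open>B\<close> as \<open>y\<close> has in that of \<theta> gives equal coordinates in
      \<open>J\<close>.\<close>
    then have agree_J: "(cube_map M B v - y) $ j = 0" if "j \<in> J" for j
      using B(2) that unfolding v(2) by (simp add: cube_map_component agree_def)
    have "z \<bullet> (cube_map M B v - y) = 0" if "z \<in> coord_plane J" for z
      unfolding inner_vec_def
    proof (intro sum.neutral ballI)
      fix i
      show "z $ i \<bullet> (cube_map M B v - y) $ i = 0"
        using agree_J[of i] that by (cases "i \<in> J") (auto simp: coord_plane_eq)
    qed
    then have "cube_map M B v - y \<in> orthogonal_comp (coord_plane J)"
      by (simp add: orthogonal_comp_def orthogonal_def)
    moreover have "cube_map M B v \<in> cube M B" using v(1) by (auto simp: cube_def)
    ultimately show ?thesis using B(1) by blast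
  qed
  have "AE \<omega> in P. percolation_set M X \<omega> \<noteq> {} \<longrightarrow>
    (\<forall>\<alpha>. orthogonal_comp (span \<alpha>) \<in> {orthogonal_comp (coord_plane J)} \<longrightarrow>
       top_of_set (span \<alpha>) interior_of (orth_proj \<alpha> ` percolation_set M X \<omega>) \<noteq> {})"
  proof (rule projections_have_interior[OF X])
    show "\<exists>B\<in>surviving M T (n * 1). \<exists>x\<in>cube M B. x - y \<in> W"
      if "thriving T" "W \<in> {orthogonal_comp (coord_plane J)}" "y \<in> ball (\<chi> i. 1 / 2) (1 / 2)" for T W y n
      using meets[OF that(1)] that(2,3) ball_centre_subset_core_cube[of 1] by (auto simp: core_cube_1)
  qed (auto simp: subspace_orthogonal_comp)
  then show ?thesis by eventually_elim (metis singletonI)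
qed

subsection \<open>Perturbing the direction\<close>

text \<open>A grid is laid over the set and one point of \<open>S\<close> is picked in each occupied
  cell. The net must lie inside \<open>S\<close> because its members have to be isometric on
  \<open>U\<close> and have base points in the unit cube.\<close>

lemma polynomial_net:
  fixes S :: "'a::euclidean_space set"
  assumes "bounded S"
  shows "\<exists>c\<ge>0. \<forall>\<eta>. 0 < \<eta> \<longrightarrow> \<eta> \<le> 1 \<longrightarrow>
    (\<exists>T\<subseteq>S. finite T \<and> real (card T) \<le> c * (1 / \<eta>) ^ DIM('a) \<and> (\<forall>x\<in>S. \<exists>y\<in>T. dist x y \<le> \<eta>))"
proof -
  obtain R where R: "R > 0" "\<And>x. x \<in> S \<Longrightarrow> norm x \<le> R" using assms bounded_pos by blast
  define N where "N = real DIM('a)"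
  have N: "N \<ge> 1" by (simp add: N_def Suc_leI)
  show ?thesis
  \<comment> \<open>Each coordinate meets at most \<open>2 * m + 2\<close> cells, where
    \<open>m < R * N / \<eta> + 1\<close>; the assumption \<open>\<eta> \<le> 1\<close> absorbs the
    additive 4 into the factor \<open>1 / \<eta>\<close>.\<close>
  proof (intro exI[of _ "(2 * R * N + 4) ^ DIM('a)"] conjI allI impI)
    show "0 \<le> (2 * R * N + 4) ^ DIM('a)" using R N by simp
    fix \<eta> :: real assume \<eta>: "0 < \<eta>" "\<eta> \<le> 1"
    define \<delta> where "\<delta> = \<eta> / N"
    have \<delta>: "\<delta> > 0" using \<eta> N by (simp add: \<delta>_def)
    define g where "g x = (\<lambda>i\<in>Basis. \<lfloor>x \<bullet> i / \<delta>\<rfloor>)" for x :: 'a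
    define m where "m = \<lceil>R / \<delta>\<rceil>"
    have m: "m \<ge> 0" using R \<delta> by (simp add: m_def less_imp_le order_less_le_trans[of "-1" 0])
    let ?G = "(Basis :: 'a set) \<rightarrow>\<^sub>E {- m - 1..m}"
    have g: "g ` S \<subseteq> ?G"
    proof -
      have "\<lfloor>x \<bullet> i / \<delta>\<rfloor> \<in> {- m - 1..m}" if "x \<in> S" "i \<in> Basis" for x i
      proof -
        have "\<bar>x \<bullet> i\<bar> \<le> R" using R(2)[OF that(1)] Basis_le_norm[OF that(2), of x] by linarith
        then have "\<bar>x \<bullet> i / \<delta>\<bar> \<le> R / \<delta>" using \<delta> by (simp add: divide_right_mono)
        also have "R / \<delta> \<le> of_int m" unfolding m_def by linarith
        finally show ?thesis by (simp add: abs_le_iff; linarith)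
      qed
      then show ?thesis by (auto simp: g_def)
    qed
    have finG: "finite ?G" by (intro finite_PiE) auto
    define T where "T = inv_into S g ` g ` S"
    have "T \<subseteq> S" unfolding T_def by (auto intro: inv_into_into)
    moreover have "finite T" unfolding T_def using finite_subset[OF g finG] by simp
    moreover have "real (card T) \<le> (2 * R * N + 4) ^ DIM('a) * (1 / \<eta>) ^ DIM('a)"
    proof -
      have "card T \<le> card (g ` S)" unfolding T_def by (rule card_image_le[OF finite_subset[OF g finG]])
      also have "\<dots> \<le> card ?G" by (rule card_mono[OF finG g])
      also have "\<dots> = nat (2 * m + 2) ^ DIM('a)" by (simp add: card_PiE add.commute)
      finally have "real (card T) \<le> real (nat (2 * m + 2)) ^ DIM('a)" by (metis of_nat_le_iff of_nat_power)
      also have "\<dots> \<le> ((2 * R * N + 4) * (1 / \<eta>)) ^ DIM('a)"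
      proof (rule power_mono)
        have "real (nat (2 * m + 2)) = 2 * real_of_int m + 2" using m by simp
        also have "\<dots> \<le> 2 * (R / \<delta>) + 4"
          unfolding m_def using ceiling_correct[of "R / \<delta>"] by linarith
        also have "\<dots> \<le> (2 * R * N + 4) * (1 / \<eta>)"
          using \<eta> N by (simp add: \<delta>_def field_simps)
        finally show "real (nat (2 * m + 2)) \<le> (2 * R * N + 4) * (1 / \<eta>)" .
      qed simp
      finally show ?thesis by (simp only: power_mult_distrib)
    qed
    moreover have "\<exists>y\<in>T. dist x y \<le> \<eta>" if x: "x \<in> S" for x
    proof
      define y where "y = inv_into S g (g x)"
      show "inv_into S g (g x) \<in> T" unfolding T_def using x by blast
      have "g y = g x" unfolding y_def by (rule f_inv_into_f) (use x in blast)
      then have fl: "\<lfloor>x \<bullet> i / \<delta>\<rfloor> = \<lfloor>y \<bullet> i / \<delta>\<rfloor>" if "i \<in> Basis" for i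
        using that unfolding g_def by (metis restrict_apply')
      have "\<bar>(x - y) \<bullet> i\<bar> \<le> \<delta>" if "i \<in> Basis" for i
      proof -
        have "\<bar>x \<bullet> i / \<delta> - y \<bullet> i / \<delta>\<bar> \<le> 1" using fl[OF that] by linarith
        then show ?thesis using \<delta> by (simp add: inner_diff_left diff_divide_distrib[symmetric])
      qed
      then have "(\<Sum>i\<in>Basis. \<bar>(x - y) \<bullet> i\<bar>) \<le> (\<Sum>i\<in>(Basis :: 'a set). \<delta>)" by (intro sum_mono)
      also have "\<dots> = \<eta>" using N by (simp add: \<delta>_def N_def)
      finally show "dist x (inv_into S g (g x)) \<le> \<eta>"
        using norm_le_l1[of "x - y"] by (simp add: dist_norm y_def)
    qed
    ultimately show "\<exists>T\<subseteq>S. finite T \<and> real (card T) \<le> (2 * R * N + 4) ^ DIM('a) * (1 / \<eta>) ^ DIM('a) \<and>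
        (\<forall>x\<in>S. \<exists>y\<in>T. dist x y \<le> \<eta>)" by blast
  qed
qed

section \<open>Effect of a small displacement of a fibre\<close>

lemma norm_matrix_vector_mult_le:
  fixes A :: "real ^ 'd ^ 'd"
  shows "norm (A *v u) \<le> real CARD('d) * norm A * norm u"
proof -
  have "norm (A *v u) \<le> (\<Sum>i\<in>UNIV. \<bar>(A *v u) $ i\<bar>)" by (rule norm_le_l1_cart)
  also have "\<dots> \<le> (\<Sum>i\<in>(UNIV :: 'd set). norm A * norm u)"
  proof (rule sum_mono)
    fix i
    have "\<bar>(A *v u) $ i\<bar> = \<bar>A $ i \<bullet> u\<bar>" by (simp add: matrix_vector_mul_component)
    also have "\<dots> \<le> norm (A $ i) * norm u" by (rule Cauchy_Schwarz_ineq2)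
    also have "\<dots> \<le> norm A * norm u" by (intro mult_right_mono Finite_Cartesian_Product.norm_nth_le) auto
    finally show "\<bar>(A *v u) $ i\<bar> \<le> norm A * norm u" .
  qed
  finally show ?thesis by simp
qed

lemma norm_diff_unit_cube_le:
  fixes x y :: "real ^ 'd"
  assumes "x \<in> unit_cube" "y \<in> unit_cube"
  shows "norm (x - y) \<le> real CARD('d)"
proof -
  have "norm (x - y) \<le> (\<Sum>i\<in>UNIV. \<bar>(x - y) $ i\<bar>)" by (rule norm_le_l1_cart)
  also have "\<dots> \<le> (\<Sum>i\<in>(UNIV :: 'd set). 1)"
    using assms by (intro sum_mono) (auto simp: unit_cube_def abs_le_iff; smt (verit))
  finally show ?thesis by simp
qed

text \<open>In the coordinates of the cube \<open>A\<close> a displacement is magnified by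
  \<open>real M ^ length A\<close>. If it is then at most \<open>s / 2\<close>, side length
  \<open>t + s\<close> absorbs it.\<close>

lemma core_cube_image_perturb:
  fixes z :: "real ^ 'd"
  assumes M: "M \<ge> 1" and z: "z \<in> cube_map M A ` core_cube t"
    and le: "real M ^ length A * norm (z' - z) \<le> s / 2"
  shows "z' \<in> cube_map M A ` core_cube (t + s)"
proof -
  obtain v where v: "v \<in> core_cube t" "z = cube_map M A v" using z by auto
  define v' where "v' = v + (real M ^ length A) *\<^sub>R (z' - z)"
  have "z' = cube_map M A v'"
    using cube_map_diff[of M A v' v] M by (simp add: v'_def v(2))
  moreover have "v' \<in> core_cube (t + s)"
  proof -
    have "\<bar>v' $ i - 1 / 2\<bar> \<le> (t + s) / 2" for i
    proof -
      have "\<bar>real M ^ length A * (z' - z) $ i\<bar> \<le> s / 2"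
      proof -
        have "real M ^ length A * \<bar>(z' - z) $ i\<bar> \<le> real M ^ length A * norm (z' - z)"
          by (intro mult_left_mono component_le_norm_cart) simp
        then show ?thesis using le by (simp add: abs_mult)
      qed
      moreover have "\<bar>v $ i - 1 / 2\<bar> \<le> t / 2" using v(1) by (simp add: core_cube_def)
      ultimately show ?thesis by (simp add: v'_def abs_le_iff add_divide_distrib; linarith)
    qed
    then show ?thesis by (simp add: core_cube_def)
  qed
  ultimately show ?thesis by blast
qed

text \<open>
  Directions near \<open>Q\<^sub>0 ` U\<close> are parametrized as \<open>Q ` U\<close> with \<open>Q\<close> isometric on a fixed subspace
  \<open>U\<close>, so that a fibre \<open>y + Q ` U\<close> becomes a point \<open>(Q, y)\<close> of a Euclidean space, where a net of
  polynomial size is available. The three sizes \<open>t\<^sub>1 + s < t\<^sub>1 + 2 s < t\<^sub>1 + 3 s = t\<^sub>2\<close> leave room for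
  replacing a fibre by a neighbour in the net and back.
\<close>

definition isometric_on :: "(real ^ 'd) set \<Rightarrow> real ^ 'd ^ 'd \<Rightarrow> bool" where
  "isometric_on U Q \<longleftrightarrow> (\<forall>u\<in>U. norm (Q *v u) = norm u)"

text \<open>Both \<open>y\<close> and \<open>y + Q *v u\<close> lie in the unit cube, so the
  isometry bounds \<open>norm u\<close> by \<open>CARD('d)\<close>. The second factor
  \<open>CARD('d)\<close> comes from the bound for matrices, and the summand 1 from the change of
  base point.\<close>

lemma isometric_fibre_perturb:
  fixes U :: "(real ^ 'd) set"
  assumes M: "M \<ge> 1" and Q: "isometric_on U Q" and u: "u \<in> U" and A: "set A \<subseteq> digits M"
    and t: "t \<le> 1" and y: "y \<in> unit_cube" and z: "y + Q *v u \<in> cube_map M A ` core_cube t"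
    and le: "real M ^ length A * ((1 + real CARD('d) ^ 2) * dist (Q, y) (Q', y')) \<le> s / 2"
  shows "y' + Q' *v u \<in> cube_map M A ` core_cube (t + s)"
proof (rule core_cube_image_perturb[OF M z])
  let ?d = "real CARD('d)"
  have "cube_map M A ` core_cube t \<subseteq> unit_cube"
    using cube_subset_unit_cube[OF M A] core_cube_subset_unit_cube[OF t] by (auto simp: cube_def)
  then have "norm ((y + Q *v u) - y) \<le> ?d" using z y by (intro norm_diff_unit_cube_le) auto
  then have nu: "norm u \<le> ?d" using Q u by (simp add: isometric_on_def)
  have "norm ((Q' - Q) *v u) \<le> ?d * norm (Q' - Q) * norm u" by (rule norm_matrix_vector_mult_le)
  also have "\<dots> \<le> ?d * dist (Q, y) (Q', y') * ?d"
    using nu dist_fst_le[of "(Q, y)" "(Q', y')"]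
    by (intro mult_mono) (auto simp: dist_norm norm_minus_commute)
  finally have "norm ((Q' - Q) *v u) \<le> ?d ^ 2 * dist (Q, y) (Q', y')" by (simp add: power2_eq_square mult_ac)
  moreover have "norm (y' - y) \<le> dist (Q, y) (Q', y')"
    using dist_snd_le[of "(Q, y)" "(Q', y')"] by (simp add: dist_norm norm_minus_commute)
  moreover have "(y' + Q' *v u) - (y + Q *v u) = (y' - y) + (Q' - Q) *v u"
    by (simp add: matrix_vector_mult_diff_rdistrib)
  then have "norm ((y' + Q' *v u) - (y + Q *v u)) \<le> norm (y' - y) + norm ((Q' - Q) *v u)"
    by (metis norm_triangle_ineq)
  ultimately have "norm ((y' + Q' *v u) - (y + Q *v u)) \<le> (1 + ?d ^ 2) * dist (Q, y) (Q', y')"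
    by (simp add: algebra_simps)
  then have "real M ^ length A * norm ((y' + Q' *v u) - (y + Q *v u)) \<le>
      real M ^ length A * ((1 + ?d ^ 2) * dist (Q, y) (Q', y'))" by (intro mult_left_mono) auto
  then show "real M ^ length A * norm ((y' + Q' *v u) - (y + Q *v u)) \<le> s / 2" using le by linarith
qed

lemma projections_near_have_interior:
  fixes X :: "(nat ^ 'd) list \<Rightarrow> 'w \<Rightarrow> bool" and U :: "(real ^ 'd) set"
  assumes X: "fractal_percolation P M p X" and M: "M \<ge> 2"
    and p: "\<And>C. C \<in> digits M \<Longrightarrow> 0 < p C \<and> p C < 1"
    and U: "subspace U" and Q\<^sub>0: "isometric_on U Q\<^sub>0"
    and t: "0 < t\<^sub>1" "t\<^sub>1 < t\<^sub>2" "t\<^sub>2 \<le> 1" and r: "r \<ge> 1"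
    and mean: "\<And>z. z \<in> core_cube t\<^sub>2 \<Longrightarrow>
       2 \<le> (\<Sum>D\<in>{D \<in> words M r. \<exists>v\<in>core_cube t\<^sub>1. cube_map M D v - z \<in> (*v) Q\<^sub>0 ` U}. prod_list (map p D))"
  shows "\<exists>\<epsilon>>0. AE \<omega> in P. percolation_set M X \<omega> \<noteq> {} \<longrightarrow>
    (\<forall>\<alpha>. \<forall>Q\<in>ball Q\<^sub>0 \<epsilon>. isometric_on U Q \<longrightarrow> orthogonal_comp (span \<alpha>) = (*v) Q ` U \<longrightarrow>
       top_of_set (span \<alpha>) interior_of (orth_proj \<alpha> ` percolation_set M X \<omega>) \<noteq> {})"
proof -
  have M1: "M \<ge> 1" and Mpos: "real M > 0" using M by auto
  define s where "s = (t\<^sub>2 - t\<^sub>1) / 3"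
  have s: "s > 0" "t\<^sub>1 + s + s + s = t\<^sub>2" using t by (simp_all add: s_def field_simps)
  define D where "D = 1 + real CARD('d) ^ 2"
  have D: "D \<ge> 1" by (simp add: D_def)
  \<comment> \<open>Chosen so that replacing \<open>Q\<^sub>0\<close> by \<open>Q\<close> costs at
    most \<open>s / 2\<close> in a cube of level \<open>r\<close>, which enlarges
    \<open>t\<^sub>1\<close> to \<open>t\<^sub>1 + s\<close>.\<close>
  define \<epsilon> where "\<epsilon> = s / (2 * D * real M ^ r)"
  have \<epsilon>: "\<epsilon> > 0" using s D Mpos by (simp add: \<epsilon>_def)
  define dirs where "dirs = {Q \<in> ball Q\<^sub>0 \<epsilon>. isometric_on U Q}"
  define fibres where "fibres = dirs \<times> (unit_cube :: (real ^ 'd) set)"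
  have "bounded dirs" unfolding dirs_def by (rule bounded_subset[OF bounded_ball]) auto
  then have "bounded fibres" unfolding fibres_def
    by (rule bounded_Times[OF _ compact_imp_bounded[OF compact_unit_cube]])
  from polynomial_net[OF this] obtain c where c: "c \<ge> 0" "\<forall>\<eta>. 0 < \<eta> \<longrightarrow> \<eta> \<le> 1 \<longrightarrow>
     (\<exists>T\<subseteq>fibres. finite T \<and> real (card T) \<le> c * (1 / \<eta>) ^ DIM((real ^ 'd ^ 'd) \<times> (real ^ 'd)) \<and>
       (\<forall>x\<in>fibres. \<exists>y\<in>T. dist x y \<le> \<eta>))"
    by (elim exE conjE)
  let ?dim = "DIM((real ^ 'd ^ 'd) \<times> (real ^ 'd))"
  \<comment> \<open>The net at stage \<open>n\<close> has to resolve fibres at the level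
    \<open>Suc n * r\<close> of the offspring, not only at that of the parents.\<close>
  define \<eta> where "\<eta> n = s / (2 * D * real M ^ (Suc n * r))" for n
  have \<eta>: "0 < \<eta> n" "\<eta> n \<le> 1" for n
  proof -
    show "0 < \<eta> n" using s D Mpos by (simp add: \<eta>_def)
    have "1 * 1 \<le> D * real M ^ (Suc n * r)" using D M by (intro mult_mono) (auto simp del: mult_Suc)
    moreover have "s \<le> 1" using t s by linarith
    ultimately show "\<eta> n \<le> 1" unfolding \<eta>_def by (simp add: divide_le_eq del: mult_Suc)
  qed
  have "\<forall>n. \<exists>T\<subseteq>fibres. finite T \<and> real (card T) \<le> c * (1 / \<eta> n) ^ ?dim \<and>
      (\<forall>x\<in>fibres. \<exists>y\<in>T. dist x y \<le> \<eta> n)"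
    by (intro allI c(2)[rule_format] \<eta>)
  from choice[OF this] obtain \<Theta> where net: "\<forall>n. \<Theta> n \<subseteq> fibres \<and> finite (\<Theta> n) \<and>
      real (card (\<Theta> n)) \<le> c * (1 / \<eta> n) ^ ?dim \<and> (\<forall>x\<in>fibres. \<exists>y\<in>\<Theta> n. dist x y \<le> \<eta> n)" ..
  then have \<Theta>: "\<Theta> n \<subseteq> fibres" "finite (\<Theta> n)" "real (card (\<Theta> n)) \<le> c * (1 / \<eta> n) ^ ?dim"
      "x \<in> fibres \<Longrightarrow> \<exists>y\<in>\<Theta> n. dist x y \<le> \<eta> n" for n x
    by (simp_all only: simp_thms)
  define hits where "hits t \<theta> A \<longleftrightarrow> (\<exists>u\<in>U. snd \<theta> + fst \<theta> *v u \<in> cube_map M A ` core_cube t)"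
    for t and \<theta> :: "(real ^ 'd ^ 'd) \<times> (real ^ 'd)" and A
  have hits_near: "hits (t + s) \<theta>' A"
    if hit: "hits t \<theta> A" and \<theta>: "\<theta> \<in> fibres" and near: "dist \<theta> \<theta>' \<le> \<eta> n" and "t \<le> 1"
      and A: "A \<in> words M m" and m: "m \<le> Suc n * r" for t \<theta> \<theta>' A n m
  proof -
    have len: "length A = m" "set A \<subseteq> digits M" using A by (auto simp: words_def)
    have "real M ^ m \<le> real M ^ (Suc n * r)" using M m by (intro power_increasing) auto
    then have "real M ^ m * (D * dist \<theta> \<theta>') \<le> real M ^ (Suc n * r) * (D * \<eta> n)"
      using near D by (intro mult_mono) auto
    also have "\<dots> = s / 2" using Mpos D by (simp add: \<eta>_def field_simps del: mult_Suc)
    finally have le: "real M ^ length A * (D * dist (fst \<theta>, snd \<theta>) (fst \<theta>', snd \<theta>')) \<le> s / 2"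
      using len by simp
    obtain u where u: "u \<in> U" "snd \<theta> + fst \<theta> *v u \<in> cube_map M A ` core_cube t"
      using hit unfolding hits_def by blast
    have "isometric_on U (fst \<theta>)" "snd \<theta> \<in> unit_cube"
      using \<theta> by (simp_all add: fibres_def dirs_def mem_Times_iff)
    from isometric_fibre_perturb[OF M1 this(1) u(1) len(2) \<open>t \<le> 1\<close> this(2) u(2) le[unfolded D_def]]
    show ?thesis using u(1) unfolding hits_def by blast
  qed
  interpret growth_scheme M r p "3 / 2" 2 "c * (2 * D * real M ^ r / s) ^ ?dim" "(real M ^ r) ^ ?dim" \<Theta>
    "hits t\<^sub>2" "hits (t\<^sub>1 + s)"
  proof
    show "1 \<le> (real M ^ r) ^ ?dim" using M by (intro one_le_power) auto
    show "real (card (\<Theta> n)) \<le> c * (2 * D * real M ^ r / s) ^ ?dim * ((real M ^ r) ^ ?dim) ^ n" for n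
    proof -
      have "real M ^ (Suc n * r) = real M ^ r * (real M ^ r) ^ n"
        unfolding mult_Suc power_add by (metis mult.commute power_mult)
      then have "1 / \<eta> n = (2 * D * real M ^ r / s) * (real M ^ r) ^ n"
        unfolding \<eta>_def by simp
      moreover have "(a ^ n) ^ ?dim = (a ^ ?dim) ^ n" for a :: real by (metis mult.commute power_mult)
      ultimately have "(1 / \<eta> n) ^ ?dim = (2 * D * real M ^ r / s) ^ ?dim * ((real M ^ r) ^ ?dim) ^ n"
        by (simp only: power_mult_distrib)
      then show ?thesis using \<Theta>(3)[of n] by (simp only: mult.assoc)
    qed
    show "2 \<le> (\<Sum>B\<in>{B \<in> words M r. hits (t\<^sub>1 + s) \<theta> (A @ B)}. prod_list (map p B))"
      if \<theta>: "\<theta> \<in> \<Theta> n" and A: "A \<in> words M (n * r)" and hit: "hits t\<^sub>2 \<theta> A" for n \<theta> A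
    proof -
      obtain Q y where Qy: "\<theta> = (Q, y)" by (cases \<theta>)
      have Q: "isometric_on U Q" "dist Q\<^sub>0 Q < \<epsilon>" using subsetD[OF \<Theta>(1) \<theta>] by (simp_all add: Qy fibres_def dirs_def)
      obtain u\<^sub>0 z where u0: "u\<^sub>0 \<in> U" and z: "z \<in> core_cube t\<^sub>2" "y + Q *v u\<^sub>0 = cube_map M A z"
        using hit unfolding hits_def Qy by auto
      have "2 \<le> (\<Sum>B\<in>{B \<in> words M r. \<exists>v\<in>core_cube t\<^sub>1. cube_map M B v - z \<in> (*v) Q\<^sub>0 ` U}. prod_list (map p B))"
        by (rule mean[OF z(1)])
      also have "\<dots> \<le> (\<Sum>B\<in>{B \<in> words M r. hits (t\<^sub>1 + s) \<theta> (A @ B)}. prod_list (map p B))"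
      proof (rule sum_mono2)
        show "{B \<in> words M r. \<exists>v\<in>core_cube t\<^sub>1. cube_map M B v - z \<in> (*v) Q\<^sub>0 ` U} \<subseteq>
            {B \<in> words M r. hits (t\<^sub>1 + s) \<theta> (A @ B)}"
        \<comment> \<open>The comparison with \<open>Q\<^sub>0\<close> takes place in the
          coordinates of the parent cube \<open>A\<close>, through the same base point
          \<open>z\<close>. Its error is magnified by \<open>real M ^ r\<close> only, so one
          \<epsilon> serves all stages.\<close>
        proof clarify
          fix B v u assume B: "B \<in> words M r" and v: "v \<in> core_cube t\<^sub>1"
            and u: "u \<in> U" "cube_map M B v - z = Q\<^sub>0 *v u"
          have eq: "z + Q\<^sub>0 *v u = cube_map M B v" using u(2) by (simp add: algebra_simps)
          have lenB: "length B = r" "set B \<subseteq> digits M" using B by (auto simp: words_def)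
          have "dist (Q\<^sub>0, z) (Q, z) = dist Q\<^sub>0 Q" by (simp add: dist_Pair_Pair)
          then have "real M ^ r * (D * dist (Q\<^sub>0, z) (Q, z)) \<le> real M ^ r * (D * \<epsilon>)"
            using Q(2) D by (intro mult_left_mono) auto
          also have "\<dots> = s / 2" using Mpos D by (simp add: \<epsilon>_def)
          finally have le: "real M ^ length B * (D * dist (Q\<^sub>0, z) (Q, z)) \<le> s / 2" using lenB by simp
          have "z \<in> unit_cube" using z(1) core_cube_subset_unit_cube[OF t(3)] by blast
          from isometric_fibre_perturb[OF M1 Q\<^sub>0 u(1) lenB(2) _ this _ le[unfolded D_def]]
          have "z + Q *v u \<in> cube_map M B ` core_cube (t\<^sub>1 + s)" using t eq v by simp
          then have "cube_map M A (z + Q *v u) \<in> cube_map M (A @ B) ` core_cube (t\<^sub>1 + s)"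
            by (auto simp: cube_map_append)
          moreover have "cube_map M A (z + Q *v u) = y + Q *v (u\<^sub>0 + (1 / real M ^ length A) *\<^sub>R u)"
            using cube_map_diff[of M A "z + Q *v u" z] z(2)
            by (simp add: matrix_vector_right_distrib matrix_vector_mult_scaleR algebra_simps)
          moreover have "u\<^sub>0 + (1 / real M ^ length A) *\<^sub>R u \<in> U"
            by (intro subspace_add subspace_scale U u0 u(1))
          ultimately show "hits (t\<^sub>1 + s) \<theta> (A @ B)" unfolding hits_def Qy by auto
        qed
        fix B assume "B \<in> {B \<in> words M r. hits (t\<^sub>1 + s) \<theta> (A @ B)} -
          {B \<in> words M r. \<exists>v\<in>core_cube t\<^sub>1. cube_map M B v - z \<in> (*v) Q\<^sub>0 ` U}"
        then have "set B \<subseteq> digits M" by (auto simp: words_def)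
        then show "0 \<le> prod_list (map p B)"
          by (intro prod_list_nonneg) (auto intro!: less_imp_le[OF p[THEN conjunct1]])
      qed (simp add: finite_words)
      finally show ?thesis .
    qed
    show "2 \<le> M" by (rule M)
    show "0 < p C \<and> p C < 1" if "C \<in> digits M" for C by (rule p[OF that])
    show "finite (\<Theta> n)" for n by (rule \<Theta>)
  qed simp_all
  \<comment> \<open>The invariant concerns the given fibre at the middle size. One step goes to size
    \<open>t\<^sub>2\<close> on the neighbour in the net, by thriving to size
    \<open>t\<^sub>1 + s\<close> one stage deeper, and back to the given fibre at the middle
    size.\<close>
  have many: "(3 / 2) ^ n \<le> real (card {A \<in> surviving M T (n * r). hits (t\<^sub>1 + s + s) \<theta> A})"
    if T: "thriving T" and \<theta>: "\<theta> \<in> fibres" "snd \<theta> \<in> core_cube (t\<^sub>1 + s + s)" for T n \<theta>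
  proof (induction n)
    case 0
    have "hits (t\<^sub>1 + s + s) \<theta> []"
      unfolding hits_def using subspace_0[OF U] \<theta>(2) by (intro bexI[of _ 0]) (simp_all add: image_iff)
    then have "{A \<in> surviving M T 0. hits (t\<^sub>1 + s + s) \<theta> A} = {[]}" by (auto simp: surviving_def)
    then show ?case by simp
  next
    case (Suc n)
    obtain \<theta>' where \<theta>': "\<theta>' \<in> \<Theta> n" "dist \<theta> \<theta>' \<le> \<eta> n" using \<Theta>(4)[OF \<theta>(1)] by blast
    have le1: "t\<^sub>1 + s \<le> 1" "t\<^sub>1 + s + s \<le> 1" using s t by linarith+
    have sub: "{A \<in> surviving M T (n * r). hits (t\<^sub>1 + s + s) \<theta> A} \<subseteq>
        {A \<in> surviving M T (n * r). hits t\<^sub>2 \<theta>' A}"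
    proof clarify
      fix A assume A: "A \<in> surviving M T (n * r)" "hits (t\<^sub>1 + s + s) \<theta> A"
      then have "hits (t\<^sub>1 + s + s + s) \<theta>' A"
        by (intro hits_near[OF A(2) \<theta>(1) \<theta>'(2) le1(2), of "n * r"] subsetD[OF surviving_subset]) auto
      then show "hits t\<^sub>2 \<theta>' A" unfolding s(2) .
    qed
    have "(3 / 2) ^ n \<le> real (card {A \<in> surviving M T (n * r). hits t\<^sub>2 \<theta>' A})"
      using Suc.IH card_mono[OF _ sub] by (simp add: finite_surviving)
    then have "(3 / 2) ^ Suc n \<le> real (card {B \<in> surviving M T (Suc n * r). hits (t\<^sub>1 + s) \<theta>' B})"
      using T \<theta>'(1) unfolding thriving_def thrives_at_def by blast
    moreover have sub: "{B \<in> surviving M T (Suc n * r). hits (t\<^sub>1 + s) \<theta>' B} \<subseteq>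
        {B \<in> surviving M T (Suc n * r). hits (t\<^sub>1 + s + s) \<theta> B}"
    proof clarify
      fix B assume B: "B \<in> surviving M T (Suc n * r)" "hits (t\<^sub>1 + s) \<theta>' B"
      have "dist \<theta>' \<theta> \<le> \<eta> n" using \<theta>'(2) by (simp add: dist_commute)
      then show "hits (t\<^sub>1 + s + s) \<theta> B"
        by (rule hits_near[OF B(2) subsetD[OF \<Theta>(1) \<theta>'(1)] _ le1(1) subsetD[OF surviving_subset B(1)]])
           simp
    qed
    ultimately show ?case
      using card_mono[OF _ sub] by (simp add: finite_surviving del: mult_Suc)
  qed
  have "AE \<omega> in P. percolation_set M X \<omega> \<noteq> {} \<longrightarrow>
    (\<forall>\<alpha>. orthogonal_comp (span \<alpha>) \<in> (\<lambda>Q. (*v) Q ` U) ` dirs \<longrightarrow>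
       top_of_set (span \<alpha>) interior_of (orth_proj \<alpha> ` percolation_set M X \<omega>) \<noteq> {})"
  proof (rule projections_have_interior[OF X r])
    show "(t\<^sub>1 + s + s) / 2 > 0" using t s by simp
    show "(\<lambda>Q. (*v) Q ` U) ` dirs \<noteq> {}" using \<epsilon> Q\<^sub>0 by (auto simp: dirs_def intro!: exI[of _ Q\<^sub>0])
    show "subspace W" if "W \<in> (\<lambda>Q. (*v) Q ` U) ` dirs" for W
      using that U by (auto intro: linear_subspace_image)
    show "\<exists>B\<in>surviving M T (n * r). \<exists>x\<in>cube M B. x - y \<in> W"
      if T: "thriving T" and W: "W \<in> (\<lambda>Q. (*v) Q ` U) ` dirs"
        and y: "y \<in> ball (\<chi> i. 1 / 2) ((t\<^sub>1 + s + s) / 2)" for T W y n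
    proof -
      obtain Q where Q: "Q \<in> dirs" "W = (*v) Q ` U" using W by blast
      have le1: "t\<^sub>1 + s + s \<le> 1" using s t by linarith
      have y': "y \<in> core_cube (t\<^sub>1 + s + s)" using y ball_centre_subset_core_cube by blast
      then have "y \<in> unit_cube" using core_cube_subset_unit_cube[OF le1] by blast
      then have "(3 / 2) ^ n \<le> real (card {A \<in> surviving M T (n * r). hits (t\<^sub>1 + s + s) (Q, y) A})"
        using Q(1) y' by (intro many[OF T]) (simp_all add: fibres_def)
      moreover have "0 < (3 / 2 :: real) ^ n" by simp
      ultimately have "0 < card {A \<in> surviving M T (n * r). hits (t\<^sub>1 + s + s) (Q, y) A}" by linarith
      then obtain B where B: "B \<in> surviving M T (n * r)" "hits (t\<^sub>1 + s + s) (Q, y) B"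
        by (metis (no_types, lifting) card.empty empty_Collect_eq less_irrefl)
      then obtain u where u: "u \<in> U" "y + Q *v u \<in> cube_map M B ` core_cube (t\<^sub>1 + s + s)"
        unfolding hits_def by auto
      then have "y + Q *v u \<in> cube M B"
        using core_cube_subset_unit_cube[OF le1] by (auto simp: cube_def)
      moreover have "(y + Q *v u) - y \<in> W" using Q(2) u(1) by simp
      ultimately show ?thesis using B(1) by blast
    qed
  qed
  then have "AE \<omega> in P. percolation_set M X \<omega> \<noteq> {} \<longrightarrow>
    (\<forall>\<alpha>. \<forall>Q\<in>ball Q\<^sub>0 \<epsilon>. isometric_on U Q \<longrightarrow> orthogonal_comp (span \<alpha>) = (*v) Q ` U \<longrightarrow>
       top_of_set (span \<alpha>) interior_of (orth_proj \<alpha> ` percolation_set M X \<omega>) \<noteq> {})"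
    by eventually_elim (auto simp: dirs_def)
  then show ?thesis using \<epsilon> by blast
qed

section \<open>Countably many neighbourhoods of directions\<close>

theorem theorem1p3:
  fixes P :: "'w measure"
    and M k :: nat
    and p :: "nat ^ 'd \<Rightarrow> real"
    and X :: "(nat ^ 'd) list \<Rightarrow> 'w \<Rightarrow> bool"
    and I :: "(real ^ 'd) set \<Rightarrow> 'd set"
  assumes "CARD('d) \<ge> 2"
    and "1 \<le> k" and "k < CARD('d)"
    and "M \<ge> 2"
    and "\<And>C. C \<in> digits M \<Longrightarrow> 0 < p C \<and> p C < 1"
    and "fractal_percolation P M p X"
    and "\<And>\<alpha>. orthonormal \<alpha> \<Longrightarrow> card \<alpha> = k \<Longrightarrow> admissible \<alpha> (I \<alpha>)"
    and "\<And>\<alpha>. orthonormal \<alpha> \<Longrightarrow> card \<alpha> = k \<Longrightarrow>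
           \<not> (\<exists>J. card J = k \<and> span \<alpha> = coord_plane J) \<Longrightarrow>
           condition_A M p \<alpha> (I \<alpha>)"
    and "\<And>J i. card J = k \<Longrightarrow> (\<forall>j\<in>J. i j < M) \<Longrightarrow>
           (\<Sum>C | C \<in> digits M \<and> (\<forall>j\<in>J. C $ j = i j). p C) > 1"
  shows "AE \<omega> in P. percolation_set M X \<omega> \<noteq> {} \<longrightarrow>
           (\<forall>\<alpha>. orthonormal \<alpha> \<and> card \<alpha> = k \<longrightarrow>
              top_of_set (span \<alpha>) interior_of (orth_proj \<alpha> ` percolation_set M X \<omega>) \<noteq> {})"
proof -
  note M = assms(4) and p = assms(5) and X = assms(6)
  define fat where "fat \<alpha> \<omega> \<longleftrightarrow>
      top_of_set (span \<alpha>) interior_of (orth_proj \<alpha> ` percolation_set M X \<omega>) \<noteq> {}" for \<alpha> \<omega>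
  have "AE \<omega> in P. percolation_set M X \<omega> \<noteq> {} \<longrightarrow>
      (\<forall>\<alpha>. span \<alpha> = coord_plane J \<longrightarrow> fat \<alpha> \<omega>)" if "card J = k" for J :: "'d set"
    unfolding fat_def by (rule coordinate_projection_has_interior[OF X M p assms(9)[OF that]])
  then have coord: "AE \<omega> in P. \<forall>J\<in>{J. card J = k}. percolation_set M X \<omega> \<noteq> {} \<longrightarrow>
      (\<forall>\<alpha>. span \<alpha> = coord_plane J \<longrightarrow> fat \<alpha> \<omega>)"
    by (intro AE_finite_allI) auto
  \<comment> \<open>Any subspace of dimension \<open>CARD('d) - k\<close> can serve as the reference
    subspace, since every orthogonal complement in question is an isometric image of it.\<close>
  obtain J\<^sub>0 :: "'d set" where J0: "card J\<^sub>0 = CARD('d) - k"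
    using obtain_subset_with_card_n[of "CARD('d) - k" "UNIV :: 'd set"] by auto
  define U where "U = (coord_plane J\<^sub>0 :: (real ^ 'd) set)"
  have U: "subspace U" "dim U = CARD('d) - k"
    by (auto simp: U_def dim_coord_plane J0) (simp add: coord_plane_def)
  define oblique where "oblique \<alpha> \<longleftrightarrow> orthonormal \<alpha> \<and> card \<alpha> = k \<and>
      \<not> (\<exists>J. card J = k \<and> span \<alpha> = coord_plane J)" for \<alpha> :: "(real ^ 'd) set"
  \<comment> \<open>Directions are lifted to matrices, so that Lindelof's theorem applies to balls
    in a Euclidean space.\<close>
  define \<G> where "\<G> = {Q. isometric_on U Q \<and>
      (\<exists>\<alpha>. oblique \<alpha> \<and> orthogonal_comp (span \<alpha>) = (*v) Q ` U)}"
  define good where "good Q \<epsilon> \<omega> \<longleftrightarrow> (percolation_set M X \<omega> \<noteq> {} \<longrightarrow>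
      (\<forall>\<alpha>. \<forall>Q'\<in>ball Q \<epsilon>. isometric_on U Q' \<longrightarrow> orthogonal_comp (span \<alpha>) = (*v) Q' ` U \<longrightarrow> fat \<alpha> \<omega>))"
    for Q \<epsilon> \<omega>
  have "\<exists>\<epsilon>>0. AE \<omega> in P. good Q \<epsilon> \<omega>" if "Q \<in> \<G>" for Q
  proof -
    obtain \<alpha> where Q: "isometric_on U Q" and \<alpha>: "oblique \<alpha>" and W: "orthogonal_comp (span \<alpha>) = (*v) Q ` U"
      using \<open>Q \<in> \<G>\<close> by (auto simp: \<G>_def)
    have A: "condition_A M p \<alpha> (I \<alpha>)" and adm: "admissible \<alpha> (I \<alpha>)" and orth: "orthonormal \<alpha>"
      using \<alpha> assms(7,8) by (auto simp: oblique_def)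
    have nonempty: "I \<alpha> \<noteq> {}" using adm \<alpha> assms(2) by (auto simp: admissible_def oblique_def)
    have bounds: "M \<ge> 1" "\<And>C. C \<in> digits M \<Longrightarrow> 0 \<le> p C" using M p by (auto intro: less_imp_le)
    obtain t\<^sub>1 t\<^sub>2 r where t: "0 < t\<^sub>1" "t\<^sub>1 < t\<^sub>2" "t\<^sub>2 \<le> 1" "r \<ge> 1" and mean:
      "\<And>z. z \<in> core_cube t\<^sub>2 \<Longrightarrow> 2 \<le> (\<Sum>D\<in>{D \<in> words M r.
         \<exists>u\<in>core_cube t\<^sub>1. cube_map M D u - z \<in> orthogonal_comp (span \<alpha>)}. prod_list (map p D))"
      by (rule condition_A_core_cubes[OF A complementary_admissible[OF adm orth] nonempty bounds])
         (assumption | rule that)+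
    show ?thesis
      unfolding good_def fat_def
      by (rule projections_near_have_interior[OF X M p U(1) Q t mean[unfolded W]])
  qed
  then obtain \<epsilon> where \<epsilon>: "\<And>Q. Q \<in> \<G> \<Longrightarrow> \<epsilon> Q > 0" "\<And>Q. Q \<in> \<G> \<Longrightarrow> AE \<omega> in P. good Q (\<epsilon> Q) \<omega>"
    by metis
  obtain \<F> where \<F>: "\<F> \<subseteq> (\<lambda>Q. ball Q (\<epsilon> Q)) ` \<G>" "countable \<F>" "\<Union> \<F> = \<Union> ((\<lambda>Q. ball Q (\<epsilon> Q)) ` \<G>)"
    by (rule Lindelof[of "(\<lambda>Q. ball Q (\<epsilon> Q)) ` \<G>"]) auto
  have "\<exists>\<G>'. countable \<G>' \<and> \<G>' \<subseteq> \<G> \<and> \<F> = (\<lambda>Q. ball Q (\<epsilon> Q)) ` \<G>'"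
    by (rule countable_subset_image[THEN iffD1]) (intro conjI \<F>)
  then obtain \<G>' where \<G>': "\<G>' \<subseteq> \<G>" "countable \<G>'" "\<F> = (\<lambda>Q. ball Q (\<epsilon> Q)) ` \<G>'"
    by (elim exE conjE)
  have "AE \<omega> in P. \<forall>Q\<in>\<G>'. good Q (\<epsilon> Q) \<omega>"
    unfolding AE_ball_countable[OF \<G>'(2)] using \<epsilon>(2) \<G>'(1) by blast
  with coord have "AE \<omega> in P. percolation_set M X \<omega> \<noteq> {} \<longrightarrow>
      (\<forall>\<alpha>. orthonormal \<alpha> \<and> card \<alpha> = k \<longrightarrow> fat \<alpha> \<omega>)"
  proof eventually_elim
    case (elim \<omega>)
    show ?case
    proof (intro impI allI)
      fix \<alpha> :: "(real ^ 'd) set"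
      assume ne: "percolation_set M X \<omega> \<noteq> {}" and \<alpha>: "orthonormal \<alpha> \<and> card \<alpha> = k"
      show "fat \<alpha> \<omega>"
      proof (cases "oblique \<alpha>")
        case True
        have "dim U = dim (orthogonal_comp (span \<alpha>))"
          using U(2) \<alpha> dim_orthonormal_span(2)[of \<alpha>] by simp
        then obtain f where f: "linear f" "f ` U = orthogonal_comp (span \<alpha>)" "\<And>x. x \<in> U \<Longrightarrow> norm (f x) = norm x"
          by (rule isometry_subspaces[OF U(1) subspace_orthogonal_comp]) (rule that)
        define Q where "Q = matrix f"
        have Qf: "(*v) Q = f" using f(1) by (simp add: Q_def fun_eq_iff matrix_works)
        have Q: "isometric_on U Q" "orthogonal_comp (span \<alpha>) = (*v) Q ` U"
          using f by (simp_all add: isometric_on_def Qf)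
        then have "Q \<in> \<G>" using True unfolding \<G>_def by blast
        moreover have "Q \<in> ball Q (\<epsilon> Q)" using \<epsilon>(1)[OF \<open>Q \<in> \<G>\<close>] by simp
        ultimately have "Q \<in> \<Union> \<F>" unfolding \<F>(3) by blast
        then obtain Q' where "Q' \<in> \<G>'" "Q \<in> ball Q' (\<epsilon> Q')" unfolding \<G>'(3) by blast
        \<comment> \<open>The event attached to \<open>Q'\<close> covers all isometric matrices in
          its ball, in particular \<open>Q\<close>, and every \<open>\<alpha>\<close> whose
          orthogonal complement is the image of \<open>U\<close> under such a matrix.\<close>
        then show ?thesis using elim(2) ne Q unfolding good_def by blast
      next
        case False
        then show ?thesis using elim(1) ne \<alpha> by (auto simp: oblique_def)
      qed
    qed
  qed
  then show ?thesis by (simp add: fat_def)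
qed

end
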